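(* Let $m\ge 1$ and $n\ge 0$ be fixed integers and let $\Sigma_0,\Sigma_1,\dots,\Sigma_n\in\mathbb{R}^{m\times m}$ with $\Sigma_0=\Sigma_0^\top$ be such that the symmetric block-Toeplitz matrix $\mathbf{T}_n=\mathrm{Toepl}(\Sigma_0,\Sigma_1^\top,\dots,\Sigma_n^\top)$ is positive definite. Let $\{\hat\Sigma_k,\ k=n+1,n+2,\dots\}$ be the maximum entropy block-Toeplitz extension of $\{\Sigma_0,\dots,\Sigma_n\}$ (the solution of the TME problem, see context), and put $\hat\Sigma_k:=\Sigma_k$ for $0\le k\le n$. For $N>2n+1$ let $\boldsymbol{\Sigma}_N^{(c)}$ be the symmetric block-circulant $mN\times mN$ matrix $$\boldsymbol{\Sigma}_N^{(c)}=\mathrm{Toepl}\left(\hat\Sigma_0,\hat\Sigma_1^\top,\dots,\hat\Sigma_{\frac N2-1}^\top,\ \hat\Sigma_{\frac N2}^\top+\hat\Sigma_{\frac N2},\ \hat\Sigma_{\frac N2-1},\dots,\hat\Sigma_1\right)\quad\text{if } N \text{ is even},$$ $$\boldsymbol{\Sigma}_N^{(c)}=\mathrm{Toepl}\left(\hat\Sigma_0,\hat\Sigma_1^\top,\dots,\hat\Sigma_{\frac{N-1}2}^\top,\ \hat\Sigma_{\frac{N-1}2},\dots,\hat\Sigma_1\right)\quad\text{if } N \text{ is odd}.$$ Then, for $N$ large enough, $\boldsymbol{\Sigma}_N^{(c)}$ is a covariance matrix (i.e. it is positive definite), and, as $N\to\infty$, it is arbitrarily close to the $mN\times mN$ maximum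 entropy block-circulant extension $\boldsymbol{\Sigma}_N^{o}$ of $\mathbf{T}_n$ (the solution of the CME problem of size $N$, see context), i.e. $$\lim_{N\to\infty}\left\|\boldsymbol{\Sigma}_N^{(c)}-\boldsymbol{\Sigma}_N^{o}\right\|=0,$$ where $\|\cdot\|$ is the spectral norm.
   Context: All matrices are real. $\mathfrak{S}_N$ denotes the vector space of real symmetric $mN\times mN$ matrices, viewed as $N\times N$ block matrices with blocks of size $m\times m$. $\mathrm{Toepl}(X_0,X_1,\dots,X_{p})$, with $X_0=X_0^\top$, denotes the symmetric block-Toeplitz matrix with $(p+1)\times(p+1)$ blocks of size $m\times m$ whose first block row is $X_0,X_1,\dots,X_p$; that is, its $(i,j)$ block is $X_{j-i}$ if $j\ge i$ and $X_{i-j}^\top$ if $j<i$. $E_n$ is the $mN\times m(n+1)$ matrix whose top $m(n+1)$ rows form the identity $I_{m(n+1)}$ and whose other rows are zero; thus $E_n^\top\boldsymbol{\Sigma}E_n$ is the leading $m(n+1)\times m(n+1)$ principal submatrix of $\boldsymbol{\Sigma}$. A matrix $\mathbf{C}$ with $N\times N$ blocks of size $m\times m$ is block-circulant iff $\mathbf{U}_N^\top\mathbf{C}\,\mathbf{U}_N=\mathbf{C}$, where $\mathbf{U}_N$ is the block-circulant shift matrix (blocks $I_m$ in positions $(i,i+1)$, $i=1,\dots,N-1$, and $(N,1)$, zero blocks elsewhere). CME problem of size $N$: maximize $\log\det\boldsymbol{\Sigma}$ over $\boldsymbol{\Sigma}\in\mathfrak{S}_N$, $\boldsymbol{\Sigma}>0$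 (positive definite), subject to $E_n^\top\boldsymbol{\Sigma}E_n=\mathbf{T}_n$ and $\mathbf{U}_N^\top\boldsymbol{\Sigma}\mathbf{U}_N=\boldsymbol{\Sigma}$. Its (unique) solution, which exists for all sufficiently large $N$ when $\mathbf{T}_n>0$, is denoted $\boldsymbol{\Sigma}_N^{o}$. TME problem of size $N$: maximize $\log\det\boldsymbol{\Sigma}$ over $\boldsymbol{\Sigma}\in\mathfrak{S}_N$, $\boldsymbol{\Sigma}>0$, subject to $E_n^\top\boldsymbol{\Sigma}E_n=\mathbf{T}_n$ and to $\boldsymbol{\Sigma}$ being block-Toeplitz (blocks constant along block diagonals). The solutions for different $N$ are nested, so they define a single sequence: the maximum entropy block-Toeplitz extension $\{\hat\Sigma_k\}_{k\ge n+1}$ is the unique sequence of $m\times m$ matrices such that, with $\hat\Sigma_k=\Sigma_k$ for $k\le n$, the matrix $\mathrm{Toepl}(\hat\Sigma_0,\hat\Sigma_1^\top,\dots,\hat\Sigma_{N-1}^\top)$ solves the TME problem of size $N$ for every $N\ge n+1$. *)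

theory Defs
  imports Complex_Main "Jordan_Normal_Form.Determinant"
begin

text \<open>Block indices are 0-based throughout: in a matrix with blocks of size \<open>m \<times> m\<close>, the entry
  \<open>(r, c)\<close> belongs to block \<open>(r div m, c div m)\<close>.\<close>

definition sym_mats :: "nat \<Rightarrow> nat \<Rightarrow> real mat set" where
  "sym_mats m N = {A \<in> carrier_mat (m * N) (m * N). transpose_mat A = A}"

definition positive_definite :: "real mat \<Rightarrow> bool" where
  "positive_definite A \<longleftrightarrow> square_mat A \<and> transpose_mat A = A \<and>
     (\<forall>v \<in> carrier_vec (dim_row A). v \<noteq> 0\<^sub>v (dim_row A) \<longrightarrow> v \<bullet> (A *\<^sub>v v) > 0)"

definition block :: "nat \<Rightarrow> real mat \<Rightarrow> nat \<Rightarrow> nat \<Rightarrow> real mat" where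
  "block m A i j = mat m m (\<lambda>(a, b). A $$ (m * i + a, m * j + b))"

text \<open>\<open>Toepl m N X\<close> has \<open>N \<times> N\<close> blocks and first block row \<open>X 0, \<dots>, X (N - 1)\<close>.\<close>

definition Toepl :: "nat \<Rightarrow> nat \<Rightarrow> (nat \<Rightarrow> real mat) \<Rightarrow> real mat" where
  "Toepl m N X = mat (m * N) (m * N) (\<lambda>(r, c).
     let i = r div m; j = c div m
     in (if i \<le> j then X (j - i) else transpose_mat (X (i - j))) $$ (r mod m, c mod m))"

definition block_toeplitz :: "nat \<Rightarrow> nat \<Rightarrow> real mat \<Rightarrow> bool" where
  "block_toeplitz m N A \<longleftrightarrow>
     (\<forall>i<N. \<forall>j<N. \<forall>i'<N. \<forall>j'<N. int j - int i = int j' - int i' \<longrightarrow>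
        block m A i j = block m A i' j')"

definition E_mat :: "nat \<Rightarrow> nat \<Rightarrow> nat \<Rightarrow> real mat" where
  "E_mat m n N = mat (m * N) (m * (n + 1)) (\<lambda>(r, c). if r = c then 1 else 0)"

definition U_mat :: "nat \<Rightarrow> nat \<Rightarrow> real mat" where
  "U_mat m N = mat (m * N) (m * N) (\<lambda>(r, c).
     if c div m = (r div m + 1) mod N \<and> r mod m = c mod m then 1 else 0)"

definition CME_feasible :: "nat \<Rightarrow> nat \<Rightarrow> real mat \<Rightarrow> nat \<Rightarrow> real mat \<Rightarrow> bool" where
  "CME_feasible m n T N A \<longleftrightarrow>
     A \<in> sym_mats m N \<and> positive_definite A \<and>
     transpose_mat (E_mat m n N) * A * E_mat m n N = T \<and>
     transpose_mat (U_mat m N) * A * U_mat m N = A"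

definition CME_solution :: "nat \<Rightarrow> nat \<Rightarrow> real mat \<Rightarrow> nat \<Rightarrow> real mat \<Rightarrow> bool" where
  "CME_solution m n T N A \<longleftrightarrow> is_arg_max (\<lambda>B. ln (det B)) (CME_feasible m n T N) A"

definition TME_feasible :: "nat \<Rightarrow> nat \<Rightarrow> real mat \<Rightarrow> nat \<Rightarrow> real mat \<Rightarrow> bool" where
  "TME_feasible m n T N A \<longleftrightarrow>
     A \<in> sym_mats m N \<and> positive_definite A \<and>
     transpose_mat (E_mat m n N) * A * E_mat m n N = T \<and>
     block_toeplitz m N A"

definition TME_solution :: "nat \<Rightarrow> nat \<Rightarrow> real mat \<Rightarrow> nat \<Rightarrow> real mat \<Rightarrow> bool" where
  "TME_solution m n T N A \<longleftrightarrow> is_arg_max (\<lambda>B. ln (det B)) (TME_feasible m n T N) A"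

definition T_mat :: "nat \<Rightarrow> nat \<Rightarrow> (nat \<Rightarrow> real mat) \<Rightarrow> real mat" where
  "T_mat m n S = Toepl m (n + 1) (\<lambda>k. transpose_mat (S k))"

text \<open>\<open>Sh\<close> is the whole sequence, including the given terms \<open>S 0, \<dots>, S n\<close>.\<close>

definition max_entropy_toeplitz_extension ::
    "nat \<Rightarrow> nat \<Rightarrow> (nat \<Rightarrow> real mat) \<Rightarrow> (nat \<Rightarrow> real mat) \<Rightarrow> bool" where
  "max_entropy_toeplitz_extension m n S Sh \<longleftrightarrow>
     (\<forall>k. Sh k \<in> carrier_mat m m) \<and> (\<forall>k\<le>n. Sh k = S k) \<and>
     (\<forall>N\<ge>n + 1. TME_solution m n (T_mat m n S) N (Toepl m N (\<lambda>k. transpose_mat (Sh k))))"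

definition circulant_approx :: "nat \<Rightarrow> (nat \<Rightarrow> real mat) \<Rightarrow> nat \<Rightarrow> real mat" where
  "circulant_approx m Sh N =
     (if even N then
        Toepl m N (\<lambda>k. if k < N div 2 then transpose_mat (Sh k)
                       else if k = N div 2 then transpose_mat (Sh k) + Sh k
                       else Sh (N - k))
      else
        Toepl m N (\<lambda>k. if k \<le> (N - 1) div 2 then transpose_mat (Sh k)
                       else Sh (N - k)))"

definition vec_norm2 :: "real vec \<Rightarrow> real" where
  "vec_norm2 v = sqrt (v \<bullet> v)"

text \<open>The spectral norm is taken as the operator norm induced by the Euclidean norm.\<close>

definition spectral_norm :: "real mat \<Rightarrow> real" where
  "spectral_norm A = (SUP v \<in> {v \<in> carrier_vec (dim_col A). vec_norm2 v \<le> 1}. vec_norm2 (A *\<^sub>v v))"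

end

theory Submission
  imports Defs "HOL-Analysis.L2_Norm"
begin

text \<open>Write \<open>C\<^sub>N\<close> for the circulant matrix built from the maximum entropy extension, \<open>X\<^sub>N\<close> for the
solution of the circulant problem and \<open>Q\<^sub>N\<close> for the inverse of \<open>X\<^sub>N\<close>.  The proof compares the inverses,
because both of them are banded up to a small error, whereas covariances are not.

\<^item> Optimality means that the inverse of the maximizer is orthogonal to all admissible directions
  (\<open>ln_det_stationary\<close>).  For \<open>X\<^sub>N\<close> this says that the blocks of \<open>Q\<^sub>N\<close> vanish at cyclic distance more than
  \<open>n\<close> (\<open>CME_inverse_banded\<close>).  For the Toeplitz problem of size \<open>N\<close> it is enough to move the last covariance
  only: the corner block of the inverse vanishes (\<open>TME_inverse_corner\<close>).  Since this holds for
  every \<open>N\<close>, the first block row of the inverse does not depend on \<open>N\<close>, and the extended covariances satisfy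
  the Yule-Walker equations of order \<open>n\<close> at all positive lags (\<open>Yule_Walker\<close>).

\<^item> The Yule-Walker recursion, run backwards over a window of \<open>n + 1\<close> blocks, is a strict contraction for the
  covariance form of the window, simply because the covariance matrix of two adjacent windows is positive
  definite (\<open>contraction\<close>).  Hence the covariances decay exponentially (\<open>decay\<close>).

\<^item> Normalizing the Yule-Walker rows gives a banded block Toeplitz operator \<open>l\<close> that whitens the
  covariance kernel \<open>t\<close>, that is, \<open>l t l\<^sup>T = 1\<close> (\<open>factorization\<close>).  Wrapped around the circle, \<open>l\<close> becomes a
  banded circulant matrix \<open>L\<^sub>N\<close> of bounded norm with \<open>L\<^sub>N C\<^sub>N L\<^sub>N\<^sup>T = 1 + E\<^sub>N\<close>, and the norm of \<open>E\<^sub>N\<close> tends to \<open>0\<close> by the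
  decay (\<open>approximate_factorization\<close>).  So \<open>C\<^sub>N\<close> is positive definite for large \<open>N\<close>, the inverse of
  \<open>L\<^sub>N\<close> is bounded uniformly in \<open>N\<close>, and \<open>C\<^sub>N\<close> is close to the matrix \<open>G\<^sub>N\<close> whose inverse is the banded circulant
  matrix \<open>L\<^sub>N\<^sup>T L\<^sub>N\<close> (\<open>factor_inverse\<close>).

\<^item> Thus \<open>X\<^sub>N\<close> and \<open>G\<^sub>N\<close> both have banded circulant inverses, and they agree within the band up to a
  small error, because there \<open>X\<^sub>N\<close> agrees with \<open>C\<^sub>N\<close>.  The difference \<open>D = Q\<^sub>N - L\<^sub>N\<^sup>T L\<^sub>N\<close> sees only the band, so that the
  trace of \<open>D (G\<^sub>N - X\<^sub>N)\<close> is at most \<open>N\<close> times a small multiple of the size of \<open>D\<close>.  On the other hand \<open>G\<^sub>N - X\<^sub>N = X\<^sub>N D G\<^sub>N\<close>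
  turns that trace into a quadratic form in \<open>D\<close>, which is at least \<open>N\<close> times a multiple of the
  square of its size (\<open>inverse_difference_energy\<close>, \<open>circulant_frobenius_lower\<close>).  The factors \<open>N\<close>
  cancel, so \<open>D\<close> is small in norm, and therefore \<open>X\<^sub>N\<close> is close to \<open>G\<^sub>N\<close> and to \<open>C\<^sub>N\<close> (\<open>circulant_stability\<close>).

Everything is done with real matrices; spectral densities and eigenvalues are replaced by estimates of quadratic forms.\<close>

section \<open>Norms and positive definite matrices\<close>

lemma vec_norm2_eq_L2_set: "vec_norm2 v = L2_set (\<lambda>i. v $ i) {0..<dim_vec v}"
  unfolding vec_norm2_def L2_set_def scalar_prod_def by (simp add: power2_eq_square)

lemma vec_norm2_nonneg [simp]: "0 \<le> vec_norm2 v"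
  by (simp add: vec_norm2_eq_L2_set)

lemma vec_norm2_square: "(vec_norm2 v)\<^sup>2 = v \<bullet> v"
  unfolding vec_norm2_def by (rule real_sqrt_pow2) (simp add: scalar_prod_def sum_nonneg)

lemma scalar_prod_self_nonneg: "0 \<le> (v :: real vec) \<bullet> v"
  by (simp add: scalar_prod_def sum_nonneg)

lemma scalar_prod_self_eq_0:
  assumes "v \<in> carrier_vec n" "(v :: real vec) \<bullet> v = 0" shows "v = 0\<^sub>v n"
proof (rule eq_vecI)
  fix i assume i: "i < dim_vec (0\<^sub>v n)"
  have "\<forall>i\<in>{0..<dim_vec v}. v $ i * v $ i = 0"
    using assms(2) unfolding scalar_prod_def by (subst (asm) sum_nonneg_eq_0_iff) auto
  then show "v $ i = 0\<^sub>v n $ i" using i assms(1) by auto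
qed (use assms in auto)

lemma scalar_prod_self_pos:
  assumes "v \<in> carrier_vec n" "v \<noteq> 0\<^sub>v n" shows "0 < (v :: real vec) \<bullet> v"
  using scalar_prod_self_eq_0[OF assms(1)] scalar_prod_self_nonneg[of v] assms(2)
  by (metis order_less_le)

lemma abs_scalar_prod_le:
  assumes "v \<in> carrier_vec n" "w \<in> carrier_vec n"
  shows "\<bar>v \<bullet> w\<bar> \<le> vec_norm2 v * vec_norm2 w"
proof -
  have "\<bar>v \<bullet> w\<bar> \<le> (\<Sum>i\<in>{0..<n}. \<bar>v $ i\<bar> * \<bar>w $ i\<bar>)"
    using assms sum_abs[of "\<lambda>i. v $ i * w $ i" "{0..<n}"] by (simp add: scalar_prod_def abs_mult)
  also have "\<dots> \<le> vec_norm2 v * vec_norm2 w"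
    using L2_set_mult_ineq[of "\<lambda>i. v $ i" "\<lambda>i. w $ i" "{0..<n}"] assms
    by (simp add: vec_norm2_eq_L2_set)
  finally show ?thesis .
qed

lemma vec_norm2_triangle:
  assumes "v \<in> carrier_vec n" "w \<in> carrier_vec n"
  shows "vec_norm2 (v + w) \<le> vec_norm2 v + vec_norm2 w"
proof -
  have "vec_norm2 (v + w) = L2_set (\<lambda>i. v $ i + w $ i) {0..<n}"
    unfolding vec_norm2_eq_L2_set using assms by (intro L2_set_cong) auto
  also have "\<dots> \<le> vec_norm2 v + vec_norm2 w"
    using L2_set_triangle_ineq[of "\<lambda>i. v $ i" "\<lambda>i. w $ i" "{0..<n}"] assms
    by (simp add: vec_norm2_eq_L2_set)
  finally show ?thesis .
qed

definition op_bound :: "real mat \<Rightarrow> real \<Rightarrow> bool" where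
  "op_bound A K \<longleftrightarrow> 0 \<le> K \<and> (\<forall>v\<in>carrier_vec (dim_col A). vec_norm2 (A *\<^sub>v v) \<le> K * vec_norm2 v)"

lemma op_boundD:
  assumes "op_bound A K" "A \<in> carrier_mat nr nc" "v \<in> carrier_vec nc"
  shows "vec_norm2 (A *\<^sub>v v) \<le> K * vec_norm2 v"
  using assms unfolding op_bound_def by auto

lemma op_bound_nonneg: "op_bound A K \<Longrightarrow> 0 \<le> K"
  by (simp add: op_bound_def)

lemma op_bound_mono: "op_bound A K \<Longrightarrow> K \<le> K' \<Longrightarrow> op_bound A K'"
  unfolding op_bound_def by (meson mult_right_mono order_trans vec_norm2_nonneg)

lemma op_bound_mult:
  assumes A: "A \<in> carrier_mat nr n" and B: "B \<in> carrier_mat n nc"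
    and KA: "op_bound A KA" and KB: "op_bound B KB"
  shows "op_bound (A * B) (KA * KB)"
  unfolding op_bound_def
proof (intro conjI ballI)
  fix v :: "real vec" assume "v \<in> carrier_vec (dim_col (A * B))"
  then have v: "v \<in> carrier_vec nc" using B by auto
  have "vec_norm2 ((A * B) *\<^sub>v v) = vec_norm2 (A *\<^sub>v (B *\<^sub>v v))"
    using A B v by simp
  also have "\<dots> \<le> KA * vec_norm2 (B *\<^sub>v v)"
    by (rule op_boundD[OF KA A]) (use B v in auto)
  also have "\<dots> \<le> KA * (KB * vec_norm2 v)"
    by (rule mult_left_mono[OF op_boundD[OF KB B v] op_bound_nonneg[OF KA]])
  finally show "vec_norm2 ((A * B) *\<^sub>v v) \<le> KA * KB * vec_norm2 v" by simp
qed (use op_bound_nonneg KA KB in auto)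

lemma op_bound_add:
  assumes A: "A \<in> carrier_mat nr nc" and B: "B \<in> carrier_mat nr nc"
    and KA: "op_bound A KA" and KB: "op_bound B KB"
  shows "op_bound (A + B) (KA + KB)"
  unfolding op_bound_def
proof (intro conjI ballI)
  fix v :: "real vec" assume "v \<in> carrier_vec (dim_col (A + B))"
  then have v: "v \<in> carrier_vec nc" using B by auto
  have "vec_norm2 ((A + B) *\<^sub>v v) = vec_norm2 (A *\<^sub>v v + B *\<^sub>v v)"
    using A B v by (simp add: add_mult_distrib_mat_vec)
  also have "\<dots> \<le> vec_norm2 (A *\<^sub>v v) + vec_norm2 (B *\<^sub>v v)"
    by (rule vec_norm2_triangle[of _ nr]) (use A B v in auto)
  also have "\<dots> \<le> (KA + KB) * vec_norm2 v"
    using op_boundD[OF KA A v] op_boundD[OF KB B v] by (simp add: distrib_right)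
  finally show "vec_norm2 ((A + B) *\<^sub>v v) \<le> (KA + KB) * vec_norm2 v" .
qed (use op_bound_nonneg KA KB in auto)

lemma op_bound_transpose:
  assumes A: "A \<in> carrier_mat nr nc" and K: "op_bound A K"
  shows "op_bound (transpose_mat A) K"
  unfolding op_bound_def
proof (intro conjI ballI)
  fix v :: "real vec" assume "v \<in> carrier_vec (dim_col (transpose_mat A))"
  then have v: "v \<in> carrier_vec nr" using A by auto
  let ?w = "transpose_mat A *\<^sub>v v"
  have w: "?w \<in> carrier_vec nc" using A v by auto
  have "vec_norm2 ?w * vec_norm2 ?w = v \<bullet> (A *\<^sub>v ?w)"
    using transpose_vec_mult_scalar[OF A w v] vec_norm2_square[of ?w]
    by (simp add: power2_eq_square)
  also have "\<dots> \<le> vec_norm2 v * vec_norm2 (A *\<^sub>v ?w)"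
    using abs_scalar_prod_le[OF v, of "A *\<^sub>v ?w"] A w by auto
  also have "\<dots> \<le> vec_norm2 v * (K * vec_norm2 ?w)"
    by (intro mult_left_mono op_boundD[OF K A w]) auto
  finally have "vec_norm2 ?w * vec_norm2 ?w \<le> (K * vec_norm2 v) * vec_norm2 ?w" by (simp add: mult_ac)
  then show "vec_norm2 ?w \<le> K * vec_norm2 v"
    using op_bound_nonneg[OF K] vec_norm2_nonneg[of ?w]
    by (cases "vec_norm2 ?w = 0") auto
qed (use op_bound_nonneg K in auto)

text \<open>The Schur test: apply the Cauchy-Schwarz inequality to a row of \<open>A\<close> with weights \<open>\<bar>A\<^sub>i\<^sub>j\<bar>\<close>; the row sums bound the
first factor, and summing the second factor over the rows brings in the column sums.\<close>

lemma op_bound_schur_test: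
  assumes A: "A \<in> carrier_mat nr nc" and K: "0 \<le> K"
    and rows: "\<And>i. i < nr \<Longrightarrow> (\<Sum>j<nc. \<bar>A $$ (i, j)\<bar>) \<le> K"
    and cols: "\<And>j. j < nc \<Longrightarrow> (\<Sum>i<nr. \<bar>A $$ (i, j)\<bar>) \<le> K"
  shows "op_bound A K"
  unfolding op_bound_def
proof (intro conjI ballI K)
  fix v :: "real vec" assume "v \<in> carrier_vec (dim_col A)"
  then have v: "v \<in> carrier_vec nc" using A by auto
  have row: "((A *\<^sub>v v) $ i)\<^sup>2 \<le> K * (\<Sum>j<nc. \<bar>A $$ (i, j)\<bar> * (v $ j)\<^sup>2)" if i: "i < nr" for i
  proof -
    have "(A *\<^sub>v v) $ i = (\<Sum>j<nc. A $$ (i, j) * v $ j)"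
      using A v i by (auto simp: scalar_prod_def intro!: sum.cong)
    then have "\<bar>(A *\<^sub>v v) $ i\<bar> \<le> (\<Sum>j<nc. \<bar>A $$ (i, j) * v $ j\<bar>)"
      by simp
    also have "\<dots> = (\<Sum>j<nc. \<bar>sqrt \<bar>A $$ (i, j)\<bar>\<bar> * \<bar>sqrt \<bar>A $$ (i, j)\<bar> * v $ j\<bar>)"
      by (intro sum.cong) (auto simp: abs_mult mult.assoc[symmetric])
    also have "\<dots> \<le> L2_set (\<lambda>j. sqrt \<bar>A $$ (i, j)\<bar>) {..<nc} * L2_set (\<lambda>j. sqrt \<bar>A $$ (i, j)\<bar> * v $ j) {..<nc}"
      by (rule L2_set_mult_ineq)
    finally have "\<bar>(A *\<^sub>v v) $ i\<bar>\<^sup>2 \<le> (L2_set (\<lambda>j. sqrt \<bar>A $$ (i, j)\<bar>) {..<nc} * L2_set (\<lambda>j. sqrt \<bar>A $$ (i, j)\<bar> * v $ j) {..<nc})\<^sup>2"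
      by (rule power_mono) simp
    also have "\<dots> = (\<Sum>j<nc. \<bar>A $$ (i, j)\<bar>) * (\<Sum>j<nc. \<bar>A $$ (i, j)\<bar> * (v $ j)\<^sup>2)"
      unfolding L2_set_def power_mult_distrib by (simp add: sum_nonneg)
    also have "\<dots> \<le> K * (\<Sum>j<nc. \<bar>A $$ (i, j)\<bar> * (v $ j)\<^sup>2)"
      by (intro mult_right_mono rows i sum_nonneg) auto
    finally show ?thesis by simp
  qed
  have "(vec_norm2 (A *\<^sub>v v))\<^sup>2 = (\<Sum>i<nr. ((A *\<^sub>v v) $ i)\<^sup>2)"
    unfolding vec_norm2_square scalar_prod_def using A
    by (simp add: lessThan_atLeast0 power2_eq_square)
  also have "\<dots> \<le> (\<Sum>i<nr. K * (\<Sum>j<nc. \<bar>A $$ (i, j)\<bar> * (v $ j)\<^sup>2))"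
    by (intro sum_mono row) auto
  also have "\<dots> = K * (\<Sum>i<nr. \<Sum>j<nc. \<bar>A $$ (i, j)\<bar> * (v $ j)\<^sup>2)"
    by (simp only: sum_distrib_left)
  also have "(\<Sum>i<nr. \<Sum>j<nc. \<bar>A $$ (i, j)\<bar> * (v $ j)\<^sup>2) = (\<Sum>j<nc. \<Sum>i<nr. \<bar>A $$ (i, j)\<bar> * (v $ j)\<^sup>2)"
    by (rule sum.swap)
  also have "\<dots> = (\<Sum>j<nc. (\<Sum>i<nr. \<bar>A $$ (i, j)\<bar>) * (v $ j)\<^sup>2)"
    by (simp only: sum_distrib_right)
  also have "K * (\<Sum>j<nc. (\<Sum>i<nr. \<bar>A $$ (i, j)\<bar>) * (v $ j)\<^sup>2) \<le> K * (\<Sum>j<nc. K * (v $ j)\<^sup>2)"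
    by (rule mult_left_mono[OF sum_mono K], rule mult_right_mono) (auto intro: cols)
  also have "\<dots> = (K * vec_norm2 v)\<^sup>2"
    unfolding power_mult_distrib vec_norm2_square scalar_prod_def using v
    by (simp add: lessThan_atLeast0 power2_eq_square sum_distrib_left mult_ac)
  finally show "vec_norm2 (A *\<^sub>v v) \<le> K * vec_norm2 v"
    by (rule power2_le_imp_le) (use K in auto)
qed

lemma spectral_norm_bounds:
  assumes "op_bound A K"
  shows "0 \<le> spectral_norm A" "spectral_norm A \<le> K"
proof -
  let ?S = "{v \<in> carrier_vec (dim_col A). vec_norm2 v \<le> 1}"
  have z: "0\<^sub>v (dim_col A) \<in> ?S" by (simp add: vec_norm2_def)
  have le: "vec_norm2 (A *\<^sub>v v) \<le> K" if "v \<in> ?S" for v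
    using assms that mult_left_mono[of "vec_norm2 v" 1 K] unfolding op_bound_def by fastforce
  show "spectral_norm A \<le> K"
    unfolding spectral_norm_def by (rule cSUP_least) (use z in blast, use le in blast)
  have "vec_norm2 (A *\<^sub>v 0\<^sub>v (dim_col A)) \<le> spectral_norm A"
    unfolding spectral_norm_def
    by (rule cSUP_upper[OF z]) (use le in \<open>auto simp: bdd_above_def\<close>)
  then show "0 \<le> spectral_norm A"
    using vec_norm2_nonneg order_trans by blast
qed

lemma positive_definiteD:
  assumes "positive_definite A" "A \<in> carrier_mat n n" "v \<in> carrier_vec n" "v \<noteq> 0\<^sub>v n"
  shows "0 < v \<bullet> (A *\<^sub>v v)"
  using assms unfolding positive_definite_def by auto

lemma positive_definite_nonneg:
  assumes "positive_definite A" "A \<in> carrier_mat n n" "v \<in> carrier_vec n"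
  shows "0 \<le> v \<bullet> (A *\<^sub>v v)"
proof (cases "v = 0\<^sub>v n")
  case True
  then show ?thesis using assms by (simp add: scalar_prod_def)
qed (use positive_definiteD[OF assms] in simp)

lemma positive_definite_sym: "positive_definite A \<Longrightarrow> transpose_mat A = A"
  by (simp add: positive_definite_def)

lemma symmetric_index:
  assumes "transpose_mat A = A" "A \<in> carrier_mat n n" "i < n" "j < n"
  shows "A $$ (i, j) = A $$ (j, i)"
  using assms by (metis carrier_matD index_transpose_mat(1))

lemma positive_definiteI:
  assumes "A \<in> carrier_mat n n" "transpose_mat A = A"
    "\<And>v. v \<in> carrier_vec n \<Longrightarrow> v \<noteq> 0\<^sub>v n \<Longrightarrow> 0 < v \<bullet> (A *\<^sub>v v)"
  shows "positive_definite A"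
  using assms unfolding positive_definite_def by auto

lemma nonsingular_inverse:
  fixes A :: "real mat"
  assumes A: "A \<in> carrier_mat n n"
    and inj: "\<And>v. v \<in> carrier_vec n \<Longrightarrow> A *\<^sub>v v = 0\<^sub>v n \<Longrightarrow> v = 0\<^sub>v n"
  obtains B where "B \<in> carrier_mat n n" "A * B = 1\<^sub>m n" "B * A = 1\<^sub>m n"
proof -
  have "det A \<noteq> 0" using det_0_iff_vec_prod_zero_field[OF A] inj by blast
  from det_non_zero_imp_unit[OF A this, of "()"] show thesis
    using that unfolding Units_def ring_mat_def by auto
qed

lemma symmetric_inverse:
  fixes A :: "real mat"
  assumes A: "A \<in> carrier_mat n n" and B: "B \<in> carrier_mat n n"
    and AB: "A * B = 1\<^sub>m n" and sym: "transpose_mat A = A"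
  shows "transpose_mat B = B"
proof -
  have BtA: "transpose_mat B * A = 1\<^sub>m n"
    using arg_cong[OF AB, of transpose_mat] transpose_mult[OF A B] sym by simp
  have "transpose_mat B = transpose_mat B * (A * B)" using AB B by simp
  also have "\<dots> = B" using BtA A B assoc_mult_mat[of "transpose_mat B" n n A n B n] by simp
  finally show ?thesis .
qed

lemma positive_definite_inverse:
  assumes A: "A \<in> carrier_mat n n" and pd: "positive_definite A"
  obtains B where "B \<in> carrier_mat n n" "A * B = 1\<^sub>m n" "B * A = 1\<^sub>m n" "transpose_mat B = B"
proof -
  have "v = 0\<^sub>v n" if v: "v \<in> carrier_vec n" "A *\<^sub>v v = 0\<^sub>v n" for v
    using positive_definiteD[OF pd A v(1)] v by (cases "v = 0\<^sub>v n") auto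
  from nonsingular_inverse[OF A this] obtain B where
    B: "B \<in> carrier_mat n n" "A * B = 1\<^sub>m n" "B * A = 1\<^sub>m n" by metis
  then show thesis using that symmetric_inverse[OF A B(1,2) positive_definite_sym[OF pd]] by auto
qed

lemma quadratic_form_add:
  fixes A :: "real mat"
  assumes A: "A \<in> carrier_mat n n" "transpose_mat A = A" and x: "x \<in> carrier_vec n" and y: "y \<in> carrier_vec n"
  shows "(x + s \<cdot>\<^sub>v y) \<bullet> (A *\<^sub>v (x + s \<cdot>\<^sub>v y)) = x \<bullet> (A *\<^sub>v x) + 2 * s * (x \<bullet> (A *\<^sub>v y)) + s\<^sup>2 * (y \<bullet> (A *\<^sub>v y))"
proof -
  have Ax: "A *\<^sub>v x \<in> carrier_vec n" "A *\<^sub>v y \<in> carrier_vec n" using A x y by auto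
  have yx: "y \<bullet> (A *\<^sub>v x) = x \<bullet> (A *\<^sub>v y)"
    using transpose_vec_mult_scalar[OF A(1) x y] A(2) comm_scalar_prod[OF Ax(2) x] by simp
  have e: "A *\<^sub>v (x + s \<cdot>\<^sub>v y) = A *\<^sub>v x + s \<cdot>\<^sub>v (A *\<^sub>v y)"
    using A x y by (simp add: mult_add_distrib_mat_vec mult_mat_vec)
  have "(x + s \<cdot>\<^sub>v y) \<bullet> (A *\<^sub>v x + s \<cdot>\<^sub>v (A *\<^sub>v y)) = x \<bullet> (A *\<^sub>v x) + s * (x \<bullet> (A *\<^sub>v y)) + (s * (y \<bullet> (A *\<^sub>v x)) + s * (s * (y \<bullet> (A *\<^sub>v y))))"
    using x y Ax by (simp add: add_scalar_prod_distrib[of _ n] scalar_prod_add_distrib[of _ n] scalar_prod_smult_distrib[of _ n] smult_scalar_prod_distrib[of _ n] algebra_simps)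
  then show ?thesis unfolding e yx by (simp add: power2_eq_square algebra_simps)
qed

lemma positive_definite_Cauchy_Schwarz:
  assumes A: "A \<in> carrier_mat n n" "positive_definite A" and x: "x \<in> carrier_vec n" and y: "y \<in> carrier_vec n"
  shows "(x \<bullet> (A *\<^sub>v y))\<^sup>2 \<le> (x \<bullet> (A *\<^sub>v x)) * (y \<bullet> (A *\<^sub>v y))"
proof (cases "y = 0\<^sub>v n")
  case True
  then have "A *\<^sub>v y = 0\<^sub>v n" using A by (auto simp: scalar_prod_def intro!: eq_vecI)
  then show ?thesis using True x by simp
next
  case False
  let ?a = "y \<bullet> (A *\<^sub>v y)" and ?b = "x \<bullet> (A *\<^sub>v y)" and ?c = "x \<bullet> (A *\<^sub>v x)"
  have a: "0 < ?a" using positive_definiteD[OF A(2,1) y False] .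
  have "0 \<le> ?c + 2 * (- ?b / ?a) * ?b + (- ?b / ?a)\<^sup>2 * ?a"
    using quadratic_form_add[OF A(1) positive_definite_sym[OF A(2)] x y, of "- ?b / ?a"]
      positive_definite_nonneg[OF A(2,1), of "x + (- ?b / ?a) \<cdot>\<^sub>v y"] x y by simp
  also have "\<dots> = ?c - ?b\<^sup>2 / ?a" using a by (simp add: power2_eq_square field_simps)
  finally show ?thesis using a by (simp add: field_simps)
qed

text \<open>An upper bound for the inverse \<open>B\<close> is a lower bound for \<open>A\<close>.  Instead of eigenvalues, the
proof uses the Cauchy-Schwarz inequality of the form \<open>A\<close> for the vectors \<open>x\<close> and \<open>B x\<close>.\<close>

lemma positive_definite_lower_bound:
  assumes A: "A \<in> carrier_mat n n" "positive_definite A" and B: "B \<in> carrier_mat n n" "A * B = 1\<^sub>m n"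
    and K: "op_bound B K" and x: "x \<in> carrier_vec n"
  shows "x \<bullet> x \<le> K * (x \<bullet> (A *\<^sub>v x))"
proof -
  let ?y = "B *\<^sub>v x"
  have y: "?y \<in> carrier_vec n" using B x by auto
  have Ay: "A *\<^sub>v ?y = x" using assoc_mult_mat_vec[OF A(1) B(1) x] B(2) x by simp
  have "?y \<bullet> x \<le> vec_norm2 ?y * vec_norm2 x" using abs_scalar_prod_le[OF y x] by auto
  also have "\<dots> \<le> K * vec_norm2 x * vec_norm2 x"
    by (rule mult_right_mono[OF op_boundD[OF K B(1) x]]) simp
  also have "\<dots> = K * (x \<bullet> x)" by (simp add: vec_norm2_square[symmetric] power2_eq_square)
  finally have yx: "?y \<bullet> x \<le> K * (x \<bullet> x)" .
  have "(x \<bullet> x)\<^sup>2 \<le> (x \<bullet> (A *\<^sub>v x)) * (?y \<bullet> x)"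
    using positive_definite_Cauchy_Schwarz[OF A x y] Ay by simp
  also have "\<dots> \<le> (x \<bullet> (A *\<^sub>v x)) * (K * (x \<bullet> x))"
    by (rule mult_left_mono[OF yx positive_definite_nonneg[OF A(2,1) x]])
  finally have "(x \<bullet> x) * (x \<bullet> x) \<le> (K * (x \<bullet> (A *\<^sub>v x))) * (x \<bullet> x)"
    by (simp add: power2_eq_square mult_ac)
  then show ?thesis
    using scalar_prod_self_nonneg[of x] op_bound_nonneg[OF K] positive_definite_nonneg[OF A(2,1) x]
    by (cases "x \<bullet> x = 0") auto
qed

lemma op_bound_exists:
  assumes A: "A \<in> carrier_mat nr nc" obtains K where "op_bound A K" "0 < K"
proof -
  define K where "K = 1 + (\<Sum>i<nr. \<Sum>j<nc. \<bar>A $$ (i, j)\<bar>)"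
  have "op_bound A K"
  proof (rule op_bound_schur_test[OF A])
    show "0 \<le> K" unfolding K_def by (simp add: add_nonneg_nonneg sum_nonneg)
    show "(\<Sum>j<nc. \<bar>A $$ (i, j)\<bar>) \<le> K" if "i < nr" for i
    proof -
      have "(\<Sum>j<nc. \<bar>A $$ (i, j)\<bar>) \<le> (\<Sum>i<nr. \<Sum>j<nc. \<bar>A $$ (i, j)\<bar>)"
        by (rule member_le_sum[of i "{..<nr}" "\<lambda>i. \<Sum>j<nc. \<bar>A $$ (i, j)\<bar>"]) (use that in \<open>auto intro: sum_nonneg\<close>)
      then show ?thesis unfolding K_def by simp
    qed
    show "(\<Sum>i<nr. \<bar>A $$ (i, j)\<bar>) \<le> K" if "j < nc" for j
    proof -
      have "(\<Sum>i<nr. \<bar>A $$ (i, j)\<bar>) \<le> (\<Sum>j<nc. \<Sum>i<nr. \<bar>A $$ (i, j)\<bar>)"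
        by (rule member_le_sum[of j "{..<nc}" "\<lambda>j. \<Sum>i<nr. \<bar>A $$ (i, j)\<bar>"]) (use that in \<open>auto intro: sum_nonneg\<close>)
      also have "\<dots> = (\<Sum>i<nr. \<Sum>j<nc. \<bar>A $$ (i, j)\<bar>)" by (rule sum.swap)
      finally show ?thesis unfolding K_def by simp
    qed
  qed
  moreover have "0 < K" unfolding K_def by (simp add: add_pos_nonneg sum_nonneg)
  ultimately show thesis using that by blast
qed

lemma positive_definite_coercive:
  assumes A: "A \<in> carrier_mat n n" "positive_definite A"
  obtains \<mu> where "0 < \<mu>" "\<And>x. x \<in> carrier_vec n \<Longrightarrow> \<mu> * (x \<bullet> x) \<le> x \<bullet> (A *\<^sub>v x)"
proof -
  obtain B where B: "B \<in> carrier_mat n n" "A * B = 1\<^sub>m n"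
    using positive_definite_inverse[OF A] by metis
  obtain K where K: "op_bound B K" "0 < K" using op_bound_exists[OF B(1)] .
  show thesis
    using that[of "1 / K"] positive_definite_lower_bound[OF A B K(1)] K(2) by (auto simp: field_simps)
qed

section \<open>Stationary points of the log-determinant\<close>

text \<open>In the Leibniz expansion a permutation other than the identity contributes at least two off-diagonal
factors, each of order \<open>s\<close>, so only the diagonal product has a derivative at \<open>0\<close>.\<close>

lemma det_perturbation_derivative:
  fixes X :: "real mat"
  assumes X: "X \<in> carrier_mat n n"
  shows "((\<lambda>s. det (1\<^sub>m n + s \<cdot>\<^sub>m X)) has_real_derivative (\<Sum>i<n. X $$ (i, i))) (at 0)"
proof -
  let ?P = "{p. p permutes {0..<n}}"
  let ?e = "\<lambda>i j. if i = j then 1 else 0 :: real"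
  have fin: "finite ?P" by (rule finite_permutations) simp
  have det: "det (1\<^sub>m n + s \<cdot>\<^sub>m X) = (\<Sum>p\<in>?P. signof p * (\<Prod>i=0..<n. ?e i (p i) + s * X $$ (i, p i)))" for s
    by (subst det_def'[of _ n]) (use X permutes_in_image in \<open>fastforce intro!: sum.cong prod.cong\<close>)+
  let ?D = "\<lambda>p. signof p * (\<Sum>i=0..<n. X $$ (i, p i) * (\<Prod>j\<in>{0..<n} - {i}. ?e j (p j)))"
  have prod: "((\<lambda>s. \<Prod>i=0..<n. ?e i (p i) + s * X $$ (i, p i)) has_real_derivative
      (\<Sum>i=0..<n. X $$ (i, p i) * (\<Prod>j\<in>{0..<n} - {i}. ?e j (p j)))) (at 0)" for p
    by (rule has_field_derivative_prod[THEN DERIV_cong]) (auto intro!: derivative_eq_intros)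
  have "((\<lambda>s. det (1\<^sub>m n + s \<cdot>\<^sub>m X)) has_real_derivative (\<Sum>p\<in>?P. ?D p)) (at 0)"
    unfolding det by (intro DERIV_sum DERIV_cmult prod)
  also have "(\<Sum>p\<in>?P. ?D p) = (\<Sum>p\<in>{id}. ?D p)"
  proof (rule sum.mono_neutral_right[OF fin])
    show "{id} \<subseteq> ?P" by (auto simp: permutes_id)
    show "\<forall>p\<in>?P - {id}. ?D p = 0"
    proof
      fix p assume p: "p \<in> ?P - {id}"
      \<comment> \<open>a permutation other than the identity moves at least two points\<close>
      have moved: "\<exists>j\<in>{0..<n} - {i}. p j \<noteq> j" for i
      proof (rule ccontr)
        assume "\<not> ?thesis"
        then have fixed: "p j = j" if "j \<noteq> i" for j
          using that p by (cases "j \<in> {0..<n}") (auto simp: permutes_def)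
        have "inj p" using p by (auto intro: permutes_inj)
        then have "p i = i" using fixed by (metis injD)
        then have "p = id" using fixed by (auto simp: fun_eq_iff) metis
        then show False using p by simp
      qed
      have zero: "(\<Prod>j\<in>{0..<n} - {i}. ?e j (p j)) = 0" for i
      proof -
        obtain j where j: "j \<in> {0..<n} - {i}" "p j \<noteq> j" using moved by blast
        then have "?e j (p j) = 0" by auto
        with j(1) show ?thesis by (intro prod_zero bexI[of _ j]) auto
      qed
      show "?D p = 0" unfolding zero by simp
    qed
  qed
  also have "\<dots> = (\<Sum>i<n. X $$ (i, i))"
    by (simp add: lessThan_atLeast0)
  finally show ?thesis .
qed

lemma continuous_det_line:
  fixes A H :: "real mat"
  assumes "A \<in> carrier_mat n n" "H \<in> carrier_mat n n"
  shows "continuous_on UNIV (\<lambda>s. det (A + s \<cdot>\<^sub>m H))"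
proof -
  let ?P = "{p. p permutes {0..<n}}"
  have det: "det (A + s \<cdot>\<^sub>m H) = (\<Sum>p\<in>?P. signof p * (\<Prod>i=0..<n. A $$ (i, p i) + s * H $$ (i, p i)))" for s
    by (subst det_def'[of _ n]) (use assms permutes_in_image in \<open>fastforce intro!: sum.cong prod.cong\<close>)+
  show ?thesis unfolding det by (intro continuous_intros)
qed

text \<open>On the segment from the identity matrix to \<open>A\<close> all matrices are positive definite, so the determinant
cannot change sign.\<close>

lemma det_positive_definite_pos:
  assumes A: "A \<in> carrier_mat n n" and pd: "positive_definite A"
  shows "0 < det A"
proof (rule ccontr)
  assume "\<not> ?thesis"
  then have neg: "det A \<le> 0" by simp
  let ?H = "A - 1\<^sub>m n"
  let ?f = "\<lambda>s. det (1\<^sub>m n + s \<cdot>\<^sub>m ?H)"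
  have H: "?H \<in> carrier_mat n n" using A by auto
  have f0: "?f 0 = 1" by (subst arg_cong[of _ "1\<^sub>m n" det]) (use A in auto)
  have f1: "?f 1 = det A" by (rule arg_cong[of _ _ det]) (use A in auto)
  have "\<exists>s\<ge>0. s \<le> 1 \<and> ?f s = 0"
    by (rule IVT2') (use neg f0 f1 continuous_on_subset[OF continuous_det_line[OF one_carrier_mat H]] in auto)
  then obtain s where s: "0 \<le> s" "s \<le> 1" "?f s = 0" by blast
  have M: "1\<^sub>m n + s \<cdot>\<^sub>m ?H \<in> carrier_mat n n" using A by auto
  from s(3) obtain v where v: "v \<in> carrier_vec n" "v \<noteq> 0\<^sub>v n" "(1\<^sub>m n + s \<cdot>\<^sub>m ?H) *\<^sub>v v = 0\<^sub>v n"
    using det_0_iff_vec_prod_zero_field[OF M] by blast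
  have e: "1\<^sub>m n + s \<cdot>\<^sub>m ?H = (1 - s) \<cdot>\<^sub>m 1\<^sub>m n + s \<cdot>\<^sub>m A"
    using A by (intro eq_matI) (auto simp: algebra_simps)
  have sv: "(c \<cdot>\<^sub>m B) *\<^sub>v v = c \<cdot>\<^sub>v (B *\<^sub>v v)" if "B \<in> carrier_mat n n" for c B
    using that v by (intro eq_vecI) (auto simp: scalar_prod_def sum_distrib_left mult_ac)
  have Av: "A *\<^sub>v v \<in> carrier_vec n" using A v by auto
  have "(1\<^sub>m n + s \<cdot>\<^sub>m ?H) *\<^sub>v v = (1 - s) \<cdot>\<^sub>v v + s \<cdot>\<^sub>v (A *\<^sub>v v)"
    unfolding e using v A by (subst add_mult_distrib_mat_vec[of _ n n]) (auto simp: sv)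
  then have "v \<bullet> ((1 - s) \<cdot>\<^sub>v v + s \<cdot>\<^sub>v (A *\<^sub>v v)) = 0"
    using v(3) scalar_prod_right_zero[OF v(1)] by metis
  then have "(1 - s) * (v \<bullet> v) + s * (v \<bullet> (A *\<^sub>v v)) = 0"
    using v Av by (simp add: scalar_prod_add_distrib[of _ n] scalar_prod_smult_distrib[of _ n])
  moreover have "0 < v \<bullet> v" "0 < v \<bullet> (A *\<^sub>v v)"
    using scalar_prod_self_pos[OF v(1,2)] positive_definiteD[OF pd A v(1,2)] by auto
  ultimately show False using s
    by (smt (verit) mult_nonneg_nonneg mult_pos_pos)
qed

lemma positive_definite_perturb:
  assumes A: "A \<in> carrier_mat n n" "positive_definite A"
    and H: "H \<in> carrier_mat n n" "transpose_mat H = H"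
  obtains e where "0 < e" "\<And>s. \<bar>s\<bar> < e \<Longrightarrow> positive_definite (A + s \<cdot>\<^sub>m H)"
proof -
  obtain \<mu> where mu: "0 < \<mu>" "\<And>x. x \<in> carrier_vec n \<Longrightarrow> \<mu> * (x \<bullet> x) \<le> x \<bullet> (A *\<^sub>v x)"
    using positive_definite_coercive[OF A] by blast
  obtain K where K: "op_bound H K" "0 < K" using op_bound_exists[OF H(1)] .
  show thesis
  proof (rule that[of "\<mu> / K"])
    show "0 < \<mu> / K" using mu K by simp
    fix s assume s: "\<bar>s\<bar> < \<mu> / K"
    show "positive_definite (A + s \<cdot>\<^sub>m H)"
    proof (rule positive_definiteI)
      show "A + s \<cdot>\<^sub>m H \<in> carrier_mat n n" using A H by auto
      show "transpose_mat (A + s \<cdot>\<^sub>m H) = A + s \<cdot>\<^sub>m H"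
        using symmetric_index[OF positive_definite_sym[OF A(2)] A(1)] symmetric_index[OF H(2,1)] A(1) H(1)
        by (intro eq_matI) auto
      fix v :: "real vec" assume v: "v \<in> carrier_vec n" "v \<noteq> 0\<^sub>v n"
      have Hv: "H *\<^sub>v v \<in> carrier_vec n" using H v by auto
      have sv: "(s \<cdot>\<^sub>m H) *\<^sub>v v = s \<cdot>\<^sub>v (H *\<^sub>v v)"
        using H v by (intro eq_vecI) (auto simp: scalar_prod_def sum_distrib_left mult_ac)
      have e: "v \<bullet> ((A + s \<cdot>\<^sub>m H) *\<^sub>v v) = v \<bullet> (A *\<^sub>v v) + s * (v \<bullet> (H *\<^sub>v v))"
        using A H v Hv by (subst add_mult_distrib_mat_vec[of _ n n])
          (auto simp: sv scalar_prod_add_distrib[of _ n] scalar_prod_smult_distrib[of _ n])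
      have pos: "0 < v \<bullet> v" by (rule scalar_prod_self_pos[OF v])
      have "\<bar>v \<bullet> (H *\<^sub>v v)\<bar> \<le> vec_norm2 v * (K * vec_norm2 v)"
        using abs_scalar_prod_le[OF v(1) Hv] mult_left_mono[OF op_boundD[OF K(1) H(1) v(1)], of "vec_norm2 v"] by simp
      also have "\<dots> = K * (v \<bullet> v)" by (simp add: vec_norm2_square[symmetric] power2_eq_square)
      finally have "\<bar>s * (v \<bullet> (H *\<^sub>v v))\<bar> \<le> \<bar>s\<bar> * (K * (v \<bullet> v))"
        unfolding abs_mult by (rule mult_left_mono) simp
      also have "\<dots> < \<mu> * (v \<bullet> v)"
        using s K pos by (simp add: field_simps)
      finally show "0 < v \<bullet> ((A + s \<cdot>\<^sub>m H) *\<^sub>v v)"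
        unfolding e using mu(2)[OF v(1)] by linarith
    qed
  qed
qed

text \<open>The derivative of the log-determinant at \<open>A\<close> in the direction \<open>H\<close> is the trace of \<open>A\<^sup>-\<^sup>1 H\<close>.  The maximality
hypothesis concerns all positive definite matrices on the line; those with small \<open>s\<close> are
positive definite, which makes \<open>s = 0\<close> a local maximum.\<close>

lemma ln_det_stationary:
  assumes A: "A \<in> carrier_mat n n" "positive_definite A"
    and H: "H \<in> carrier_mat n n" "transpose_mat H = H"
    and B: "B \<in> carrier_mat n n" "A * B = 1\<^sub>m n"
    and max: "\<And>s. positive_definite (A + s \<cdot>\<^sub>m H) \<Longrightarrow> ln (det (A + s \<cdot>\<^sub>m H)) \<le> ln (det A)"
  shows "(\<Sum>i<n. \<Sum>j<n. B $$ (i, j) * H $$ (j, i)) = 0"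
proof -
  obtain e where e: "0 < e" "\<And>s. \<bar>s\<bar> < e \<Longrightarrow> positive_definite (A + s \<cdot>\<^sub>m H)"
    using positive_definite_perturb[OF A H] by blast
  let ?f = "\<lambda>s. det (1\<^sub>m n + s \<cdot>\<^sub>m (B * H))"
  have BH: "B * H \<in> carrier_mat n n" using B H by auto
  have "A * (1\<^sub>m n + s \<cdot>\<^sub>m (B * H)) = A + s \<cdot>\<^sub>m H" for s
  proof -
    have "A * (1\<^sub>m n + s \<cdot>\<^sub>m (B * H)) = A * 1\<^sub>m n + A * (s \<cdot>\<^sub>m (B * H))"
      by (rule mult_add_distrib_mat) (use A BH in auto)
    also have "A * (s \<cdot>\<^sub>m (B * H)) = s \<cdot>\<^sub>m (A * (B * H))" by (rule mult_smult_distrib) (use A BH in auto)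
    also have "A * (B * H) = H" using assoc_mult_mat[OF A(1) B(1) H(1)] B(2) H(1) by simp
    finally show ?thesis using A by simp
  qed
  then have det: "det (A + s \<cdot>\<^sub>m H) = det A * ?f s" for s
    using det_mult[of A n "1\<^sub>m n + s \<cdot>\<^sub>m (B * H)"] A BH by (simp add: add_carrier_mat)
  have dA: "0 < det A" by (rule det_positive_definite_pos[OF A])
  have "1\<^sub>m n + 0 \<cdot>\<^sub>m (B * H) = 1\<^sub>m n"
    using B(1) H(1) by (intro eq_matI) auto
  then have f0: "?f 0 = 1" by simp
  have "?f s \<le> ?f 0" if s: "\<bar>0 - s\<bar> < e" for s
  proof -
    have pd: "positive_definite (A + s \<cdot>\<^sub>m H)" using e(2) s by simp
    have c: "A + s \<cdot>\<^sub>m H \<in> carrier_mat n n" using A H by auto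
    have "det (A + s \<cdot>\<^sub>m H) \<le> det A"
      using max[OF pd] det_positive_definite_pos[OF c pd] dA by simp
    then show ?thesis unfolding det f0 using dA by simp
  qed
  then have "(\<Sum>i<n. (B * H) $$ (i, i)) = 0"
    using DERIV_local_max[OF det_perturbation_derivative[OF BH] e(1)] by blast
  then show ?thesis
    using B H by (simp add: scalar_prod_def lessThan_atLeast0)
qed

section \<open>Positive definite kernels\<close>

definition bilinear_sum :: "nat \<Rightarrow> (nat \<Rightarrow> nat \<Rightarrow> real) \<Rightarrow> (nat \<Rightarrow> real) \<Rightarrow> (nat \<Rightarrow> real) \<Rightarrow> real" where
  "bilinear_sum M f u v = (\<Sum>i<M. \<Sum>j<M. u i * f i j * v j)"

text \<open>Positive definiteness of a finite section of a kernel.  Functions instead of matrices make it easy to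
restrict to windows of indices and to translate them.\<close>

definition pos_kernel :: "nat \<Rightarrow> (nat \<Rightarrow> nat \<Rightarrow> real) \<Rightarrow> bool" where
  "pos_kernel M f \<longleftrightarrow> (\<forall>i<M. \<forall>j<M. f i j = f j i) \<and>
     (\<forall>u. (\<exists>i<M. u i \<noteq> 0) \<longrightarrow> 0 < bilinear_sum M f u u)"

lemma bilinear_sum_eq_scalar_prod:
  "bilinear_sum M f u v = vec M u \<bullet> (mat M M (\<lambda>(i, j). f i j) *\<^sub>v vec M v)"
proof -
  have "vec M u \<bullet> (mat M M (\<lambda>(i, j). f i j) *\<^sub>v vec M v) = (\<Sum>i<M. u i * (\<Sum>j<M. f i j * v j))"
    by (simp add: scalar_prod_def lessThan_atLeast0)
  also have "\<dots> = bilinear_sum M f u v"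
    unfolding bilinear_sum_def by (simp only: sum_distrib_left mult.assoc)
  finally show ?thesis ..
qed

lemma pos_kernel_iff: "pos_kernel M f \<longleftrightarrow> positive_definite (mat M M (\<lambda>(i, j). f i j))"
proof
  let ?A = "mat M M (\<lambda>(i, j). f i j)"
  assume f: "pos_kernel M f"
  show "positive_definite ?A"
  proof (rule positive_definiteI)
    show "transpose_mat ?A = ?A" using f unfolding pos_kernel_def by (intro eq_matI) auto
    fix v :: "real vec" assume v: "v \<in> carrier_vec M" "v \<noteq> 0\<^sub>v M"
    have vv: "vec M (\<lambda>i. v $ i) = v" using v by (intro eq_vecI) auto
    have "\<exists>i<M. v $ i \<noteq> 0" using v by (metis carrier_vecD eq_vecI index_zero_vec)
    then show "0 < v \<bullet> (?A *\<^sub>v v)"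
      using f bilinear_sum_eq_scalar_prod[of M f "\<lambda>i. v $ i" "\<lambda>i. v $ i"] vv
      unfolding pos_kernel_def by auto
  qed simp
next
  let ?A = "mat M M (\<lambda>(i, j). f i j)"
  assume pd: "positive_definite ?A"
  have A: "?A \<in> carrier_mat M M" by simp
  show "pos_kernel M f"
    unfolding pos_kernel_def
  proof (intro conjI allI impI)
    fix i j assume "i < M" "j < M"
    then show "f i j = f j i" using symmetric_index[OF positive_definite_sym[OF pd] A] by auto
  next
    fix u :: "nat \<Rightarrow> real" assume "\<exists>i<M. u i \<noteq> 0"
    then have "vec M u \<noteq> 0\<^sub>v M" by (metis index_vec index_zero_vec(1))
    then show "0 < bilinear_sum M f u u"
      unfolding bilinear_sum_eq_scalar_prod by (intro positive_definiteD[OF pd A]) auto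
  qed
qed

lemma bilinear_sum_linear:
  "bilinear_sum M f (\<lambda>i. u i - v i) w = bilinear_sum M f u w - bilinear_sum M f v w"
  "bilinear_sum M f (\<lambda>i. c * u i) w = c * bilinear_sum M f u w"
  "bilinear_sum M f w (\<lambda>i. c * u i) = c * bilinear_sum M f w u"
  "bilinear_sum M f (\<lambda>i. \<Sum>k\<in>A. g k i) w = (\<Sum>k\<in>A. bilinear_sum M f (g k) w)"
proof -
  show "bilinear_sum M f (\<lambda>i. \<Sum>k\<in>A. g k i) w = (\<Sum>k\<in>A. bilinear_sum M f (g k) w)"
    unfolding bilinear_sum_def
    by (induction A rule: infinite_finite_induct) (auto simp: distrib_right sum.distrib)
qed (auto simp: bilinear_sum_def algebra_simps sum_subtractf sum_distrib_left)

lemma bilinear_sum_sym: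
  assumes "pos_kernel M f" shows "bilinear_sum M f u v = bilinear_sum M f v u"
proof -
  have "bilinear_sum M f u v = (\<Sum>j<M. \<Sum>i<M. u i * f i j * v j)"
    unfolding bilinear_sum_def by (rule sum.swap)
  also have "\<dots> = bilinear_sum M f v u"
    using assms unfolding bilinear_sum_def pos_kernel_def by (intro sum.cong) (auto simp: mult_ac)
  finally show ?thesis .
qed

text \<open>Gram-Schmidt for the inner product given by \<open>f\<close>.  The first \<open>k\<close> vectors are supported on the first
\<open>k\<close> coordinates, so what remains of the next unit vector after projection is not zero.\<close>

lemma Gram_Schmidt_kernel:
  assumes f: "pos_kernel M f"
  obtains W where "\<And>i j. i < M \<Longrightarrow> j < M \<Longrightarrow> bilinear_sum M f (W i) (W j) = (if i = j then 1 else 0)"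
proof -
  have "\<exists>W. (\<forall>i<k. \<forall>a\<ge>k. W i a = 0) \<and>
      (\<forall>i<k. \<forall>j<k. bilinear_sum M f (W i) (W j) = (if i = j then 1 else 0))" if "k \<le> M" for k
    using that
  proof (induction k)
    case (Suc k)
    then obtain W where W0: "\<And>i a. i < k \<Longrightarrow> a \<ge> k \<Longrightarrow> W i a = 0"
      and W1: "\<And>i j. i < k \<Longrightarrow> j < k \<Longrightarrow> bilinear_sum M f (W i) (W j) = (if i = j then 1 else 0)"
      by (metis Suc_leD)
    define e where "e = (\<lambda>a. if a = k then 1 else 0 :: real)"
    define v where "v = (\<lambda>a. e a - (\<Sum>i<k. bilinear_sum M f e (W i) * W i a))"
    define N where "N = bilinear_sum M f v v"
    have vW: "bilinear_sum M f v (W j) = 0" if j: "j < k" for j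
      unfolding v_def bilinear_sum_linear using j by (simp add: W1 if_distrib sum.delta cong: if_cong)
    have "v k = 1" unfolding v_def e_def by (simp add: W0)
    then have N: "0 < N" using f Suc.prems unfolding pos_kernel_def N_def
      by (metis Suc_le_eq zero_neq_one)
    define s where "s = 1 / sqrt N"
    define W' where "W' = (\<lambda>i. if i = k then (\<lambda>a. s * v a) else W i)"
    have v0: "v a = 0" if "a \<ge> Suc k" for a
      using that unfolding v_def e_def by (simp add: W0)
    have "s * (s * N) = 1" using N by (simp add: s_def field_simps)
    then have "bilinear_sum M f (W' i) (W' j) = (if i = j then 1 else 0)" if "i < Suc k" "j < Suc k" for i j
      using that W1 vW bilinear_sum_sym[OF f, of "W i" v]
      unfolding W'_def by (auto simp: bilinear_sum_linear N_def[symmetric] less_Suc_eq)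
    moreover have "W' i a = 0" if "i < Suc k" "a \<ge> Suc k" for i a
      using that v0 W0 unfolding W'_def by auto
    ultimately show ?case by blast
  qed auto
  from this[OF order_refl] obtain W where
    "\<forall>i<M. \<forall>j<M. bilinear_sum M f (W i) (W j) = (if i = j then 1 else 0)" by blast
  then show thesis by (intro that[of W]) auto
qed

lemma pos_kernel_inverse:
  assumes f: "pos_kernel M f"
  obtains g where "\<And>i j. i < M \<Longrightarrow> j < M \<Longrightarrow> g i j = g j i"
    and "\<And>i k. i < M \<Longrightarrow> k < M \<Longrightarrow> (\<Sum>j<M. f i j * g j k) = (if i = k then 1 else 0)"
    and "\<And>i k. i < M \<Longrightarrow> k < M \<Longrightarrow> (\<Sum>j<M. g i j * f j k) = (if i = k then 1 else 0)"
proof -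
  let ?A = "mat M M (\<lambda>(i, j). f i j)"
  have A: "?A \<in> carrier_mat M M" by simp
  obtain B where B: "B \<in> carrier_mat M M" "?A * B = 1\<^sub>m M" "B * ?A = 1\<^sub>m M" "transpose_mat B = B"
    using positive_definite_inverse[OF A] f pos_kernel_iff by metis
  show thesis
  proof (rule that[of "\<lambda>i j. B $$ (i, j)"])
    show "B $$ (i, j) = B $$ (j, i)" if "i < M" "j < M" for i j
      using symmetric_index[OF B(4,1) that] .
    fix i k assume ik: "i < M" "k < M"
    have "(?A * B) $$ (i, k) = (\<Sum>j<M. f i j * B $$ (j, k))"
      using ik B(1) by (auto simp: scalar_prod_def lessThan_atLeast0 intro!: sum.cong)
    then show "(\<Sum>j<M. f i j * B $$ (j, k)) = (if i = k then 1 else 0)" using B(2) ik by simp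
    have "(B * ?A) $$ (i, k) = (\<Sum>j<M. B $$ (i, j) * f j k)"
      using ik B(1) by (auto simp: scalar_prod_def lessThan_atLeast0 intro!: sum.cong)
    then show "(\<Sum>j<M. B $$ (i, j) * f j k) = (if i = k then 1 else 0)" using B(3) ik by simp
  qed
qed

lemma pos_kernel_solve:
  assumes f: "pos_kernel M f"
  obtains b where "\<And>i. i < M \<Longrightarrow> (\<Sum>j<M. b j * f i j) = y i"
proof -
  obtain g where g: "\<And>i k. i < M \<Longrightarrow> k < M \<Longrightarrow> (\<Sum>j<M. f i j * g j k) = (if i = k then 1 else 0)"
    using pos_kernel_inverse[OF f] by metis
  show thesis
  proof (rule that[of "\<lambda>j. \<Sum>k<M. g j k * y k"])
    fix i assume i: "i < M"
    have "(\<Sum>j<M. (\<Sum>k<M. g j k * y k) * f i j) = (\<Sum>j<M. \<Sum>k<M. (f i j * g j k) * y k)"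
      by (simp add: sum_distrib_right sum_distrib_left mult_ac)
    also have "\<dots> = (\<Sum>k<M. \<Sum>j<M. (f i j * g j k) * y k)" by (rule sum.swap)
    also have "\<dots> = (\<Sum>k<M. (if i = k then 1 else 0) * y k)"
      using g i by (simp add: sum_distrib_right[symmetric])
    also have "\<dots> = y i" using i by (simp add: if_distribR if_distrib[of "\<lambda>x. x * _"] cong: if_cong)
    finally show "(\<Sum>j<M. (\<Sum>k<M. g j k * y k) * f i j) = y i" .
  qed
qed

lemma pos_kernel_injective:
  assumes f: "pos_kernel M f" and u: "\<And>i. i < M \<Longrightarrow> (\<Sum>j<M. f i j * u j) = 0" and i: "i < M"
  shows "u i = 0"
proof (rule ccontr)
  assume "u i \<noteq> 0"
  then have "0 < bilinear_sum M f u u" using f i unfolding pos_kernel_def by blast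
  also have "bilinear_sum M f u u = (\<Sum>i<M. u i * (\<Sum>j<M. f i j * u j))"
    unfolding bilinear_sum_def by (simp add: sum_distrib_left mult_ac)
  also have "\<dots> = 0" using u by simp
  finally show False by simp
qed

lemma pos_kernel_coercive:
  assumes f: "pos_kernel M f"
  obtains \<mu> where "0 < \<mu>" "\<And>u. \<mu> * (\<Sum>i<M. (u i)\<^sup>2) \<le> bilinear_sum M f u u"
proof -
  have A: "mat M M (\<lambda>(i, j). f i j) \<in> carrier_mat M M" by simp
  obtain \<mu> where mu: "0 < \<mu>"
    "\<And>x. x \<in> carrier_vec M \<Longrightarrow> \<mu> * (x \<bullet> x) \<le> x \<bullet> (mat M M (\<lambda>(i, j). f i j) *\<^sub>v x)"
    using positive_definite_coercive[OF A] f pos_kernel_iff by metis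
  have "vec M u \<bullet> vec M u = (\<Sum>i<M. (u i)\<^sup>2)" for u :: "nat \<Rightarrow> real"
    by (simp add: scalar_prod_def lessThan_atLeast0 power2_eq_square)
  then show thesis
    using that[OF mu(1)] mu(2)[of "vec M u" for u] by (simp add: bilinear_sum_eq_scalar_prod)
qed

lemma bilinear_sum_upper:
  "bilinear_sum M f u u \<le> (\<Sum>i<M. \<Sum>j<M. \<bar>f i j\<bar>) * (\<Sum>i<M. (u i)\<^sup>2)"
proof -
  have "u i * f i j * u j \<le> \<bar>f i j\<bar> * (\<Sum>i<M. (u i)\<^sup>2)" if "i < M" "j < M" for i j
  proof -
    have s: "(u k)\<^sup>2 \<le> (\<Sum>i<M. (u i)\<^sup>2)" if "k < M" for k
      by (rule member_le_sum) (use that in auto)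
    have "2 * \<bar>u i * u j\<bar> \<le> (u i)\<^sup>2 + (u j)\<^sup>2"
      using sum_squares_bound[of "\<bar>u i\<bar>" "\<bar>u j\<bar>"] by (simp add: abs_mult)
    then have "\<bar>u i * u j\<bar> \<le> (\<Sum>i<M. (u i)\<^sup>2)" using s[OF that(1)] s[OF that(2)] by linarith
    then have "\<bar>f i j\<bar> * \<bar>u i * u j\<bar> \<le> \<bar>f i j\<bar> * (\<Sum>i<M. (u i)\<^sup>2)" by (rule mult_left_mono) simp
    moreover have "u i * f i j * u j \<le> \<bar>f i j\<bar> * \<bar>u i * u j\<bar>"
      by (metis abs_ge_self abs_mult mult.assoc mult.commute)
    ultimately show ?thesis by linarith
  qed
  then show ?thesis unfolding bilinear_sum_def sum_distrib_right by (intro sum_mono) auto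
qed

section \<open>The Yule-Walker equations\<close>

lemma shift_multiple:
  fixes k :: "int \<Rightarrow> int \<Rightarrow> real"
  assumes k: "\<And>r c. k (r + int m) (c + int m) = k r c"
  shows "k (r + int m * q) (c + int m * q) = k r c"
proof -
  have nat: "k (r + int m * int q) (c + int m * int q) = k r c" for q r c
  proof (induction q)
    case (Suc q)
    have "k (r + int m * int (Suc q)) (c + int m * int (Suc q)) = k ((r + int m * int q) + int m) ((c + int m * int q) + int m)"
      by (simp add: algebra_simps)
    then show ?case using k Suc by simp
  qed simp
  show ?thesis
  proof (cases "0 \<le> q")
    case True
    then show ?thesis using nat[of r "nat q" c] by simp
  next
    case False
    then show ?thesis using nat[of "r + int m * q" "nat (- q)" "c + int m * q"] by simp
  qed
qed

text \<open>The covariance kernel \<open>t\<close> of a stationary sequence of random vectors of length \<open>m\<close>, with scalar indices: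
\<open>m * k + a\<close> stands for component \<open>a\<close> at time \<open>k\<close>.  A block Toeplitz matrix is then a kernel invariant under
the shift by \<open>m\<close>.  The last assumption is what entropy maximization contributes: every left
inverse \<open>g\<close> of a finite section of more than \<open>n + 1\<close> blocks has a vanishing corner block.\<close>

locale toeplitz_kernel =
  fixes m n :: nat and t :: "int \<Rightarrow> int \<Rightarrow> real"
  assumes m_pos: "0 < m"
    and shift1: "t (r + int m) (c + int m) = t r c"
    and sym: "t r c = t c r"
    and pos: "n + 1 \<le> N \<Longrightarrow> pos_kernel (m * N) (\<lambda>i j. t (int i) (int j))"
    and corner: "n + 2 \<le> N \<Longrightarrow>
       (\<And>i k. i < m * N \<Longrightarrow> k < m * N \<Longrightarrow> (\<Sum>j<m * N. g i j * t (int j) (int k)) = (if i = k then 1 else 0)) \<Longrightarrow>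
       a < m \<Longrightarrow> b < m \<Longrightarrow> g a (m * (N - 1) + b) = 0"
begin

definition w :: nat where "w = m * (n + 1)"

lemma w_pos: "0 < w" and m_le_w: "m \<le> w" using m_pos by (auto simp: w_def)

lemma shift: "t (r + int m * p) (c + int m * p) = t r c"
  by (rule shift_multiple) (rule shift1)

text \<open>Let \<open>G N\<close> be the inverse of the section with \<open>N\<close> blocks.  The first block row of \<open>G (N + 1)\<close> has zeros in its
last block; dropping them leaves a row that solves the system of size \<open>N\<close>, hence the
first block row of \<open>G N\<close>.  So this row is the same for all \<open>N\<close>, and its equations hold at every \<open>k\<close>.
The leading block is positive definite as a diagonal block of a positive definite inverse; it serves to
solve the recursion backwards and to normalize it.\<close>

lemma Yule_Walker:
  obtains x where
    "\<And>a k. a < m \<Longrightarrow> (\<Sum>j<w. x a j * t (int j) (int k)) = (if a = k then 1 else 0)"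
    and "pos_kernel m x"
proof -
  define is_inv where "is_inv N g \<longleftrightarrow>
     (\<forall>i<m * N. \<forall>j<m * N. g i j = g j i) \<and>
     (\<forall>i<m * N. \<forall>k<m * N. (\<Sum>j<m * N. t (int i) (int j) * g j k) = (if i = k then 1 else 0)) \<and>
     (\<forall>i<m * N. \<forall>k<m * N. (\<Sum>j<m * N. g i j * t (int j) (int k)) = (if i = k then 1 else 0))"
    for N and g :: "nat \<Rightarrow> nat \<Rightarrow> real"
  have "\<exists>g. n + 1 \<le> N \<longrightarrow> is_inv N g" for N
  proof (cases "n + 1 \<le> N")
    case True
    show ?thesis
    proof (rule pos_kernel_inverse[OF pos[OF True]])
      fix g :: "nat \<Rightarrow> nat \<Rightarrow> real"
      assume "\<And>i j. i < m * N \<Longrightarrow> j < m * N \<Longrightarrow> g i j = g j i"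
        and "\<And>i k. i < m * N \<Longrightarrow> k < m * N \<Longrightarrow> (\<Sum>j<m * N. t (int i) (int j) * g j k) = (if i = k then 1 else 0)"
        and "\<And>i k. i < m * N \<Longrightarrow> k < m * N \<Longrightarrow> (\<Sum>j<m * N. g i j * t (int j) (int k)) = (if i = k then 1 else 0)"
      then have "is_inv N g" unfolding is_inv_def by blast
      then show "\<exists>g. n + 1 \<le> N \<longrightarrow> is_inv N g" by blast
    qed
  qed simp
  then obtain G where G: "\<forall>N. n + 1 \<le> N \<longrightarrow> is_inv N (G N)"
    using choice[of "\<lambda>N g. n + 1 \<le> N \<longrightarrow> is_inv N g"] by blast
  note G = G[unfolded is_inv_def]
  note Gsym = G[rule_format, THEN conjunct1, rule_format]
    and Gr = G[rule_format, THEN conjunct2, THEN conjunct1, rule_format]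
    and Gl = G[rule_format, THEN conjunct2, THEN conjunct2, rule_format]
  define x where "x = (\<lambda>a j. if j < w then G (n + 1) a j else 0)"
  have row: "G N a j = x a j" if "n + 1 \<le> N" "a < m" "j < m * N" for N a j
    using that
  proof (induction N arbitrary: j rule: dec_induct)
    case base
    then show ?case by (simp add: x_def w_def)
  next
    case (step N)
    have mN: "m \<le> m * N" using step.hyps by (cases N) auto
    then have aN: "a < m * N" "a < m * Suc N" using step.prems(1) by (simp_all add: less_le_trans trans_less_add1)
    have zero: "G (Suc N) a j = 0" if "m * N \<le> j" "j < m * Suc N" for j
      using corner[of "Suc N" "G (Suc N)" a "j - m * N"] Gl[of "Suc N"] step.hyps step.prems(1) that by auto
    have split: "(\<Sum>i<m * Suc N. G (Suc N) a i * t (int i) (int k)) = (\<Sum>i<m * N. G (Suc N) a i * t (int i) (int k))" for k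
      by (rule sum.mono_neutral_right) (use zero in auto)
    have eq: "G (Suc N) a k = G N a k" if k: "k < m * N" for k
    proof -
      have "G (Suc N) a k = (\<Sum>i<m * N. G (Suc N) a i * (if i = k then 1 else 0))"
        using k by (simp add: if_distrib cong: if_cong)
      also have "\<dots> = (\<Sum>i<m * N. G (Suc N) a i * (\<Sum>j<m * N. t (int i) (int j) * G N j k))"
        using Gr[of N] step.hyps k by (intro sum.cong) auto
      also have "\<dots> = (\<Sum>i<m * N. \<Sum>j<m * N. G (Suc N) a i * t (int i) (int j) * G N j k)"
        by (simp add: sum_distrib_left mult_ac)
      also have "\<dots> = (\<Sum>j<m * N. \<Sum>i<m * N. G (Suc N) a i * t (int i) (int j) * G N j k)"
        by (rule sum.swap)
      also have "\<dots> = (\<Sum>j<m * N. (\<Sum>i<m * Suc N. G (Suc N) a i * t (int i) (int j)) * G N j k)"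
        unfolding split by (simp add: sum_distrib_right)
      also have "\<dots> = (\<Sum>j<m * N. (if a = j then 1 else 0) * G N j k)"
        using Gl[of "Suc N"] aN step.hyps by (intro sum.cong) auto
      also have "\<dots> = G N a k"
        using aN by (simp add: if_distribR if_distrib[of "\<lambda>x. x * _"] cong: if_cong)
      finally show ?thesis .
    qed
    show ?case
    proof (cases "j < m * N")
      case True
      then show ?thesis using eq step by simp
    next
      case False
      have "w \<le> m * N" using mult_le_mono2[OF step.hyps(1)] unfolding w_def by blast
      then show ?thesis using False zero step.prems by (simp add: x_def)
    qed
  qed
  show thesis
  proof (rule that[of x])
    fix a k assume a: "a < m"
    define N where "N = n + 1 + k"
    have N: "n + 1 \<le> N" unfolding N_def by simp
    have wN: "w \<le> m * N" unfolding w_def N_def by simp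
    have "N \<le> m * N" using m_pos by simp
    then have k: "k < m * N" unfolding N_def by linarith
    have "(\<Sum>j<w. x a j * t (int j) (int k)) = (\<Sum>j<m * N. x a j * t (int j) (int k))"
      by (rule sum.mono_neutral_left) (use wN in \<open>auto simp: x_def\<close>)
    also have "\<dots> = (\<Sum>j<m * N. G N a j * t (int j) (int k))" using row[OF N a] by simp
    also have "\<dots> = (if a = k then 1 else 0)" using Gl[OF N, of a k] a k wN m_le_w by simp
    finally show "(\<Sum>j<w. x a j * t (int j) (int k)) = (if a = k then 1 else 0)" .
  next
    let ?f = "\<lambda>i j. t (int i) (int j)"
    have pw: "pos_kernel w ?f" using pos[of "n + 1"] by (simp add: w_def)
    have gl: "(\<Sum>j<w. G (n + 1) i j * ?f j k) = (if i = k then 1 else 0)" if "i < w" "k < w" for i k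
      using Gl[of "n + 1" i k] that by (simp add: w_def)
    have gr: "(\<Sum>j<w. ?f i j * G (n + 1) j k) = (if i = k then 1 else 0)" if "i < w" "k < w" for i k
      using Gr[of "n + 1" i k] that by (simp add: w_def)
    show "pos_kernel m x"
      unfolding pos_kernel_def
    proof (intro conjI allI impI)
      fix i j assume "i < m" "j < m"
      then show "x i j = x j i" using Gsym[of "n + 1" i j] m_le_w by (simp add: x_def w_def)
    next
      fix u :: "nat \<Rightarrow> real" assume u: "\<exists>i<m. u i \<noteq> 0"
      define y where "y = (\<lambda>j. \<Sum>a<m. G (n + 1) j a * u a)"
      have fy: "(\<Sum>j<w. ?f i j * y j) = (if i < m then u i else 0)" if i: "i < w" for i
      proof -
        have "(\<Sum>j<w. ?f i j * y j) = (\<Sum>j<w. \<Sum>a<m. ?f i j * G (n + 1) j a * u a)"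
          unfolding y_def by (simp add: sum_distrib_left mult_ac)
        also have "\<dots> = (\<Sum>a<m. \<Sum>j<w. ?f i j * G (n + 1) j a * u a)" by (rule sum.swap)
        also have "\<dots> = (\<Sum>a<m. (if i = a then 1 else 0) * u a)"
          using gr[OF i] m_le_w by (simp add: sum_distrib_right[symmetric])
        also have "\<dots> = (if i < m then u i else 0)"
          by (simp add: if_distribR if_distrib[of "\<lambda>x. x * _"] cong: if_cong)
        finally show ?thesis .
      qed
      obtain i where i: "i < m" "u i \<noteq> 0" using u by blast
      have "\<exists>j<w. y j \<noteq> 0"
      proof (rule ccontr)
        assume "\<not> ?thesis"
        then have "(\<Sum>j<w. ?f i j * y j) = 0" by simp
        then show False using fy[of i] i m_le_w by auto
      qed
      then have "0 < bilinear_sum w ?f y y" using pw unfolding pos_kernel_def by blast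
      also have "\<dots> = (\<Sum>i<w. y i * (\<Sum>j<w. ?f i j * y j))"
        unfolding bilinear_sum_def by (simp add: sum_distrib_left mult_ac)
      also have "\<dots> = (\<Sum>i<w. y i * (if i < m then u i else 0))" using fy by simp
      also have "\<dots> = (\<Sum>i<m. y i * u i)"
        by (rule sum.mono_neutral_cong_right) (use m_le_w in auto)
      also have "\<dots> = bilinear_sum m x u u"
        unfolding bilinear_sum_def y_def using m_le_w
        by (auto simp: x_def sum_distrib_left sum_distrib_right mult_ac intro!: sum.cong)
      finally show "0 < bilinear_sum m x u u" .
    qed
  qed
qed

end

section \<open>Exponential decay of the covariances\<close>

lemma sum_lessThan_add: "(\<Sum>i<a + b. f i) = (\<Sum>i<a. f i) + (\<Sum>i<b. f (a + i))" for f :: "nat \<Rightarrow> real"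
  by (induction b) simp_all

context toeplitz_kernel
begin

abbreviation energy :: "(nat \<Rightarrow> real) \<Rightarrow> real" where
  "energy u \<equiv> bilinear_sum w (\<lambda>i j. t (int i) (int j)) u u"

text \<open>The Yule-Walker recursion determines each block from the \<open>n\<close> blocks after it, since the leading
coefficient \<open>x\<close> is nonsingular.\<close>

lemma backward_unique:
  assumes x: "pos_kernel m x"
    and rec: "\<And>b a. b < 0 \<Longrightarrow> a < m \<Longrightarrow> (\<Sum>j<w. x a j * u (int m * b + int j)) = 0"
    and init: "\<And>r. 0 \<le> r \<Longrightarrow> r < int w \<Longrightarrow> u r = 0"
    and r: "r < int w"
  shows "u r = (0 :: real)"
proof -
  have zero: "\<forall>r. - int m * int k \<le> r \<longrightarrow> r < int w \<longrightarrow> u r = 0" for k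
  proof (induction k)
    case 0
    then show ?case using init by simp
  next
    case (Suc k)
    define b where "b = - int (Suc k)"
    have mb: "int m * b + int m = - int m * int k" unfolding b_def by (simp add: algebra_simps)
    have block: "u (int m * b + int j) = 0" if j: "j < m" for j
    proof (rule pos_kernel_injective[OF x _ j])
      fix a assume a: "a < m"
      have "0 = (\<Sum>j<w. x a j * u (int m * b + int j))"
        using rec[of b a] a by (simp add: b_def)
      also have "\<dots> = (\<Sum>j<m. x a j * u (int m * b + int j))"
      proof (rule sum.mono_neutral_right)
        show "\<forall>j\<in>{..<w} - {..<m}. x a j * u (int m * b + int j) = 0"
        proof
          fix j assume j: "j \<in> {..<w} - {..<m}"
          then have "- int m * int k \<le> int m * b + int j" using mb by auto
          moreover have "int m * b \<le> 0" unfolding b_def by (simp add: mult_nonneg_nonpos)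
          then have "int m * b + int j < int w" using j by auto
          ultimately show "x a j * u (int m * b + int j) = 0" using Suc.IH by simp
        qed
      qed (use m_le_w in auto)
      finally show "(\<Sum>j<m. x a j * u (int m * b + int j)) = 0" by simp
    qed
    show ?case
    proof (intro allI impI)
      fix r assume r: "- int m * int (Suc k) \<le> r" "r < int w"
      show "u r = 0"
      proof (cases "- int m * int k \<le> r")
        case True
        then show ?thesis using Suc.IH r by simp
      next
        case False
        have "int m * b = - int m * int (Suc k)" unfolding b_def by (simp add: algebra_simps)
        then have "int m * b \<le> r" using r by linarith
        moreover have "r - int m * b < int m" using False mb by linarith
        ultimately show ?thesis using block[of "nat (r - int m * b)"] by simp
      qed
    qed
  qed
  have "- int m * int (nat (- r)) \<le> r"
  proof (cases "0 \<le> r")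
    case False
    then have "1 * (- r) \<le> int m * (- r)" using m_pos by (intro mult_right_mono) auto
    then show ?thesis using False by simp
  qed simp
  then show ?thesis using zero r by blast
qed

text \<open>A covariance combination \<open>\<Sum>\<^sub>k \<alpha>\<^sub>k t(r, k)\<close> over the window, observed one window earlier, is again such a
combination \<open>\<beta>\<close>: choose \<open>\<beta>\<close> so that both agree on one window and use the recursion.  Probabilistically, \<open>\<beta>\<close> is
the projection of \<open>\<alpha>\<close> onto the earlier window, and its energy is smaller by a fixed factor because the
covariance matrix of the two windows together is coercive.\<close>

lemma contraction:
  "\<exists>q. 0 < q \<and> q < 1 \<and> (\<forall>\<alpha>. \<exists>\<beta>. energy \<beta> \<le> q * energy \<alpha> \<and>
       (\<forall>r<int w. (\<Sum>k<w. \<alpha> k * t (r - int w) (int k)) = (\<Sum>k<w. \<beta> k * t r (int k))))"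
proof -
  let ?T = "\<lambda>i j. t (int i) (int j)"
  have pw: "pos_kernel w ?T" using pos[of "n + 1"] by (simp add: w_def)
  have p2w: "pos_kernel (w + w) ?T" 
  proof -
    have "m * (2 * (n + 1)) = w + w" by (simp add: w_def algebra_simps)
    then show ?thesis using pos[of "2 * (n + 1)"] by simp
  qed
  have wsh: "t (r + int w) (c + int w) = t r c" for r c
  proof -
    have "int w = int m * int (n + 1)" by (simp add: w_def algebra_simps)
    then show ?thesis using shift[of r "int (n + 1)" c] by metis
  qed
  obtain x where xt: "\<And>a k. a < m \<Longrightarrow> (\<Sum>j<w. x a j * t (int j) (int k)) = (if a = k then 1 else 0)"
    and xp: "pos_kernel m x" using Yule_Walker by metis
  obtain \<mu> where mu: "0 < \<mu>" "\<And>u. \<mu> * (\<Sum>i<w + w. (u i)\<^sup>2) \<le> bilinear_sum (w + w) ?T u u"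
    using pos_kernel_coercive[OF p2w] by metis
  \<comment> \<open>the summand \<open>1 + \<mu>\<close> makes \<open>K\<close> larger than \<open>\<mu>\<close>, so that \<open>0 < q\<close>\<close>
  define K where "K = 1 + \<mu> + (\<Sum>i<w. \<Sum>j<w. \<bar>?T i j\<bar>)"
  have "0 \<le> (\<Sum>i<w. \<Sum>j<w. \<bar>?T i j\<bar>)" by (intro sum_nonneg) auto
  then have K1: "\<mu> < K" unfolding K_def by linarith
  have K: "energy u \<le> K * (\<Sum>i<w. (u i)\<^sup>2)" for u
  proof -
    have "energy u \<le> (\<Sum>i<w. \<Sum>j<w. \<bar>?T i j\<bar>) * (\<Sum>i<w. (u i)\<^sup>2)" by (rule bilinear_sum_upper)
    also have "\<dots> \<le> K * (\<Sum>i<w. (u i)\<^sup>2)"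
      unfolding K_def using mu(1) by (intro mult_right_mono sum_nonneg) auto
    finally show ?thesis .
  qed
  define q where "q = 1 - \<mu> / K"
  have q: "0 < q" "q < 1" unfolding q_def using K1 mu(1) by (auto simp: field_simps)
  have "\<exists>\<beta>. energy \<beta> \<le> q * energy \<alpha> \<and>
       (\<forall>r<int w. (\<Sum>k<w. \<alpha> k * t (r - int w) (int k)) = (\<Sum>k<w. \<beta> k * t r (int k)))" for \<alpha>
  proof -
    define z where "z r = (\<Sum>k<w. \<alpha> k * t r (int k))" for r
    obtain \<beta> where \<beta>: "\<And>i. i < w \<Longrightarrow> (\<Sum>k<w. \<beta> k * ?T i k) = z (int i - int w)"
      using pos_kernel_solve[OF pw, of "\<lambda>i. z (int i - int w)"] by metis
    have rec: "(\<Sum>j<w. x a j * (\<Sum>k<w. \<gamma> k * t (int m * b + int j) (int k))) = 0"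
      if "b < 0" "a < m" for b a and \<gamma> :: "nat \<Rightarrow> real"
    proof -
      have "(\<Sum>j<w. x a j * t (int m * b + int j) (int k)) = 0" for k
      proof -
        have "int m * 1 \<le> int m * - b" by (rule mult_left_mono) (use that(1) in auto)
        then have mb: "int m \<le> int m * - b" by simp
        have "t (int m * b + int j) (int k) = t (int j) (int (k + nat (int m * - b)))" for j
          using shift[of "int j" b "int (k + nat (int m * - b))"] mb by (simp add: add.commute)
        then have "(\<Sum>j<w. x a j * t (int m * b + int j) (int k)) = (if a = k + nat (int m * - b) then 1 else 0)"
          using xt[OF that(2), of "k + nat (int m * - b)"] by simp
        then show ?thesis using mb that(2) by auto
      qed
      then have "(\<Sum>k<w. \<gamma> k * (\<Sum>j<w. x a j * t (int m * b + int j) (int k))) = 0" by simp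
      also have "(\<Sum>k<w. \<gamma> k * (\<Sum>j<w. x a j * t (int m * b + int j) (int k)))
          = (\<Sum>k<w. \<Sum>j<w. x a j * (\<gamma> k * t (int m * b + int j) (int k)))"
        by (simp add: sum_distrib_left mult_ac)
      also have "\<dots> = (\<Sum>j<w. \<Sum>k<w. x a j * (\<gamma> k * t (int m * b + int j) (int k)))" by (rule sum.swap)
      also have "\<dots> = (\<Sum>j<w. x a j * (\<Sum>k<w. \<gamma> k * t (int m * b + int j) (int k)))"
        by (simp only: sum_distrib_left)
      finally show ?thesis .
    qed
    define u where "u r = z (r - int w) - (\<Sum>k<w. \<beta> k * t r (int k))" for r
    have u0: "u r = 0" if "r < int w" for r
    proof (rule backward_unique[OF xp _ _ that])
      show "u r = 0" if "0 \<le> r" "r < int w" for r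
        using \<beta>[of "nat r"] that unfolding u_def by simp
      fix b a assume b: "(b :: int) < 0" and a: "a < m"
      have wb: "int m * b + int j - int w = int m * (b - int (n + 1)) + int j" for j
        by (simp add: w_def algebra_simps)
      have "(\<Sum>j<w. x a j * z (int m * b + int j - int w)) = 0"
        unfolding wb z_def by (rule rec) (use a b in auto)
      then show "(\<Sum>j<w. x a j * u (int m * b + int j)) = 0"
        unfolding u_def right_diff_distrib sum_subtractf using rec[OF b a] by simp
    qed
    \<comment> \<open>the vector on both windows, translated by \<open>w\<close> to nonnegative indices: the projection error \<open>\<beta> - \<alpha>\<close>\<close>
    define \<gamma> where "\<gamma> i = (if i < w then \<beta> i else - \<alpha> (i - w))" for i
    have tw: "t (int i) (int w + int j) = t (int i - int w) (int j)" for i j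
      using wsh[of "int i - int w" "int j"] by (simp add: add.commute)
    have cross: "(\<Sum>i<w. \<Sum>j<w. \<beta> i * t (int i) (int w + int j) * \<alpha> j) = energy \<beta>"
    proof -
      have "(\<Sum>i<w. \<Sum>j<w. \<beta> i * t (int i) (int w + int j) * \<alpha> j) = (\<Sum>i<w. \<beta> i * z (int i - int w))"
        unfolding z_def tw by (simp add: sum_distrib_left mult_ac)
      also have "\<dots> = (\<Sum>i<w. \<beta> i * (\<Sum>k<w. \<beta> k * ?T i k))" using \<beta> by simp
      also have "\<dots> = energy \<beta>" unfolding bilinear_sum_def by (simp add: sum_distrib_left mult_ac)
      finally show ?thesis .
    qed
    have cross': "(\<Sum>i<w. \<Sum>j<w. \<alpha> i * t (int w + int i) (int j) * \<beta> j) = energy \<beta>"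
    proof -
      have "(\<Sum>i<w. \<Sum>j<w. \<alpha> i * t (int w + int i) (int j) * \<beta> j) = (\<Sum>j<w. \<Sum>i<w. \<alpha> i * t (int w + int i) (int j) * \<beta> j)"
        by (rule sum.swap)
      also have "\<dots> = energy \<beta>"
        unfolding cross[symmetric] by (intro sum.cong refl) (simp add: sym[of "int w + _"] mult_ac)
      finally show ?thesis .
    qed
    have tt: "t (int w + int i) (int w + int j) = ?T i j" for i j
      using wsh[of "int i" "int j"] by (simp add: add.commute)
    have "bilinear_sum (w + w) ?T \<gamma> \<gamma> =
        (\<Sum>i<w. \<Sum>j<w. \<beta> i * ?T i j * \<beta> j) - (\<Sum>i<w. \<Sum>j<w. \<beta> i * t (int i) (int w + int j) * \<alpha> j)
        - (\<Sum>i<w. \<Sum>j<w. \<alpha> i * t (int w + int i) (int j) * \<beta> j) + (\<Sum>i<w. \<Sum>j<w. \<alpha> i * ?T i j * \<alpha> j)"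
      unfolding bilinear_sum_def sum_lessThan_add \<gamma>_def
      by (simp add: tt sum.distrib sum_subtractf sum_negf)
    also have "\<dots> = energy \<alpha> - energy \<beta>"
      unfolding cross cross' by (simp add: bilinear_sum_def)
    finally have form: "bilinear_sum (w + w) ?T \<gamma> \<gamma> = energy \<alpha> - energy \<beta>" .
    have "(\<Sum>i<w. (\<alpha> i)\<^sup>2) \<le> (\<Sum>i<w + w. (\<gamma> i)\<^sup>2)"
      unfolding sum_lessThan_add \<gamma>_def by (simp add: sum_nonneg)
    then have "\<mu> * (\<Sum>i<w. (\<alpha> i)\<^sup>2) \<le> energy \<alpha> - energy \<beta>"
      using mu(2)[of \<gamma>] mult_left_mono[of "\<Sum>i<w. (\<alpha> i)\<^sup>2" "\<Sum>i<w + w. (\<gamma> i)\<^sup>2" \<mu>] mu(1) form by linarith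
    moreover have "\<mu> / K * energy \<alpha> \<le> \<mu> * (\<Sum>i<w. (\<alpha> i)\<^sup>2)"
    proof -
      have "\<mu> / K * energy \<alpha> \<le> \<mu> / K * (K * (\<Sum>i<w. (\<alpha> i)\<^sup>2))"
        by (rule mult_left_mono[OF K]) (use K1 mu in auto)
      then show ?thesis using K1 mu(1) by simp
    qed
    ultimately have "energy \<beta> \<le> q * energy \<alpha>" unfolding q_def by (simp add: left_diff_distrib)
    moreover have "(\<Sum>k<w. \<alpha> k * t (r - int w) (int k)) = (\<Sum>k<w. \<beta> k * t r (int k))" if "r < int w" for r
      using u0[OF that] unfolding u_def z_def by simp
    ultimately show ?thesis by blast
  qed
  then show ?thesis using q by blast
qed

text \<open>Iterating the contraction \<open>p\<close> times bounds the covariances at a distance of \<open>p\<close> windows by a multiple of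
the square root of \<open>q\<^sup>p\<close>; shift invariance and symmetry reduce all index pairs to this case.\<close>

lemma decay:
  obtains K \<rho> where "0 \<le> K" "0 < \<rho>" "\<rho> < 1" "\<And>r c. \<bar>t r c\<bar> \<le> K * \<rho> ^ nat \<bar>r - c\<bar>"
proof -
  let ?T = "\<lambda>i j. t (int i) (int j)"
  have pw: "pos_kernel w ?T" using pos[of "n + 1"] by (simp add: w_def)
  obtain q where q: "0 < q" "q < 1"
    "\<forall>\<alpha>. \<exists>\<beta>. energy \<beta> \<le> q * energy \<alpha> \<and>
       (\<forall>r<int w. (\<Sum>k<w. \<alpha> k * t (r - int w) (int k)) = (\<Sum>k<w. \<beta> k * t r (int k)))"
    using contraction by blast
  obtain \<mu> where mu: "0 < \<mu>" "\<And>u. \<mu> * (\<Sum>i<w. (u i)\<^sup>2) \<le> energy u"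
    using pos_kernel_coercive[OF pw] by metis
  define \<tau> where "\<tau> = (\<Sum>i<w. \<Sum>j<w. \<bar>?T i j\<bar>)"
  have tau0: "0 \<le> \<tau>" unfolding \<tau>_def by (simp add: sum_nonneg)
  have tau: "\<bar>?T i j\<bar> \<le> \<tau>" if "i < w" "j < w" for i j
  proof -
    have "\<bar>?T i j\<bar> \<le> (\<Sum>j<w. \<bar>?T i j\<bar>)" by (rule member_le_sum[of j "{..<w}" "\<lambda>j. \<bar>?T i j\<bar>"]) (use that in auto)
    also have "\<dots> \<le> \<tau>" unfolding \<tau>_def
      by (rule member_le_sum[of i "{..<w}" "\<lambda>i. \<Sum>j<w. \<bar>?T i j\<bar>"]) (use that in \<open>auto intro: sum_nonneg\<close>)
    finally show ?thesis .
  qed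
  define s where "s = sqrt q"
  have s: "0 < s" "s < 1" unfolding s_def using q by auto
  define K where "K = real w * \<tau> * sqrt (\<tau> / \<mu>)"
  have K0: "0 \<le> K" unfolding K_def using tau0 mu(1) by simp
  have far: "\<bar>t (int r - int p * int w) (int k)\<bar> \<le> K * s ^ p" if r: "r < w" and k: "k < w" for r k p
  proof -
    have "\<exists>\<alpha>. energy \<alpha> \<le> q ^ p * \<tau> \<and> (\<forall>r<int w. t (r - int p * int w) (int k) = (\<Sum>j<w. \<alpha> j * t r (int j)))"
    proof (induction p)
      case 0
      have "energy (\<lambda>j. if j = k then 1 else 0) = ?T k k"
        using k unfolding bilinear_sum_def by (simp add: if_distrib[of "\<lambda>x. x * _"] if_distrib[of "\<lambda>x. _ * x"] if_distribR sum.delta cong: if_cong)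
      then show ?case
        using k tau[OF k k] by (intro exI[of _ "\<lambda>j. if j = k then 1 else 0"])
          (simp add: if_distrib[of "\<lambda>x. x * _"] cong: if_cong)
    next
      case (Suc p)
      then obtain \<alpha> where \<alpha>: "energy \<alpha> \<le> q ^ p * \<tau>"
        "\<And>r. r < int w \<Longrightarrow> t (r - int p * int w) (int k) = (\<Sum>j<w. \<alpha> j * t r (int j))" by blast
      obtain \<beta> where \<beta>: "energy \<beta> \<le> q * energy \<alpha>"
        "\<And>r. r < int w \<Longrightarrow> (\<Sum>k<w. \<alpha> k * t (r - int w) (int k)) = (\<Sum>k<w. \<beta> k * t r (int k))"
        using q(3) by blast
      have "energy \<beta> \<le> q ^ Suc p * \<tau>"
        using \<beta>(1) mult_left_mono[OF \<alpha>(1), of q] q(1)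
        by (simp only: power_Suc mult.assoc) linarith
      moreover have "t (r - int (Suc p) * int w) (int k) = (\<Sum>j<w. \<beta> j * t r (int j))" if "r < int w" for r
        using \<alpha>(2)[of "r - int w"] \<beta>(2)[OF that] that by (simp add: algebra_simps)
      ultimately show ?case by blast
    qed
    then obtain \<alpha> where \<alpha>: "energy \<alpha> \<le> q ^ p * \<tau>"
      "t (int r - int p * int w) (int k) = (\<Sum>j<w. \<alpha> j * ?T r j)" using r by force
    have bound: "\<bar>\<alpha> j\<bar> \<le> sqrt (\<tau> / \<mu>) * s ^ p" if j: "j < w" for j
    proof -
      have "\<mu> * (\<alpha> j)\<^sup>2 \<le> \<mu> * (\<Sum>i<w. (\<alpha> i)\<^sup>2)"
        by (rule mult_left_mono[OF member_le_sum]) (use j mu in auto)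
      also have "\<dots> \<le> q ^ p * \<tau>" using mu(2)[of \<alpha>] \<alpha>(1) by linarith
      finally have "(\<alpha> j)\<^sup>2 \<le> \<tau> / \<mu> * q ^ p" using mu(1) by (simp add: field_simps)
      then have "sqrt ((\<alpha> j)\<^sup>2) \<le> sqrt (\<tau> / \<mu> * q ^ p)" by (rule real_sqrt_le_mono)
      then have "\<bar>\<alpha> j\<bar> \<le> sqrt (\<tau> / \<mu> * q ^ p)" by simp
      also have "\<dots> = sqrt (\<tau> / \<mu>) * s ^ p" by (simp only: real_sqrt_mult real_sqrt_power s_def)
      finally show ?thesis .
    qed
    have "\<bar>\<Sum>j<w. \<alpha> j * ?T r j\<bar> \<le> (\<Sum>j<w. \<bar>\<alpha> j * ?T r j\<bar>)" by (rule sum_abs)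
    also have "\<dots> \<le> (\<Sum>j<w. (sqrt (\<tau> / \<mu>) * s ^ p) * \<tau>)"
      unfolding abs_mult by (intro sum_mono mult_mono bound tau r) (use s tau0 mu in auto)
    also have "\<dots> = K * s ^ p" unfolding K_def by simp
    finally show ?thesis using \<alpha>(2) by simp
  qed
  \<comment> \<open>a factor \<open>s\<close> per window of length \<open>w\<close> is a factor \<open>\<rho>\<close> per index; the division by \<open>s\<close> below pays for the
    incomplete window\<close>
  define \<rho> where "\<rho> = root w s"
  have rho: "0 < \<rho>" "\<rho> < 1" "\<rho> ^ w = s"
    unfolding \<rho>_def using s w_pos by (auto simp: real_root_pow_pos)
  have ordered: "\<bar>t r c\<bar> \<le> K / s * \<rho> ^ nat \<bar>r - c\<bar>" if rc: "r \<le> c" for r c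
  proof -
    define c0 r0 where "c0 = c mod int m" and "r0 = r - int m * (c div int m)"
    have c0: "0 \<le> c0" "c0 < int m" unfolding c0_def using m_pos by auto
    have c: "c = c0 + int m * (c div int m)" and r: "r = r0 + int m * (c div int m)"
      unfolding c0_def r0_def by auto
    have t0: "t r c = t r0 c0"
      using shift[of r0 "c div int m" c0] c r by metis
    have r0: "r0 \<le> c0" using rc c r by linarith
    define p where "p = nat (- (r0 div int w))"
    have "r0 div int w \<le> 0"
    proof -
      have "r0 div int w \<le> (int w - 1) div int w"
        by (rule zdiv_mono1) (use r0 c0 m_le_w w_pos in auto)
      also have "\<dots> = 0" using w_pos by (intro div_pos_pos_trivial) auto
      finally show ?thesis .
    qed
    then have p: "r0 = r0 mod int w - int p * int w"
      unfolding p_def by (simp add: minus_mult_left[symmetric])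
    have m0: "0 \<le> r0 mod int w" "r0 mod int w < int w" using w_pos by auto
    have lt: "nat (r0 mod int w) < w" "nat c0 < w" using m0 c0 m_le_w by linarith+
    have "\<bar>t r c\<bar> \<le> K * s ^ p"
      using lt far[of "nat (r0 mod int w)" "nat c0" p] p m0 c0 m_le_w t0 by simp
    also have "\<dots> = K / s * \<rho> ^ (w * Suc p)"
    proof -
      have "\<rho> ^ (w * Suc p) = s ^ Suc p" by (simp only: power_mult rho(3))
      then show ?thesis using s by simp
    qed
    also have "\<dots> \<le> K / s * \<rho> ^ nat \<bar>r - c\<bar>"
    proof -
      have "c - r = c0 - r0" using c r by linarith
      also have "\<dots> \<le> int w + int p * int w" using p m0 c0 m_le_w by linarith
      finally have "nat \<bar>r - c\<bar> \<le> w * Suc p" using rc by (simp add: nat_le_iff algebra_simps)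
      then show ?thesis using rho s K0
        by (intro mult_left_mono power_decreasing) auto
    qed
    finally show ?thesis .
  qed
  show thesis
  proof (rule that[of "K / s" \<rho>])
    show "\<bar>t r c\<bar> \<le> K / s * \<rho> ^ nat \<bar>r - c\<bar>" for r c
      using ordered[of r c] ordered[of c r] sym[of r c] by (cases "r \<le> c") (auto simp: abs_minus_commute)
  qed (use K0 s rho in auto)
qed

end

section \<open>A banded whitening filter\<close>

context toeplitz_kernel
begin

text \<open>Rows of \<open>l\<close> are the Yule-Walker rows, combined by a Gram-Schmidt matrix \<open>W\<close> of the leading coefficient.  By the
Yule-Walker equations \<open>l t\<close> is block lower triangular, and \<open>l\<^sup>T\<close> is so too: hence \<open>l t l\<^sup>T\<close> is block lower
triangular with diagonal blocks \<open>W x W\<^sup>T = 1\<close>, and by symmetry it is the identity.  The summation ranges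
\<open>I\<close> and \<open>J\<close> are arbitrary finite sets that contain the supports.\<close>

lemma factorization:
  obtains l where
    "\<And>r c. l (r + int m) (c + int m) = l r c"
    and "\<And>r c. l r c \<noteq> 0 \<Longrightarrow> int m * (r div int m) \<le> c \<and> c < int m * (r div int m) + int w"
    and "\<And>r c I J. finite I \<Longrightarrow> finite J \<Longrightarrow> (\<And>i. l r i \<noteq> 0 \<Longrightarrow> i \<in> I) \<Longrightarrow> (\<And>j. l c j \<noteq> 0 \<Longrightarrow> j \<in> J) \<Longrightarrow>
       (\<Sum>i\<in>I. \<Sum>j\<in>J. l r i * t i j * l c j) = (if r = c then 1 else 0)"
proof -
  obtain x where xt: "\<And>a k. a < m \<Longrightarrow> (\<Sum>j<w. x a j * t (int j) (int k)) = (if a = k then 1 else 0)"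
    and xp: "pos_kernel m x" using Yule_Walker by metis
  obtain W where W: "\<And>i j. i < m \<Longrightarrow> j < m \<Longrightarrow> bilinear_sum m x (W i) (W j) = (if i = j then 1 else 0)"
    using Gram_Schmidt_kernel[OF xp] by metis
  define base where "base r = int m * (r div int m)" for r
  define off where "off r = nat (r mod int m)" for r
  define y where "y a j = (\<Sum>b<m. W a b * x b j)" for a j
  define l where "l r c = (if base r \<le> c \<and> c < base r + int w then y (off r) (nat (c - base r)) else 0)" for r c
  have off: "off r < m" for r unfolding off_def using m_pos by (simp add: nat_less_iff)
  have r_eq: "r = base r + int (off r)" for r unfolding base_def off_def using m_pos by simp
  have base_shift: "base (r + int m) = base r + int m" "off (r + int m) = off r" for r
    unfolding base_def off_def using m_pos by (simp_all add: algebra_simps)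
  have base_le: "base r < base c \<Longrightarrow> base r + int m \<le> base c" for r c
  proof -
    assume "base r < base c"
    then have "r div int m < c div int m" unfolding base_def using m_pos by simp
    then have "r div int m + 1 \<le> c div int m" by simp
    then have "int m * (r div int m + 1) \<le> int m * (c div int m)" by (rule mult_left_mono) simp
    then show ?thesis unfolding base_def by (simp add: algebra_simps)
  qed
  have t_base: "t (base r + i) (base r + j) = t i j" for r i j
    using shift[of i "r div int m" j] unfolding base_def by (simp add: add.commute)
  have yt: "(\<Sum>j<w. y a j * t (int j) (int k)) = (if k < m then W a k else 0)" for a k
  proof -
    have "(\<Sum>j<w. y a j * t (int j) (int k)) = (\<Sum>j<w. \<Sum>b<m. W a b * (x b j * t (int j) (int k)))"
      unfolding y_def by (simp add: sum_distrib_right mult.assoc)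
    also have "\<dots> = (\<Sum>b<m. \<Sum>j<w. W a b * (x b j * t (int j) (int k)))" by (rule sum.swap)
    also have "\<dots> = (\<Sum>b<m. W a b * (\<Sum>j<w. x b j * t (int j) (int k)))" by (simp only: sum_distrib_left)
    also have "\<dots> = (\<Sum>b<m. W a b * (if b = k then 1 else 0))" by (intro sum.cong refl) (simp add: xt)
    also have "\<dots> = (if k < m then W a k else 0)" by (simp add: if_distrib cong: if_cong)
    finally show ?thesis .
  qed
  have l_sum: "(\<Sum>i\<in>I. l r i * f i) = (\<Sum>i<w. y (off r) i * f (base r + int i))"
    if I: "finite I" "\<And>i. l r i \<noteq> 0 \<Longrightarrow> i \<in> I" for r I and f :: "int \<Rightarrow> real"
  proof -
    let ?J = "(\<lambda>i. base r + int i) ` {..<w}"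
    have "(\<Sum>i\<in>I. l r i * f i) = (\<Sum>i\<in>I \<union> ?J. l r i * f i)"
      by (rule sum.mono_neutral_left) (use I in auto)
    also have "\<dots> = (\<Sum>i\<in>?J. l r i * f i)"
    proof (rule sum.mono_neutral_right)
      show "\<forall>i\<in>(I \<union> ?J) - ?J. l r i * f i = 0"
      proof
        fix i assume "i \<in> (I \<union> ?J) - ?J"
        then have "i \<noteq> base r + int k" if "k < w" for k using that by blast
        from this[of "nat (i - base r)"] have "\<not> (base r \<le> i \<and> i < base r + int w)"
          by (auto simp: nat_less_iff)
        then show "l r i * f i = 0" unfolding l_def by auto
      qed
    qed (use I in auto)
    also have "\<dots> = (\<Sum>i<w. l r (base r + int i) * f (base r + int i))"
      by (subst sum.reindex) (auto simp: inj_on_def)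
    also have "\<dots> = (\<Sum>i<w. y (off r) i * f (base r + int i))"
      by (intro sum.cong refl) (simp add: l_def)
    finally show ?thesis .
  qed
  have lower: "(\<Sum>i\<in>I. \<Sum>j\<in>J. l r i * t i j * l c j) = (if r = c then 1 else 0)"
    if I: "finite I" "\<And>i. l r i \<noteq> 0 \<Longrightarrow> i \<in> I" and J: "finite J" "\<And>j. l c j \<noteq> 0 \<Longrightarrow> j \<in> J"
      and le: "base r \<le> base c" for r c I J
  proof -
    define d where "d = nat (base c - base r)"
    have d: "base c = base r + int d" unfolding d_def using le by simp
    have lt: "(\<Sum>i\<in>I. l r i * t i (base c + int j)) = (if d + j < m then W (off r) (d + j) else 0)" for j
    proof -
      have "(\<Sum>i\<in>I. l r i * t i (base c + int j)) = (\<Sum>i<w. y (off r) i * t (base r + int i) (base c + int j))"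
        by (rule l_sum[OF I])
      also have "\<dots> = (\<Sum>i<w. y (off r) i * t (int i) (int (d + j)))"
        unfolding d using t_base[of r _ "int (d + j)"] by (simp add: add.assoc)
      also have "\<dots> = (if d + j < m then W (off r) (d + j) else 0)" by (rule yt)
      finally show ?thesis .
    qed
    have "(\<Sum>i\<in>I. \<Sum>j\<in>J. l r i * t i j * l c j) = (\<Sum>j\<in>J. \<Sum>i\<in>I. l r i * t i j * l c j)" by (rule sum.swap)
    also have "\<dots> = (\<Sum>j\<in>J. l c j * (\<Sum>i\<in>I. l r i * t i j))"
      by (simp add: sum_distrib_left mult_ac)
    also have "\<dots> = (\<Sum>j<w. y (off c) j * (\<Sum>i\<in>I. l r i * t i (base c + int j)))"
      by (rule l_sum[OF J])
    also have "\<dots> = (\<Sum>j<w. y (off c) j * (if d + j < m then W (off r) (d + j) else 0))" unfolding lt ..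
    also have "\<dots> = (if r = c then 1 else 0)"
    proof (cases "base r = base c")
      case True
      then have d0: "d = 0" unfolding d_def by simp
      have "(\<Sum>j<w. y (off c) j * (if d + j < m then W (off r) (d + j) else 0)) = (\<Sum>j<m. y (off c) j * W (off r) j)"
        unfolding d0 by (rule sum.mono_neutral_cong_right) (use m_le_w in auto)
      also have "\<dots> = (\<Sum>j<m. \<Sum>b<m. W (off c) b * x b j * W (off r) j)"
        unfolding y_def by (simp add: sum_distrib_right)
      also have "\<dots> = (\<Sum>b<m. \<Sum>j<m. W (off c) b * x b j * W (off r) j)" by (rule sum.swap)
      also have "\<dots> = bilinear_sum m x (W (off c)) (W (off r))" by (simp add: bilinear_sum_def)
      also have "\<dots> = (if off c = off r then 1 else 0)" using W off by simp
      also have "\<dots> = (if r = c then 1 else 0)" using r_eq[of r] r_eq[of c] True by auto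
      finally show ?thesis .
    next
      case False
      then have "base r + int m \<le> base c" using base_le[of r c] le by simp
      then have "m \<le> d" unfolding d_def by simp
      moreover have "r \<noteq> c" using False by auto
      ultimately show ?thesis by simp
    qed
    finally show ?thesis .
  qed
  show thesis
  proof (rule that[of l])
    show "l (r + int m) (c + int m) = l r c" for r c
      unfolding l_def base_shift by simp
    show "int m * (r div int m) \<le> c \<and> c < int m * (r div int m) + int w" if "l r c \<noteq> 0" for r c
      using that unfolding l_def base_def by (auto split: if_splits)
    fix r c and I J :: "int set"
    assume I: "finite I" "\<And>i. l r i \<noteq> 0 \<Longrightarrow> i \<in> I" and J: "finite J" "\<And>j. l c j \<noteq> 0 \<Longrightarrow> j \<in> J"
    show "(\<Sum>i\<in>I. \<Sum>j\<in>J. l r i * t i j * l c j) = (if r = c then 1 else 0)"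
    proof (cases "base r \<le> base c")
      case True
      then show ?thesis using lower[OF I J] by simp
    next
      case False
      have "(\<Sum>i\<in>I. \<Sum>j\<in>J. l r i * t i j * l c j) = (\<Sum>j\<in>J. \<Sum>i\<in>I. l c j * t j i * l r i)"
        by (subst sum.swap) (simp add: sym mult_ac)
      also have "\<dots> = (if c = r then 1 else 0)" using lower[OF J I] False by simp
      finally show ?thesis by auto
    qed
  qed
qed

end

section \<open>Periodization of banded kernels\<close>

definition banded :: "int \<Rightarrow> (int \<Rightarrow> int \<Rightarrow> real) \<Rightarrow> bool" where
  "banded b k \<longleftrightarrow> (\<forall>r c. k r c \<noteq> 0 \<longrightarrow> \<bar>c - r\<bar> \<le> b)"

definition periodic :: "nat \<Rightarrow> (int \<Rightarrow> int \<Rightarrow> real) \<Rightarrow> bool" where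
  "periodic M k \<longleftrightarrow> (\<forall>r c q. k (r + int M * q) (c + int M * q) = k r c)"

text \<open>The circulant \<open>M \<times> M\<close> matrix induced by a kernel on the integers: its entries are sums over residue
classes modulo \<open>M\<close>.  For a kernel of band width \<open>b\<close> the finite window around the diagonal contains all nonzero
terms.\<close>

definition wrap :: "nat \<Rightarrow> int \<Rightarrow> (int \<Rightarrow> int \<Rightarrow> real) \<Rightarrow> real mat" where
  "wrap M b k = mat M M (\<lambda>(r, c). \<Sum>d\<in>{d \<in> {int r - b..int r + b}. d mod int M = int c}. k (int r) d)"

lemma wrap_carrier [simp]: "wrap M b k \<in> carrier_mat M M" "dim_row (wrap M b k) = M" "dim_col (wrap M b k) = M"
  by (auto simp: wrap_def)

lemma wrap_index:
  assumes "banded b k" "finite I" "\<And>d. k (int r) d \<noteq> 0 \<Longrightarrow> d \<in> I" "r < M" "c < M"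
  shows "wrap M b k $$ (r, c) = (\<Sum>d\<in>{d \<in> I. d mod int M = int c}. k (int r) d)"
proof -
  let ?S = "{d \<in> {int r - b..int r + b}. d mod int M = int c}" and ?T = "{d \<in> I. d mod int M = int c}"
  have fin: "finite ?S" "finite ?T"
    by (rule finite_subset[of _ "{int r - b..int r + b}"]) (use assms(2) in auto)
  have "wrap M b k $$ (r, c) = (\<Sum>d\<in>?S. k (int r) d)" using assms by (simp add: wrap_def)
  also have "\<dots> = (\<Sum>d\<in>?S \<inter> ?T. k (int r) d)"
    by (rule sum.mono_neutral_right[OF fin(1)]) (use assms in auto)
  also have "\<dots> = (\<Sum>d\<in>?T. k (int r) d)"
    by (rule sum.mono_neutral_left[OF fin(2)]) (use assms in \<open>fastforce simp: banded_def\<close>)+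
  finally show ?thesis .
qed

lemma sum_residues:
  fixes f :: "int \<Rightarrow> real"
  assumes "finite I" "0 < M"
  shows "(\<Sum>d<M. \<Sum>e\<in>{e \<in> I. e mod int M = int d}. f e) = (\<Sum>e\<in>I. f e)"
proof -
  have "(\<Sum>d\<in>{..<M}. \<Sum>e\<in>{e \<in> I. nat (e mod int M) = d}. f e) = (\<Sum>e\<in>I. f e)"
    by (rule sum.group) (use assms in \<open>auto simp: nat_less_iff\<close>)
  moreover have "{e \<in> I. nat (e mod int M) = d} = {e \<in> I. e mod int M = int d}" for d
    using assms(2) by auto
  ultimately show ?thesis by simp
qed

text \<open>Kernels act on \<open>M\<close>-periodic sequences, and this action is multiplicative: summing over a representative and
over its residue class is summing over all integers.\<close>

lemma wrap_mult:
  assumes M: "0 < M" and b1: "banded b1 k1" and b2: "banded b2 k2" and p2: "periodic M k2"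
  shows "wrap M b1 k1 * wrap M b2 k2 = wrap M (b1 + b2) (\<lambda>r c. \<Sum>e\<in>{r - b1..r + b1}. k1 r e * k2 e c)"
    (is "_ = wrap M _ ?k")
proof (rule eq_matI)
  fix r c assume "r < dim_row (wrap M (b1 + b2) ?k)" "c < dim_col (wrap M (b1 + b2) ?k)"
  then have r: "r < M" and c: "c < M" by auto
  define S where "S e = (\<Sum>d\<in>{d \<in> {e - b2..e + b2}. d mod int M = int c}. k2 e d)" for e
  have S_per: "S (e + int M * q) = S e" for e q
    unfolding S_def
  proof (rule sum.reindex_bij_witness[of _ "\<lambda>d. d + int M * q" "\<lambda>d. d - int M * q"])
    fix d assume "d \<in> {d \<in> {e - b2..e + b2}. d mod int M = int c}"
    then show "d + int M * q \<in> {d \<in> {e + int M * q - b2..e + int M * q + b2}. d mod int M = int c}"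
      by simp
  next
    fix d assume d: "d \<in> {d \<in> {e + int M * q - b2..e + int M * q + b2}. d mod int M = int c}"
    have "(d - int M * q) mod int M = d mod int M"
      using mod_mult_self2[of "d - int M * q" "int M" q] by simp
    then show "d - int M * q \<in> {d \<in> {e - b2..e + b2}. d mod int M = int c}" using d by auto
    show "k2 e (d - int M * q) = k2 (e + int M * q) d"
      using p2[unfolded periodic_def, rule_format, of e q "d - int M * q"] by simp
  qed auto
  have S_mod: "S e = S (e mod int M)" for e
    using S_per[of "e mod int M" "e div int M"] by (simp add: add.commute)
  have S_res: "S (int d) = S e" if "e mod int M = int d" for e d
    using S_mod[of e] that by simp
  have S_wide: "S e = (\<Sum>d\<in>{d \<in> {int r - (b1 + b2)..int r + (b1 + b2)}. d mod int M = int c}. k2 e d)"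
    if "e \<in> {int r - b1..int r + b1}" for e
  proof -
    have fin: "finite {d \<in> {int r - (b1 + b2)..int r + (b1 + b2)}. d mod int M = int c}"
      by (rule finite_subset[of _ "{int r - (b1 + b2)..int r + (b1 + b2)}"]) auto
    show ?thesis unfolding S_def
      by (rule sum.mono_neutral_left[OF fin]) (use that b2 in \<open>fastforce simp: banded_def\<close>)+
  qed
  let ?I = "{int r - b1..int r + b1}"
  let ?D = "{d \<in> {int r - (b1 + b2)..int r + (b1 + b2)}. d mod int M = int c}"
  have "(wrap M b1 k1 * wrap M b2 k2) $$ (r, c) = (\<Sum>d<M. wrap M b1 k1 $$ (r, d) * wrap M b2 k2 $$ (d, c))"
    using r c by (simp add: scalar_prod_def lessThan_atLeast0)
  also have "\<dots> = (\<Sum>d<M. (\<Sum>e\<in>{e \<in> ?I. e mod int M = int d}. k1 (int r) e) * S (int d))"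
    using r c by (intro sum.cong) (auto simp: wrap_def S_def)
  also have "\<dots> = (\<Sum>d<M. \<Sum>e\<in>{e \<in> ?I. e mod int M = int d}. k1 (int r) e * S e)"
    unfolding sum_distrib_right by (intro sum.cong refl) (use S_res in simp)
  also have "\<dots> = (\<Sum>e\<in>?I. k1 (int r) e * S e)"
    by (rule sum_residues) (use M in auto)
  also have "\<dots> = (\<Sum>e\<in>?I. \<Sum>d\<in>?D. k1 (int r) e * k2 e d)"
    using S_wide by (simp add: sum_distrib_left)
  also have "\<dots> = (\<Sum>d\<in>?D. ?k (int r) d)" by (rule sum.swap)
  also have "\<dots> = wrap M (b1 + b2) ?k $$ (r, c)" using r c by (simp add: wrap_def)
  finally show "(wrap M b1 k1 * wrap M b2 k2) $$ (r, c) = wrap M (b1 + b2) ?k $$ (r, c)" .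
qed auto

text \<open>The reflection \<open>d \<mapsto> c + r - d\<close> exchanges the representatives of \<open>r\<close> near \<open>c\<close> with those of \<open>c\<close> near \<open>r\<close>.\<close>

lemma wrap_transpose:
  assumes M: "0 < M" and p: "periodic M k"
  shows "transpose_mat (wrap M b k) = wrap M b (\<lambda>r c. k c r)"
proof (rule eq_matI)
  fix r c assume "r < dim_row (wrap M b (\<lambda>r c. k c r))" "c < dim_col (wrap M b (\<lambda>r c. k c r))"
  then have r: "r < M" and c: "c < M" by auto
  have reflect: "(int x + int y - d) mod int M = int x" if "d mod int M = int y" "x < M" for x y d
  proof -
    have "(int x + int y - d) mod int M = (int x + int y - d mod int M) mod int M"
      by (simp add: mod_diff_right_eq)
    then show ?thesis using that by simp
  qed
  have "(\<Sum>d\<in>{d \<in> {int c - b..int c + b}. d mod int M = int r}. k (int c) d) =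
      (\<Sum>e\<in>{e \<in> {int r - b..int r + b}. e mod int M = int c}. k e (int r))"
  proof (rule sum.reindex_bij_witness[of _ "\<lambda>d. int c + int r - d" "\<lambda>d. int c + int r - d"])
    fix d assume d: "d \<in> {d \<in> {int c - b..int c + b}. d mod int M = int r}"
    then show "int c + int r - d \<in> {e \<in> {int r - b..int r + b}. e mod int M = int c}"
      using reflect[of d r c] c by auto
    define q where "q = d div int M"
    have dq: "d = int r + int M * q" using d mult_div_mod_eq[of "int M" d] unfolding q_def by simp
    show "k (int c + int r - d) (int r) = k (int c) d"
      using p[unfolded periodic_def, rule_format, of "int c + int r - d" q "int r"] dq by simp
  next
    fix d assume d: "d \<in> {e \<in> {int r - b..int r + b}. e mod int M = int c}"
    then show "int c + int r - d \<in> {d \<in> {int c - b..int c + b}. d mod int M = int r}"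
      using reflect[of d c r] r by (auto simp: add.commute)
  qed auto
  then show "transpose_mat (wrap M b k) $$ (r, c) = wrap M b (\<lambda>r c. k c r) $$ (r, c)"
    using r c by (simp add: wrap_def)
qed auto

lemma wrap_add: "wrap M b (\<lambda>r c. k1 r c + k2 r c) = wrap M b k1 + wrap M b k2"
  by (rule eq_matI) (auto simp: wrap_def sum.distrib)

lemma wrap_identity:
  assumes "0 \<le> b" shows "wrap M b (\<lambda>r c. if r = c then 1 else 0) = 1\<^sub>m M"
proof (rule eq_matI)
  fix r c assume "r < dim_row (1\<^sub>m M :: real mat)" "c < dim_col (1\<^sub>m M :: real mat)"
  then have r: "r < M" and c: "c < M" by auto
  let ?k = "\<lambda>r c. if r = c then 1 else 0 :: real"
  have "wrap M b ?k $$ (r, c) = (\<Sum>d\<in>{d \<in> {int r}. d mod int M = int c}. ?k (int r) d)"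
    by (rule wrap_index) (use assms r c in \<open>auto simp: banded_def split: if_splits\<close>)
  also have "{d \<in> {int r}. d mod int M = int c} = (if r = c then {int r} else {})"
    using r by auto
  finally show "wrap M b ?k $$ (r, c) = 1\<^sub>m M $$ (r, c)" using r c by simp
qed auto

lemma op_bound_wrap:
  assumes M: "0 < M" and K: "0 \<le> K" and p: "periodic M k"
    and row: "\<And>r. (\<Sum>d\<in>{r - b..r + b}. \<bar>k r d\<bar>) \<le> K"
    and col: "\<And>c. (\<Sum>d\<in>{c - b..c + b}. \<bar>k d c\<bar>) \<le> K"
  shows "op_bound (wrap M b k) K"
proof -
  have row_sum: "(\<Sum>c<M. \<bar>wrap M b k $$ (r, c)\<bar>) \<le> K"
    if r: "r < M" and row: "\<And>r. (\<Sum>d\<in>{r - b..r + b}. \<bar>k r d\<bar>) \<le> K" for r k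
  proof -
    have "(\<Sum>c<M. \<bar>wrap M b k $$ (r, c)\<bar>) \<le>
        (\<Sum>c<M. \<Sum>d\<in>{d \<in> {int r - b..int r + b}. d mod int M = int c}. \<bar>k (int r) d\<bar>)"
      by (rule sum_mono) (use r in \<open>simp add: wrap_def sum_abs\<close>)
    also have "\<dots> = (\<Sum>d\<in>{int r - b..int r + b}. \<bar>k (int r) d\<bar>)"
      by (rule sum_residues) (use M in auto)
    also have "\<dots> \<le> K" by (rule row)
    finally show ?thesis .
  qed
  show ?thesis
  proof (rule op_bound_schur_test[OF _ K])
    show "wrap M b k \<in> carrier_mat M M" by simp
    show "(\<Sum>j<M. \<bar>wrap M b k $$ (i, j)\<bar>) \<le> K" if "i < M" for i by (rule row_sum[OF that row])
    show "(\<Sum>i<M. \<bar>wrap M b k $$ (i, j)\<bar>) \<le> K" if j: "j < M" for j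
    proof -
      have "(\<Sum>i<M. \<bar>wrap M b k $$ (i, j)\<bar>) = (\<Sum>i<M. \<bar>transpose_mat (wrap M b k) $$ (j, i)\<bar>)"
        using j by simp
      also have "\<dots> \<le> K" unfolding wrap_transpose[OF M p] by (rule row_sum[OF j col])
      finally show ?thesis .
    qed
  qed
qed

lemma wrap_shift:
  assumes M: "M = m * N" "0 < M" and k: "\<And>r c. k (r + int m) (c + int m) = k r c" and b: "banded b k"
    and r: "r < M" and c: "c < M"
  shows "wrap M b k $$ ((r + m) mod M, (c + m) mod M) = wrap M b k $$ (r, c)"
proof -
  have p: "k (r + int m * q) (c + int m * q) = k r c" for r c q
    by (rule shift_multiple) (rule k)
  define s where "s = int (r + m) div int M"
  have rs: "int ((r + m) mod M) = int r + int m - int M * s"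
  proof -
    have "int ((r + m) mod M) = int (r + m) - int M * s"
      unfolding s_def zmod_int by (rule minus_mult_div_eq_mod[symmetric])
    then show ?thesis by simp
  qed
  let ?r' = "int ((r + m) mod M)"
  have "(\<Sum>d\<in>{d \<in> {?r' - b..?r' + b}. d mod int M = int ((c + m) mod M)}. k ?r' d)
      = (\<Sum>d\<in>{d \<in> {int r - b..int r + b}. d mod int M = int c}. k (int r) d)"
  proof (rule sum.reindex_bij_witness[of _ "\<lambda>d. d + int m - int M * s" "\<lambda>d. d - int m + int M * s"])
    fix d assume d: "d \<in> {d \<in> {?r' - b..?r' + b}. d mod int M = int ((c + m) mod M)}"
    have "(d - int m + int M * s) mod int M = (d - int m) mod int M" by simp
    also have "\<dots> = (d mod int M - int m) mod int M" by (simp add: mod_diff_left_eq)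
    also have "\<dots> = ((int c + int m) mod int M - int m) mod int M" using d by (simp add: zmod_int)
    also have "\<dots> = int c" using c by (simp add: mod_diff_left_eq)
    finally show "d - int m + int M * s \<in> {d \<in> {int r - b..int r + b}. d mod int M = int c}"
      using d rs by auto
    have e: "d - int m + int M * s = d + int m * (int N * s - 1)" "int r = ?r' + int m * (int N * s - 1)"
      using rs M by (simp_all add: algebra_simps)
    show "k (int r) (d - int m + int M * s) = k ?r' d" unfolding e using p by simp
  next
    fix d assume d: "d \<in> {d \<in> {int r - b..int r + b}. d mod int M = int c}"
    have "(d + int m - int M * s) mod int M = (d + int m) mod int M"
      using mod_mult_self2[of "d + int m - int M * s" "int M" s] by simp
    also have "\<dots> = (d mod int M + int m) mod int M" by (simp add: mod_add_left_eq)
    also have "\<dots> = int ((c + m) mod M)" using d by (simp add: zmod_int)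
    finally show "d + int m - int M * s \<in> {d \<in> {?r' - b..?r' + b}. d mod int M = int ((c + m) mod M)}"
      using d rs by auto
  qed auto
  then show ?thesis using r c M(2) by (simp add: wrap_def)
qed

section \<open>Truncation of the covariance kernel\<close>

lemma geometric_tail_nat:
  fixes \<rho> :: real
  assumes "0 < \<rho>" "\<rho> < 1" "finite D" "\<And>d. d \<in> D \<Longrightarrow> h \<le> d"
  shows "(\<Sum>d\<in>D. \<rho> ^ d) \<le> \<rho> ^ h / (1 - \<rho>)"
proof -
  have "(\<Sum>d\<in>D. \<rho> ^ d) = (\<Sum>d\<in>D. \<rho> ^ h * \<rho> ^ (d - h))"
    by (intro sum.cong refl) (simp add: power_add[symmetric] assms)
  also have "\<dots> = \<rho> ^ h * (\<Sum>e\<in>(\<lambda>d. d - h) ` D. \<rho> ^ e)"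
    unfolding sum_distrib_left
    by (subst sum.reindex) (use assms in \<open>auto simp: inj_on_def dest: eq_diff_iff[THEN iffD1, rotated 2]\<close>)
  also have "(\<Sum>e\<in>(\<lambda>d. d - h) ` D. \<rho> ^ e) \<le> (\<Sum>e. \<rho> ^ e)"
    by (rule sum_le_suminf) (use assms in \<open>auto intro: summable_geometric\<close>)
  also have "(\<Sum>e. \<rho> ^ e) = 1 / (1 - \<rho>)" by (rule suminf_geometric) (use assms in auto)
  finally show ?thesis using assms by simp
qed

lemma geometric_tail_int:
  fixes \<rho> :: real and i :: int
  assumes "0 < \<rho>" "\<rho> < 1" "finite J" "\<And>j. j \<in> J \<Longrightarrow> int h \<le> \<bar>i - j\<bar>"
  shows "(\<Sum>j\<in>J. \<rho> ^ nat \<bar>i - j\<bar>) \<le> 2 * (\<rho> ^ h / (1 - \<rho>))"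
proof -
  have half: "(\<Sum>j\<in>A. \<rho> ^ nat \<bar>i - j\<bar>) \<le> \<rho> ^ h / (1 - \<rho>)" if A: "A \<subseteq> J" "inj_on (\<lambda>j. nat \<bar>i - j\<bar>) A" for A
  proof -
    have "finite A" using A(1) assms(3) finite_subset by blast
    have "(\<Sum>j\<in>A. \<rho> ^ nat \<bar>i - j\<bar>) = (\<Sum>d\<in>(\<lambda>j. nat \<bar>i - j\<bar>) ` A. \<rho> ^ d)"
      by (subst sum.reindex[OF A(2)]) simp
    also have "\<dots> \<le> \<rho> ^ h / (1 - \<rho>)"
    proof (rule geometric_tail_nat)
      fix d assume "d \<in> (\<lambda>j. nat \<bar>i - j\<bar>) ` A"
      then obtain j where "j \<in> J" "d = nat \<bar>i - j\<bar>" using A(1) by blast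
      then show "h \<le> d" using assms(4)[of j] by simp
    qed (use assms \<open>finite A\<close> in auto)
    finally show ?thesis .
  qed
  have "(\<Sum>j\<in>J. \<rho> ^ nat \<bar>i - j\<bar>) = (\<Sum>j\<in>J \<inter> {j. j \<le> i}. \<rho> ^ nat \<bar>i - j\<bar>) + (\<Sum>j\<in>J - {j. j \<le> i}. \<rho> ^ nat \<bar>i - j\<bar>)"
    by (rule sum.Int_Diff[OF assms(3)])
  also have "\<dots> \<le> \<rho> ^ h / (1 - \<rho>) + \<rho> ^ h / (1 - \<rho>)"
    by (intro add_mono half) (auto simp: inj_on_def)
  finally show ?thesis by simp
qed

definition shift_invariant :: "nat \<Rightarrow> nat \<Rightarrow> real mat \<Rightarrow> bool" where
  "shift_invariant m M A \<longleftrightarrow>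
     (\<forall>r<M. \<forall>c<M. A $$ ((r + m) mod M, (c + m) mod M) = A $$ (r, c))"

text \<open>The blocks of \<open>r\<close> and \<open>c\<close> have cyclic distance at most \<open>n\<close>; the integer \<open>d\<close> represents \<open>c\<close> on
the universal cover of the circle.\<close>

definition near :: "nat \<Rightarrow> nat \<Rightarrow> nat \<Rightarrow> nat \<Rightarrow> nat \<Rightarrow> bool" where
  "near m n M r c \<longleftrightarrow> (\<exists>d. d mod int M = int c \<and> \<bar>d div int m - int r div int m\<bar> \<le> int n)"

context toeplitz_kernel
begin

definition trunc :: "nat \<Rightarrow> int \<Rightarrow> int \<Rightarrow> real" where
  "trunc h r c = (if \<bar>c div int m - r div int m\<bar> \<le> int h then t r c else 0)"

text \<open>The circulant approximation in kernel form: keep the lags up to half the period and wrap them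
around.  If \<open>N\<close> is even, the lags \<open>N/2\<close> and \<open>-N/2\<close> fall on the same block and add up.\<close>

definition circ :: "nat \<Rightarrow> real mat" where
  "circ N = wrap (m * N) (int m * int (N div 2 + 1)) (trunc (N div 2))"

lemma div_shift: "(r + int m) div int m = r div int m + 1"
  using m_pos by simp

lemma trunc_shift: "trunc h (r + int m) (c + int m) = trunc h r c"
  unfolding trunc_def div_shift shift1 by simp

lemma trunc_sym: "trunc h r c = trunc h c r"
  unfolding trunc_def by (auto simp: sym abs_minus_commute)

lemma block_diff:
  "int m * (c div int m - r div int m) < c - r + int m"
  "c - r < int m * (c div int m - r div int m) + int m"
proof -
  have "c = int m * (c div int m) + c mod int m" "r = int m * (r div int m) + r mod int m" by auto
  moreover have "0 \<le> c mod int m" "c mod int m < int m" "0 \<le> r mod int m" "r mod int m < int m"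
    using m_pos by auto
  ultimately show "int m * (c div int m - r div int m) < c - r + int m"
    "c - r < int m * (c div int m - r div int m) + int m" unfolding right_diff_distrib by linarith+
qed

lemma banded_trunc: "banded (int m * int (h + 1)) (trunc h)"
  unfolding banded_def
proof (intro allI impI)
  fix r c assume "trunc h r c \<noteq> 0"
  then have "\<bar>c div int m - r div int m\<bar> \<le> int h" unfolding trunc_def by (auto split: if_splits)
  then have d: "c div int m - r div int m \<le> int h" "- int h \<le> c div int m - r div int m" by linarith+
  have "int m * (c div int m - r div int m) \<le> int m * int h" by (rule mult_left_mono[OF d(1)]) simp
  moreover have "int m * (- int h) \<le> int m * (c div int m - r div int m)" by (rule mult_left_mono[OF d(2)]) simp
  moreover have "int m * int (h + 1) = int m * int h + int m" by (simp add: algebra_simps)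
  moreover have "int m * (- int h) = - (int m * int h)" by simp
  ultimately show "\<bar>c - r\<bar> \<le> int m * int (h + 1)" using block_diff[of c r] by linarith
qed

text \<open>Blocks at distance more than \<open>h\<close> contain only indices at distance at least \<open>h\<close>, so the omitted part of a row is
dominated by the tail of a geometric series.\<close>

lemma trunc_tail:
  obtains \<tau> K where "\<tau> \<longlonglongrightarrow> 0" "0 < K"
    "\<And>h i J. finite J \<Longrightarrow> (\<Sum>j\<in>J. \<bar>t i j - trunc h i j\<bar>) \<le> \<tau> h"
    "\<And>h i J. finite J \<Longrightarrow> (\<Sum>j\<in>J. \<bar>trunc h i j\<bar>) \<le> K"
proof -
  obtain K \<rho> where K: "0 \<le> K" and rho: "0 < \<rho>" "\<rho> < 1" and t: "\<And>r c. \<bar>t r c\<bar> \<le> K * \<rho> ^ nat \<bar>r - c\<bar>"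
    using decay by metis
  define \<tau> where "\<tau> h = K * (2 * (\<rho> ^ h / (1 - \<rho>)))" for h :: nat
  have bound: "(\<Sum>j\<in>J. \<bar>f j\<bar>) \<le> \<tau> h"
    if J: "finite J" and f: "\<And>j. j \<in> J \<Longrightarrow> f j \<noteq> 0 \<Longrightarrow> int h \<le> \<bar>i - j\<bar>" "\<And>j. \<bar>f j\<bar> \<le> \<bar>t i j\<bar>" for J f h i
  proof -
    let ?J = "{j \<in> J. f j \<noteq> 0}"
    have "(\<Sum>j\<in>J. \<bar>f j\<bar>) = (\<Sum>j\<in>?J. \<bar>f j\<bar>)"
      by (rule sum.mono_neutral_right) (use J in auto)
    also have "\<dots> \<le> (\<Sum>j\<in>?J. K * \<rho> ^ nat \<bar>i - j\<bar>)"
      by (intro sum_mono order_trans[OF f(2) t])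
    also have "\<dots> = K * (\<Sum>j\<in>?J. \<rho> ^ nat \<bar>i - j\<bar>)" by (simp only: sum_distrib_left)
    also have "\<dots> \<le> \<tau> h" unfolding \<tau>_def
      by (intro mult_left_mono geometric_tail_int K) (use rho J f(1) in auto)
    finally show ?thesis .
  qed
  show thesis
  proof (rule that[of \<tau> "\<tau> 0 + 1"])
    have "(\<lambda>h. K * (2 * (\<rho> ^ h / (1 - \<rho>)))) \<longlonglongrightarrow> K * (2 * (0 / (1 - \<rho>)))"
      by (intro tendsto_intros LIMSEQ_power_zero) (use rho in auto)
    then show "\<tau> \<longlonglongrightarrow> 0" unfolding \<tau>_def by simp
    have "0 \<le> \<tau> 0" unfolding \<tau>_def using K rho by simp
    then show "0 < \<tau> 0 + 1" by simp
    show "(\<Sum>j\<in>J. \<bar>t i j - trunc h i j\<bar>) \<le> \<tau> h" if "finite J" for h i J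
    proof (rule bound[OF that])
      fix j assume "t i j - trunc h i j \<noteq> 0"
      then have "int h + 1 \<le> \<bar>j div int m - i div int m\<bar>" unfolding trunc_def by (auto split: if_splits)
      then have "int m * (int h + 1) \<le> int m * \<bar>j div int m - i div int m\<bar>" by (intro mult_left_mono) auto
      also have "\<dots> = \<bar>int m * (j div int m - i div int m)\<bar>" by (simp add: abs_mult)
      also have "\<dots> \<le> \<bar>i - j\<bar> + int m" using block_diff[of j i] by linarith
      finally have "int m * int h \<le> \<bar>i - j\<bar>" by (simp add: distrib_left)
      moreover have "1 * int h \<le> int m * int h" using m_pos by (intro mult_right_mono) auto
      ultimately show "int h \<le> \<bar>i - j\<bar>" by linarith
    qed (auto simp: trunc_def)
    show "(\<Sum>j\<in>J. \<bar>trunc h i j\<bar>) \<le> \<tau> 0 + 1" if "finite J" for h i J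
      using bound[OF that, of "trunc h i" 0 i] by (force simp: trunc_def)
  qed
qed

end

section \<open>Whitening the circulant approximation\<close>

context toeplitz_kernel
begin

lemma circ_carrier [simp]: "circ N \<in> carrier_mat (m * N) (m * N)"
  by (simp add: circ_def)

lemma periodic_of_shift:
  assumes "\<And>r c. k (r + int m) (c + int m) = k r c"
  shows "periodic (m * N) k"
  unfolding periodic_def
proof (intro allI)
  fix r c q
  show "k (r + int (m * N) * q) (c + int (m * N) * q) = k r c"
    using shift_multiple[of k m r "int N * q" c, OF assms] by (simp add: mult.assoc)
qed

text \<open>Wrapping turns \<open>l t l\<^sup>T = 1\<close> into a statement on circulant matrices, except that \<open>circ\<close> wraps the truncated
kernel.  Up to its sign, the error is \<open>l\<close> applied on both sides to the omitted part of \<open>t\<close>, so its row sums are at most the tail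
sums of \<open>t\<close> times the square of a bound on the row and column sums of \<open>l\<close>.\<close>

lemma approximate_factorization:
  obtains L :: "nat \<Rightarrow> real mat" and \<Lambda> K :: real and \<eta> :: "nat \<Rightarrow> real"
  where "\<eta> \<longlonglongrightarrow> 0" "0 < \<Lambda>" "0 < K"
    and "\<And>N. L N \<in> carrier_mat (m * N) (m * N)"
    and "\<And>N. 0 < N \<Longrightarrow> op_bound (L N) \<Lambda>"
    and "\<And>N. 0 < N \<Longrightarrow> op_bound (circ N) K"
    and "\<And>N. 0 < N \<Longrightarrow> \<exists>E \<in> carrier_mat (m * N) (m * N).
       L N * circ N * transpose_mat (L N) = 1\<^sub>m (m * N) + E \<and> op_bound E (\<eta> N)"
    and "\<And>N. 0 < N \<Longrightarrow> shift_invariant m (m * N) (transpose_mat (L N) * L N)"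
    and "\<And>N r c. 0 < N \<Longrightarrow> r < m * N \<Longrightarrow> c < m * N \<Longrightarrow> (transpose_mat (L N) * L N) $$ (r, c) \<noteq> 0 \<Longrightarrow>
       near m n (m * N) r c"
proof -
  obtain l where l_shift: "\<And>r c. l (r + int m) (c + int m) = l r c"
    and l_supp: "\<And>r c. l r c \<noteq> 0 \<Longrightarrow> int m * (r div int m) \<le> c \<and> c < int m * (r div int m) + int w"
    and ltl: "\<And>r c I J. finite I \<Longrightarrow> finite J \<Longrightarrow> (\<And>i. l r i \<noteq> 0 \<Longrightarrow> i \<in> I) \<Longrightarrow> (\<And>j. l c j \<noteq> 0 \<Longrightarrow> j \<in> J) \<Longrightarrow>
       (\<Sum>i\<in>I. \<Sum>j\<in>J. l r i * t i j * l c j) = (if r = c then 1 else 0)"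
    using factorization by blast
  obtain \<tau> K where tau: "\<tau> \<longlonglongrightarrow> 0" and K: "0 < K"
    and tail: "\<And>h i J. finite J \<Longrightarrow> (\<Sum>j\<in>J. \<bar>t i j - trunc h i j\<bar>) \<le> \<tau> h"
    and trow: "\<And>h i J. finite J \<Longrightarrow> (\<Sum>j\<in>J. \<bar>trunc h i j\<bar>) \<le> K"
    using trunc_tail by blast
  let ?lt = "\<lambda>r c. l c r"
  have l_band: "\<bar>c - r\<bar> \<le> int w" if "l r c \<noteq> 0" for r c
  proof -
    have "int m * (r div int m) \<le> r" "r < int m * (r div int m) + int m"
      using block_diff(2)[of r 0] m_pos mult_div_mod_eq[of "int m" r] pos_mod_bound[of "int m" r] pos_mod_sign[of "int m" r] by linarith+
    then show ?thesis using l_supp[OF that] m_le_w by linarith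
  qed
  have bl: "banded (int w) l" "banded (int w) ?lt"
    unfolding banded_def using l_band by (simp, metis abs_minus_commute)
  have pl: "periodic (m * N) l" "periodic (m * N) ?lt" for N
    using l_shift by (auto intro: periodic_of_shift)
  \<comment> \<open>up to block shifts, \<open>l\<close> has only finitely many nonzero entries\<close>
  define lmax where "lmax = (\<Sum>r\<in>{0..<int m}. \<Sum>c\<in>{0..<int w}. \<bar>l r c\<bar>)"
  have lmax: "\<bar>l r c\<bar> \<le> lmax" for r c
  proof (cases "l r c = 0")
    case True
    then show ?thesis unfolding lmax_def by (simp add: sum_nonneg)
  next
    case False
    let ?r = "r mod int m" and ?c = "c - int m * (r div int m)"
    have r: "r = ?r + int m * (r div int m)" and c: "c = ?c + int m * (r div int m)" by auto
    have e: "l r c = l ?r ?c"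
      using shift_multiple[of l m ?r "r div int m" ?c, OF l_shift] r c by metis
    have "?r \<in> {0..<int m}" using m_pos by auto
    moreover have "?c \<in> {0..<int w}" using l_supp[OF False] by auto
    moreover have "\<bar>l ?r ?c\<bar> \<le> (\<Sum>c\<in>{0..<int w}. \<bar>l ?r c\<bar>)"
      by (rule member_le_sum[of ?c "{0..<int w}" "\<lambda>c. \<bar>l ?r c\<bar>"]) (use calculation in auto)
    moreover have "\<dots> \<le> lmax" unfolding lmax_def
      by (rule member_le_sum[of ?r "{0..<int m}" "\<lambda>r. \<Sum>c\<in>{0..<int w}. \<bar>l r c\<bar>"])
        (use calculation in \<open>auto intro: sum_nonneg\<close>)
    ultimately show ?thesis unfolding e by linarith
  qed
  have lmax0: "0 \<le> lmax" using lmax[of 0 0] by linarith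
  define \<Lambda> where "\<Lambda> = (2 * real w + 1) * lmax + 1"
  have Lam: "0 < \<Lambda>" unfolding \<Lambda>_def using lmax0 by (simp add: add_nonneg_pos)
  have line: "(\<Sum>j\<in>J. \<bar>f j\<bar>) \<le> \<Lambda>"
    if J: "finite J" and f: "\<And>j. f j \<noteq> 0 \<Longrightarrow> \<bar>j - i\<bar> \<le> int w" "\<And>j. \<bar>f j\<bar> \<le> lmax" for J f i
  proof -
    have "(\<Sum>j\<in>J. \<bar>f j\<bar>) \<le> (\<Sum>j\<in>J \<union> {i - int w..i + int w}. \<bar>f j\<bar>)"
      by (rule sum_mono2) (use J in auto)
    also have "\<dots> = (\<Sum>j\<in>{i - int w..i + int w}. \<bar>f j\<bar>)"
    proof (rule sum.mono_neutral_right)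
      show "\<forall>j\<in>J \<union> {i - int w..i + int w} - {i - int w..i + int w}. \<bar>f j\<bar> = 0"
        using f(1) by fastforce
    qed (use J in auto)
    also have "\<dots> \<le> (\<Sum>j\<in>{i - int w..i + int w}. lmax)" by (intro sum_mono f(2))
    also have "\<dots> \<le> \<Lambda>" unfolding \<Lambda>_def by (simp add: algebra_simps)
    finally show ?thesis .
  qed
  have lrow: "(\<Sum>j\<in>J. \<bar>l r j\<bar>) \<le> \<Lambda>" if "finite J" for J r
    by (rule line[OF that, of _ r]) (use l_band lmax in auto)
  have lcol: "(\<Sum>r\<in>J. \<bar>l r j\<bar>) \<le> \<Lambda>" if "finite J" for J j
  proof (rule line[OF that, of _ j])
    show "\<bar>r - j\<bar> \<le> int w" if "l r j \<noteq> 0" for r using l_band[OF that] by linarith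
  qed (rule lmax)
  define L where "L N = wrap (m * N) (int w) l" for N
  have Lc: "L N \<in> carrier_mat (m * N) (m * N)" for N unfolding L_def by simp
  have mN: "0 < m * N" if "0 < N" for N using that m_pos by simp
  have LT: "transpose_mat (L N) = wrap (m * N) (int w) ?lt" if "0 < N" for N
    unfolding L_def by (rule wrap_transpose[OF mN[OF that] pl(1)])
  define \<eta> where "\<eta> N = \<Lambda> * (\<tau> (N div 2) * \<Lambda>)" for N :: nat
  have "\<eta> \<longlonglongrightarrow> \<Lambda> * (0 * \<Lambda>)"
    unfolding \<eta>_def
    by (intro tendsto_intros filterlim_compose[OF tau] filterlim_at_top_div_const_nat) simp
  then have eta: "\<eta> \<longlonglongrightarrow> 0" by simp
  have fact: "\<exists>E \<in> carrier_mat (m * N) (m * N).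
       L N * circ N * transpose_mat (L N) = 1\<^sub>m (m * N) + E \<and> op_bound E (\<eta> N)" if N: "0 < N" for N
  proof -
    define h where "h = N div 2"
    define b where "b = int m * int (h + 1)"
    define k1 where "k1 r c = (\<Sum>e\<in>{r - int w..r + int w}. l r e * trunc h e c)" for r c
    define k where "k r c = (\<Sum>e\<in>{r - (int w + b)..r + (int w + b)}. k1 r e * l c e)" for r c
    define B where "B = int w + b + int w"
    have B: "0 \<le> B" "0 \<le> b" unfolding B_def b_def by auto
    have bt: "banded b (trunc h)" unfolding b_def by (rule banded_trunc)
    have bk1: "banded (int w + b) k1"
      unfolding banded_def
    proof (intro allI impI)
      fix r c assume "k1 r c \<noteq> 0"
      then obtain e where "l r e * trunc h e c \<noteq> 0"
        unfolding k1_def using sum.not_neutral_contains_not_neutral by blast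
      then have "\<bar>e - r\<bar> \<le> int w" "\<bar>c - e\<bar> \<le> b" using l_band bt unfolding banded_def by auto
      then show "\<bar>c - r\<bar> \<le> int w + b" by linarith
    qed
    have "L N * circ N = wrap (m * N) (int w + b) k1"
      unfolding L_def circ_def h_def[symmetric] b_def[symmetric] k1_def
      by (rule wrap_mult[OF mN[OF N] bl(1) bt periodic_of_shift]) (rule trunc_shift)
    then have prod: "L N * circ N * transpose_mat (L N) = wrap (m * N) B k"
      unfolding LT[OF N] B_def k_def
      using wrap_mult[OF mN[OF N] bk1 bl(2) pl(2)] by simp
    define err where "err r c = k r c - (if r = c then 1 else 0)" for r c
    have k_err: "k = (\<lambda>r c. (if r = c then 1 else 0) + err r c)" by (simp add: err_def fun_eq_iff)
    have prod': "L N * circ N * transpose_mat (L N) = 1\<^sub>m (m * N) + wrap (m * N) B err"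
      unfolding prod k_err wrap_add wrap_identity[OF B(1)] ..
    have k_double: "k r c = (\<Sum>i\<in>{r - int w..r + int w}. \<Sum>j\<in>J. l r i * trunc h i j * l c j)"
      if J: "finite J" "\<And>j. l c j \<noteq> 0 \<Longrightarrow> j \<in> J" for r c J
    proof -
      have "k r c = (\<Sum>j\<in>{r - (int w + b)..r + (int w + b)} \<union> J. k1 r j * l c j)"
        unfolding k_def by (rule sum.mono_neutral_left) (use bk1 J in \<open>fastforce simp: banded_def\<close>)+
      also have "\<dots> = (\<Sum>j\<in>J. k1 r j * l c j)"
        by (rule sum.mono_neutral_right) (use J in auto)
      also have "\<dots> = (\<Sum>j\<in>J. \<Sum>i\<in>{r - int w..r + int w}. l r i * trunc h i j * l c j)"
        unfolding k1_def by (simp add: sum_distrib_right)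
      also have "\<dots> = (\<Sum>i\<in>{r - int w..r + int w}. \<Sum>j\<in>J. l r i * trunc h i j * l c j)" by (rule sum.swap)
      finally show ?thesis .
    qed
    have err_double: "err r c = - (\<Sum>i\<in>{r - int w..r + int w}. \<Sum>j\<in>J. l r i * (t i j - trunc h i j) * l c j)"
      if J: "finite J" "\<And>j. l c j \<noteq> 0 \<Longrightarrow> j \<in> J" for r c J
    proof -
      have one: "(if r = c then 1 else 0) = (\<Sum>i\<in>{r - int w..r + int w}. \<Sum>j\<in>J. l r i * t i j * l c j)"
        by (rule ltl[symmetric]) (use l_band J in fastforce)+
      have "(\<Sum>i\<in>{r - int w..r + int w}. \<Sum>j\<in>J. l r i * (t i j - trunc h i j) * l c j) =
          (\<Sum>i\<in>{r - int w..r + int w}. \<Sum>j\<in>J. l r i * t i j * l c j) -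
          (\<Sum>i\<in>{r - int w..r + int w}. \<Sum>j\<in>J. l r i * trunc h i j * l c j)"
        by (simp only: right_diff_distrib left_diff_distrib sum_subtractf)
      moreover have "k r c = (\<Sum>i\<in>{r - int w..r + int w}. \<Sum>j\<in>J. l r i * trunc h i j * l c j)"
        by (rule k_double[OF J])
      ultimately show ?thesis unfolding err_def one by simp
    qed
    have sym_err: "err r c = err c r" for r c
    proof -
      let ?I = "\<lambda>r. {r - int w..r + int w}"
      have I: "finite (?I r)" "l r j \<noteq> 0 \<Longrightarrow> j \<in> ?I r" for r j using l_band[of r j] by auto
      have kk: "k r c = (\<Sum>i\<in>?I r. \<Sum>j\<in>?I c. l r i * trunc h i j * l c j)" for r c
        by (rule k_double[OF I])
      have "k r c = (\<Sum>j\<in>?I c. \<Sum>i\<in>?I r. l r i * trunc h i j * l c j)"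
        unfolding kk[of r c] by (rule sum.swap)
      also have "\<dots> = k c r"
        unfolding kk[of c r] by (intro sum.cong refl) (metis trunc_sym mult.commute mult.left_commute)
      finally show ?thesis unfolding err_def by auto
    qed
    have row: "(\<Sum>c\<in>{r - B..r + B}. \<bar>err r c\<bar>) \<le> \<eta> N" for r
    proof -
      \<comment> \<open>\<open>?J\<close> contains the supports of all rows \<open>c\<close> of \<open>l\<close> with \<open>c\<close> in \<open>?C\<close>, so that the sums can be interchanged\<close>
      let ?I = "{r - int w..r + int w}" and ?J = "{r - B - int w..r + B + int w}" and ?C = "{r - B..r + B}"
      have "\<bar>err r c\<bar> \<le> (\<Sum>i\<in>?I. \<Sum>j\<in>?J. \<bar>l r i\<bar> * \<bar>t i j - trunc h i j\<bar> * \<bar>l c j\<bar>)" if c: "c \<in> ?C" for c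
      proof -
        have J: "finite ?J" "l c j \<noteq> 0 \<Longrightarrow> j \<in> ?J" for j using l_band[of c j] c by auto
        have e: "err r c = - (\<Sum>i\<in>?I. \<Sum>j\<in>?J. l r i * (t i j - trunc h i j) * l c j)"
          by (rule err_double[OF J])
        have "\<bar>err r c\<bar> \<le> (\<Sum>i\<in>?I. \<bar>\<Sum>j\<in>?J. l r i * (t i j - trunc h i j) * l c j\<bar>)"
          unfolding e abs_minus_cancel by (rule sum_abs)
        also have "\<dots> \<le> (\<Sum>i\<in>?I. \<Sum>j\<in>?J. \<bar>l r i * (t i j - trunc h i j) * l c j\<bar>)"
          by (intro sum_mono sum_abs)
        finally show ?thesis by (simp add: abs_mult)
      qed
      then have "(\<Sum>c\<in>?C. \<bar>err r c\<bar>) \<le> (\<Sum>c\<in>?C. \<Sum>i\<in>?I. \<Sum>j\<in>?J. \<bar>l r i\<bar> * \<bar>t i j - trunc h i j\<bar> * \<bar>l c j\<bar>)"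
        by (rule sum_mono)
      also have "\<dots> = (\<Sum>i\<in>?I. \<Sum>c\<in>?C. \<Sum>j\<in>?J. \<bar>l r i\<bar> * \<bar>t i j - trunc h i j\<bar> * \<bar>l c j\<bar>)"
        by (rule sum.swap)
      also have "\<dots> = (\<Sum>i\<in>?I. \<Sum>j\<in>?J. \<Sum>c\<in>?C. \<bar>l r i\<bar> * \<bar>t i j - trunc h i j\<bar> * \<bar>l c j\<bar>)"
        by (intro sum.cong refl sum.swap)
      also have "\<dots> = (\<Sum>i\<in>?I. \<bar>l r i\<bar> * (\<Sum>j\<in>?J. \<bar>t i j - trunc h i j\<bar> * (\<Sum>c\<in>?C. \<bar>l c j\<bar>)))"
        by (simp only: sum_distrib_left mult.assoc)
      also have "\<dots> \<le> (\<Sum>i\<in>?I. \<bar>l r i\<bar> * (\<tau> h * \<Lambda>))"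
      proof (intro sum_mono mult_left_mono)
        fix i
        have "(\<Sum>j\<in>?J. \<bar>t i j - trunc h i j\<bar> * (\<Sum>c\<in>?C. \<bar>l c j\<bar>)) \<le> (\<Sum>j\<in>?J. \<bar>t i j - trunc h i j\<bar> * \<Lambda>)"
          by (intro sum_mono mult_left_mono lcol) auto
        also have "\<dots> = (\<Sum>j\<in>?J. \<bar>t i j - trunc h i j\<bar>) * \<Lambda>" by (simp only: sum_distrib_right)
        also have "\<dots> \<le> \<tau> h * \<Lambda>" by (intro mult_right_mono tail) (use Lam in auto)
        finally show "(\<Sum>j\<in>?J. \<bar>t i j - trunc h i j\<bar> * (\<Sum>c\<in>?C. \<bar>l c j\<bar>)) \<le> \<tau> h * \<Lambda>" .
      qed auto
      also have "\<dots> = (\<Sum>i\<in>?I. \<bar>l r i\<bar>) * (\<tau> h * \<Lambda>)" by (simp only: sum_distrib_right)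
      also have "\<dots> \<le> \<Lambda> * (\<tau> h * \<Lambda>)"
        using tail[where J = "{}" and h = h] Lam by (intro mult_right_mono lrow) auto
      finally show ?thesis unfolding \<eta>_def h_def .
    qed
    have "op_bound (wrap (m * N) B err) (\<eta> N)"
    proof (rule op_bound_wrap[OF mN[OF N]])
      show "0 \<le> \<eta> N" using row[of 0] by (rule order_trans[rotated]) (simp add: sum_nonneg)
      have k1s: "k1 (r + int m) (c + int m) = k1 r c" for r c
        unfolding k1_def
      proof (rule sum.reindex_bij_witness[of _ "\<lambda>e. e + int m" "\<lambda>e. e - int m"])
        fix e show "l r (e - int m) * trunc h (e - int m) c = l (r + int m) e * trunc h e (c + int m)"
          using l_shift[of r "e - int m"] trunc_shift[of h "e - int m" c] by simp
      qed auto
      have "k (r + int m) (c + int m) = k r c" for r c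
        unfolding k_def
      proof (rule sum.reindex_bij_witness[of _ "\<lambda>e. e + int m" "\<lambda>e. e - int m"])
        fix e show "k1 r (e - int m) * l c (e - int m) = k1 (r + int m) e * l (c + int m) e"
          using k1s[of r "e - int m"] l_shift[of c "e - int m"] by simp
      qed auto
      then show "periodic (m * N) err" by (intro periodic_of_shift) (simp add: err_def)
      show "(\<Sum>d\<in>{r - B..r + B}. \<bar>err r d\<bar>) \<le> \<eta> N" for r by (rule row)
      show "(\<Sum>d\<in>{c - B..c + B}. \<bar>err d c\<bar>) \<le> \<eta> N" for c using row[of c] by (simp add: sym_err[of _ c])
    qed
    then show ?thesis using prod' by (intro bexI[of _ "wrap (m * N) B err"]) auto
  qed
  define q where "q r c = (\<Sum>e\<in>{r - int w..r + int w}. l e r * l e c)" for r c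
  have R: "transpose_mat (L N) * L N = wrap (m * N) (int w + int w) q" if "0 < N" for N
    unfolding LT[OF that] q_def
    unfolding L_def using wrap_mult[OF mN[OF that] bl(2) bl(1) pl(1)] .
  have q_near: "\<bar>c div int m - r div int m\<bar> \<le> int n" and q_band: "\<bar>c - r\<bar> \<le> int w + int w" if nz: "q r c \<noteq> 0" for r c
  proof -
    obtain e where "l e r * l e c \<noteq> 0"
      using sum.not_neutral_contains_not_neutral[OF nz[unfolded q_def]] by blast
    then have e: "l e r \<noteq> 0" "l e c \<noteq> 0" by auto
    have "\<bar>r - e\<bar> \<le> int w" "\<bar>c - e\<bar> \<le> int w" using e l_band by auto
    then show "\<bar>c - r\<bar> \<le> int w + int w" by linarith
    define d where "d = e div int m"
    have div: "d \<le> x div int m \<and> x div int m \<le> d + int n" if "l e x \<noteq> 0" for x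
    proof -
      have x: "int m * d \<le> x" "x < int m * (d + int n + 1)"
        using l_supp[OF that] unfolding d_def w_def by (auto simp: algebra_simps)
      have "x = int m * (x div int m) + x mod int m" "0 \<le> x mod int m" "x mod int m < int m"
        using m_pos by auto
      then have "int m * (x div int m) \<le> x" "x < int m * (x div int m + 1)"
        unfolding distrib_left by linarith+
      then have "int m * d < int m * (x div int m + 1)" "int m * (x div int m) < int m * (d + int n + 1)"
        using x by linarith+
      then have "d < x div int m + 1" "x div int m < d + int n + 1"
        using m_pos by (simp_all only: mult_less_cancel_left_pos of_nat_0_less_iff)
      then show ?thesis by linarith
    qed
    show "\<bar>c div int m - r div int m\<bar> \<le> int n" using div[OF e(1)] div[OF e(2)] by linarith
  qed
  have bq: "banded (int w + int w) q" unfolding banded_def using q_band by blast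
  show thesis
  proof (rule that[of \<eta> \<Lambda> K L])
    show "op_bound (L N) \<Lambda>" if "0 < N" for N
      unfolding L_def by (rule op_bound_wrap[OF mN[OF that] _ pl(1)]) (use Lam lrow lcol in auto)
    show "op_bound (circ N) K" if "0 < N" for N
      unfolding circ_def
    proof (rule op_bound_wrap[OF mN[OF that]])
      show "periodic (m * N) (trunc (N div 2))" by (rule periodic_of_shift) (rule trunc_shift)
      show "(\<Sum>d\<in>{c - int m * int (N div 2 + 1)..c + int m * int (N div 2 + 1)}. \<bar>trunc (N div 2) d c\<bar>) \<le> K" for c
        using trow[of "{c - int m * int (N div 2 + 1)..c + int m * int (N div 2 + 1)}" "N div 2" c]
        by (simp only: trunc_sym[of "N div 2" _ c] finite_atLeastAtMost_int)
    qed (use K trow in auto)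
    show "shift_invariant m (m * N) (transpose_mat (L N) * L N)" if N: "0 < N" for N
      unfolding shift_invariant_def R[OF N]
    proof (intro allI impI, rule wrap_shift[OF refl mN[OF N] _ bq])
      show "q (r + int m) (c + int m) = q r c" for r c
        unfolding q_def
      proof (rule sum.reindex_bij_witness[of _ "\<lambda>e. e + int m" "\<lambda>e. e - int m"])
        fix e show "l (e - int m) r * l (e - int m) c = l e (r + int m) * l e (c + int m)"
          using l_shift[of "e - int m"] by simp
      qed auto
    qed
    show "near m n (m * N) r c" if N: "0 < N" and r: "r < m * N" and c: "c < m * N"
      and nz: "(transpose_mat (L N) * L N) $$ (r, c) \<noteq> 0" for N r c
    proof -
      have "(\<Sum>d\<in>{d \<in> {int r - (int w + int w)..int r + (int w + int w)}. d mod int (m * N) = int c}. q (int r) d) \<noteq> 0"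
        using nz r c unfolding R[OF N] by (simp add: wrap_def)
      then obtain d where "d mod int (m * N) = int c" "q (int r) d \<noteq> 0" 
        using sum.not_neutral_contains_not_neutral by blast
      then show ?thesis unfolding near_def using q_near by blast
    qed
  qed (use eta Lam K Lc fact in auto)
qed

end

section \<open>Stability of matrices with banded circulant inverse\<close>

lemma abs_index_le_op_bound:
  assumes A: "A \<in> carrier_mat n n" and K: "op_bound A K" and i: "i < n" and j: "j < n"
  shows "\<bar>A $$ (i, j)\<bar> \<le> K"
proof -
  have u: "unit_vec n i \<in> carrier_vec n" "unit_vec n j \<in> carrier_vec n" for i j :: nat by auto
  have n1: "vec_norm2 (unit_vec n i) = 1" if "i < n" for i using that by (simp add: vec_norm2_def)
  have "A $$ (i, j) = unit_vec n i \<bullet> (A *\<^sub>v unit_vec n j)"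
    using A i j by (simp add: mult_mat_vec_def)
  also have "\<bar>\<dots>\<bar> \<le> vec_norm2 (unit_vec n i) * vec_norm2 (A *\<^sub>v unit_vec n j)"
    by (rule abs_scalar_prod_le[of _ n]) (use A in auto)
  also have "\<dots> \<le> 1 * (K * 1)"
    using op_boundD[OF K A, of "unit_vec n j"] n1[OF i] n1[OF j] by simp
  finally show ?thesis by simp
qed

text \<open>If \<open>L C L\<^sup>T\<close> is close to the identity, its form is at least half of the Euclidean one, which makes \<open>C\<close>
positive definite.  As the form of \<open>C\<close> at \<open>L\<^sup>T v\<close> is at most \<open>K\<close> times the square of the norm of \<open>L\<^sup>T v\<close>, it also
bounds the inverse of \<open>L\<close>, in terms of \<open>K\<close> alone.\<close>

lemma factor_inverse:
  assumes L: "L \<in> carrier_mat M M" and C: "C \<in> carrier_mat M M" and E: "E \<in> carrier_mat M M"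
    and eq: "L * C * transpose_mat L = 1\<^sub>m M + E" and eta: "op_bound E \<eta>" "\<eta> \<le> 1 / 2"
    and K: "op_bound C K" and sym: "transpose_mat C = C"
  obtains P where "P \<in> carrier_mat M M" "P * L = 1\<^sub>m M" "L * P = 1\<^sub>m M" "op_bound P (sqrt (2 * K))"
    "positive_definite C" "C = P * (1\<^sub>m M + E) * transpose_mat P"
proof -
  have LT: "transpose_mat L \<in> carrier_mat M M" using L by simp
  have form: "v \<bullet> v / 2 \<le> (transpose_mat L *\<^sub>v v) \<bullet> (C *\<^sub>v (transpose_mat L *\<^sub>v v))"
    if v: "v \<in> carrier_vec M" for v
  proof -
    let ?u = "transpose_mat L *\<^sub>v v"
    have u: "?u \<in> carrier_vec M" using LT v by simp
    have Ev: "E *\<^sub>v v \<in> carrier_vec M" using E v by simp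
    have "?u \<bullet> (C *\<^sub>v ?u) = v \<bullet> (L *\<^sub>v (C *\<^sub>v ?u))"
      by (rule transpose_vec_mult_scalar[OF L _ v]) (use C u in auto)
    also have "L *\<^sub>v (C *\<^sub>v ?u) = (L * C * transpose_mat L) *\<^sub>v v"
      using L C LT v u by (simp add: assoc_mult_mat_vec[of _ M M _ M])
    also have "\<dots> = v + E *\<^sub>v v"
      unfolding eq using E v by (simp add: add_mult_distrib_mat_vec[of _ M M])
    also have "v \<bullet> (v + E *\<^sub>v v) = v \<bullet> v + v \<bullet> (E *\<^sub>v v)"
      using v Ev by (simp add: scalar_prod_add_distrib[of _ M])
    finally have e: "?u \<bullet> (C *\<^sub>v ?u) = v \<bullet> v + v \<bullet> (E *\<^sub>v v)" .
    have "\<bar>v \<bullet> (E *\<^sub>v v)\<bar> \<le> vec_norm2 v * (\<eta> * vec_norm2 v)"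
      using abs_scalar_prod_le[OF v Ev] mult_left_mono[OF op_boundD[OF eta(1) E v], of "vec_norm2 v"] by simp
    also have "\<dots> = \<eta> * (v \<bullet> v)" by (simp add: vec_norm2_square[symmetric] power2_eq_square)
    also have "\<dots> \<le> 1 / 2 * (v \<bullet> v)" by (rule mult_right_mono[OF eta(2) scalar_prod_self_nonneg])
    finally show ?thesis unfolding e by linarith
  qed
  have lower: "(vec_norm2 v)\<^sup>2 \<le> 2 * K * (vec_norm2 (transpose_mat L *\<^sub>v v))\<^sup>2" if v: "v \<in> carrier_vec M" for v
  proof -
    let ?u = "transpose_mat L *\<^sub>v v"
    have u: "?u \<in> carrier_vec M" "C *\<^sub>v ?u \<in> carrier_vec M" using LT C v by simp_all
    have "v \<bullet> v / 2 \<le> vec_norm2 ?u * (K * vec_norm2 ?u)"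
      using form[OF v] abs_scalar_prod_le[OF u] mult_left_mono[OF op_boundD[OF K C u(1)], of "vec_norm2 ?u"] by simp
    then show ?thesis by (simp add: vec_norm2_square[symmetric] power2_eq_square mult_ac)
  qed
  have "v = 0\<^sub>v M" if v: "v \<in> carrier_vec M" "transpose_mat L *\<^sub>v v = 0\<^sub>v M" for v
  proof -
    have "(vec_norm2 v)\<^sup>2 \<le> 0" using lower[OF v(1)] v(2) by (simp add: vec_norm2_def)
    then show ?thesis using scalar_prod_self_eq_0[OF v(1)] scalar_prod_self_nonneg[of v] vec_norm2_square[of v] by simp
  qed
  from nonsingular_inverse[OF LT this] obtain P' where
    P': "P' \<in> carrier_mat M M" "transpose_mat L * P' = 1\<^sub>m M" "P' * transpose_mat L = 1\<^sub>m M" by metis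
  define P where "P = transpose_mat P'"
  have P: "P \<in> carrier_mat M M" unfolding P_def using P' by simp
  have PT: "transpose_mat P = P'" unfolding P_def by simp
  have PL: "P * L = 1\<^sub>m M"
    using arg_cong[OF P'(2), of transpose_mat] transpose_mult[OF LT P'(1)] unfolding P_def by simp
  have LP: "L * P = 1\<^sub>m M" by (rule mat_mult_left_right_inverse[OF P L PL])
  have K0: "0 \<le> K" by (rule op_bound_nonneg[OF K])
  have "op_bound P' (sqrt (2 * K))"
    unfolding op_bound_def
  proof (intro conjI ballI)
    fix u :: "real vec" assume "u \<in> carrier_vec (dim_col P')"
    then have u: "u \<in> carrier_vec M" using P' by auto
    have Pu: "P' *\<^sub>v u \<in> carrier_vec M" using P' u by simp
    have "transpose_mat L *\<^sub>v (P' *\<^sub>v u) = u"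
      using assoc_mult_mat_vec[OF LT P'(1) u] P'(2) u by simp
    then have "(vec_norm2 (P' *\<^sub>v u))\<^sup>2 \<le> 2 * K * (vec_norm2 u)\<^sup>2" using lower[OF Pu] by simp
    also have "\<dots> = (sqrt (2 * K) * vec_norm2 u)\<^sup>2" using K0 by (simp add: power_mult_distrib)
    finally show "vec_norm2 (P' *\<^sub>v u) \<le> sqrt (2 * K) * vec_norm2 u"
      by (rule power2_le_imp_le) (use K0 in auto)
  qed (use K0 in auto)
  then have bound: "op_bound P (sqrt (2 * K))" unfolding P_def by (rule op_bound_transpose[OF P'(1)])
  have pd: "positive_definite C"
  proof (rule positive_definiteI[OF C sym])
    fix u :: "real vec" assume u: "u \<in> carrier_vec M" "u \<noteq> 0\<^sub>v M"
    have Pu: "P' *\<^sub>v u \<in> carrier_vec M" using P' u by simp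
    have LPu: "transpose_mat L *\<^sub>v (P' *\<^sub>v u) = u"
      using assoc_mult_mat_vec[OF LT P'(1) u(1)] P'(2) u by simp
    have "P' *\<^sub>v u \<noteq> 0\<^sub>v M"
    proof
      assume "P' *\<^sub>v u = 0\<^sub>v M"
      then have "u = transpose_mat L *\<^sub>v 0\<^sub>v M" using LPu by simp
      also have "\<dots> = 0\<^sub>v M" using LT by (intro eq_vecI) (auto simp: scalar_prod_def)
      finally show False using u(2) by simp
    qed
    then have "0 < (P' *\<^sub>v u) \<bullet> (P' *\<^sub>v u)" by (rule scalar_prod_self_pos[OF Pu])
    then show "0 < u \<bullet> (C *\<^sub>v u)" using form[OF Pu] unfolding LPu by linarith
  qed
  have "P * (1\<^sub>m M + E) * transpose_mat P = P * (L * C * transpose_mat L) * P'" unfolding eq PT ..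
  also have "\<dots> = (P * L) * C * (transpose_mat L * P')"
    using P L C LT P' by (simp add: assoc_mult_mat[of _ M M _ M _ M])
  also have "\<dots> = C" unfolding PL P'(2) using C by simp
  finally show thesis using that[OF P PL LP bound pd] by simp
qed

lemma mat_mult_index_sum:
  assumes "A \<in> carrier_mat n k" "B \<in> carrier_mat k l" "i < n" "j < l"
  shows "(A * B) $$ (i, j) = (\<Sum>x<k. A $$ (i, x) * B $$ (x, j))"
  using assms by (simp add: scalar_prod_def lessThan_atLeast0)

lemma sum_diag_mult:
  fixes A B :: "real mat"
  assumes "A \<in> carrier_mat n k" "B \<in> carrier_mat k n"
  shows "(\<Sum>i<n. (A * B) $$ (i, i)) = (\<Sum>i<n. \<Sum>j<k. A $$ (i, j) * B $$ (j, i))"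
  using assms by (simp add: scalar_prod_def lessThan_atLeast0)

lemma sum_diag_mult_comm:
  fixes A B :: "real mat"
  assumes "A \<in> carrier_mat n k" "B \<in> carrier_mat k n"
  shows "(\<Sum>i<n. (A * B) $$ (i, i)) = (\<Sum>i<k. (B * A) $$ (i, i))"
  unfolding sum_diag_mult[OF assms] sum_diag_mult[OF assms(2,1)]
  by (subst sum.swap) (simp add: mult.commute)

text \<open>Here \<open>P P\<^sup>T\<close> is the inverse of \<open>L\<^sup>T L\<close>, and \<open>D\<close> is the difference of the inverses of \<open>X\<close> and of \<open>P P\<^sup>T\<close>.  By the
resolvent identity \<open>P P\<^sup>T - X = X D P P\<^sup>T\<close> the trace of \<open>D (P P\<^sup>T - X)\<close> equals that of \<open>F\<^sup>T X F\<close> for \<open>F = D P\<close>.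
The factor \<open>1/q\<close> comes from \<open>X \<ge> 1/q\<close>, the factor \<open>1/\<Lambda>\<^sup>2\<close> from recovering \<open>D = F L\<close>.\<close>

lemma inverse_difference_energy:
  assumes L: "L \<in> carrier_mat M M" and P: "P \<in> carrier_mat M M" "P * L = 1\<^sub>m M" "L * P = 1\<^sub>m M" and Lam: "op_bound L \<Lambda>" "0 < \<Lambda>"
    and X: "X \<in> carrier_mat M M" "positive_definite X" and Q: "Q \<in> carrier_mat M M" "X * Q = 1\<^sub>m M" "op_bound Q q" "0 < q"
    and D: "D = Q - transpose_mat L * L"
  shows "(\<Sum>i<M. \<Sum>j<M. (D $$ (i, j))\<^sup>2) / (q * \<Lambda>\<^sup>2) \<le>
    - (\<Sum>i<M. \<Sum>j<M. D $$ (i, j) * (X - P * transpose_mat P) $$ (j, i))"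
    and "P * transpose_mat P - X = X * D * (P * transpose_mat P)"
proof -
  let ?R = "transpose_mat L * L" and ?G = "P * transpose_mat P"
  have LT: "transpose_mat L \<in> carrier_mat M M" and PT: "transpose_mat P \<in> carrier_mat M M" using L P by simp_all
  have R: "?R \<in> carrier_mat M M" and G: "?G \<in> carrier_mat M M" using L P LT PT by auto
  have Dc: "D \<in> carrier_mat M M" unfolding D by (rule minus_carrier_mat[OF R])
  have LTPT: "transpose_mat L * transpose_mat P = 1\<^sub>m M"
    using transpose_mult[OF P(1) L] P(2) by simp
  have RG: "?R * ?G = 1\<^sub>m M"
  proof -
    have "?R * ?G = transpose_mat L * ((L * P) * transpose_mat P)"
      using L P(1) LT PT by (simp add: assoc_mult_mat[of _ M M _ M _ M])
    also have "\<dots> = 1\<^sub>m M" unfolding P(3) using LTPT PT by simp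
    finally show ?thesis .
  qed
  have QX: "Q * X = 1\<^sub>m M" by (rule mat_mult_left_right_inverse[OF X(1) Q(1,2)])
  have Qsym: "transpose_mat Q = Q" by (rule symmetric_inverse[OF X(1) Q(1,2) positive_definite_sym[OF X(2)]])
  have Dsym: "transpose_mat D = D"
    unfolding D transpose_minus[OF Q(1) R] Qsym transpose_mult[OF LT L] by simp
  show diff: "?G - X = X * D * ?G"
  proof -
    have "X * D * ?G = X * (D * ?G)" using X(1) Dc G by simp
    also have "D * ?G = Q * ?G - ?R * ?G" unfolding D by (rule minus_mult_distrib_mat[OF Q(1) R G])
    also have "X * (Q * ?G - ?R * ?G) = X * (Q * ?G) - X * (?R * ?G)"
      by (rule mult_minus_distrib_mat[OF X(1) mult_carrier_mat[OF Q(1) G] mult_carrier_mat[OF R G]])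
    also have "X * (Q * ?G) = X * Q * ?G" using X(1) Q(1) G by simp
    also have "\<dots> = ?G" unfolding Q(2) by (rule left_mult_one_mat[OF G])
    also have "X * (?R * ?G) = X" unfolding RG using X(1) by simp
    finally show ?thesis ..
  qed
  define F where "F = D * P"
  have F: "F \<in> carrier_mat M M" unfolding F_def using Dc P by auto
  have FT: "transpose_mat F = transpose_mat P * D" unfolding F_def transpose_mult[OF Dc P(1)] Dsym ..
  have XF: "X * F \<in> carrier_mat M M" using X(1) F by auto
  have GX: "?G - X \<in> carrier_mat M M" by (rule minus_carrier_mat[OF X(1)])
  have neg: "(X - ?G) $$ (j, i) = - (?G - X) $$ (j, i)" if "i < M" "j < M" for i j
    using that X(1) carrier_matD[OF G] by simp
  have "- (\<Sum>i<M. \<Sum>j<M. D $$ (i, j) * (X - ?G) $$ (j, i)) = (\<Sum>i<M. (D * (?G - X)) $$ (i, i))"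
    unfolding sum_diag_mult[OF Dc GX] sum_negf[symmetric]
    by (intro sum.cong refl) (simp only: neg lessThan_iff mult_minus_right minus_minus)
  also have "D * (?G - X) = (D * (X * F)) * transpose_mat P"
    unfolding diff F_def using Dc X(1) P(1) PT by (simp add: assoc_mult_mat[of _ M M _ M _ M])
  also have "(\<Sum>i<M. ((D * (X * F)) * transpose_mat P) $$ (i, i)) = (\<Sum>i<M. (transpose_mat P * (D * (X * F))) $$ (i, i))"
    by (rule sum_diag_mult_comm) (use Dc XF PT in auto)
  also have "transpose_mat P * (D * (X * F)) = transpose_mat F * (X * F)"
    unfolding FT using Dc XF PT by (simp add: assoc_mult_mat[of _ M M _ M _ M])
  also have "(\<Sum>i<M. (transpose_mat F * (X * F)) $$ (i, i)) = (\<Sum>i<M. col F i \<bullet> (X *\<^sub>v col F i))"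
    using F X(1) by (intro sum.cong refl) (simp add: col_mult2[of _ M M] mult_mat_vec_def)
  finally have tr: "- (\<Sum>i<M. \<Sum>j<M. D $$ (i, j) * (X - ?G) $$ (j, i)) = (\<Sum>i<M. col F i \<bullet> (X *\<^sub>v col F i))" .
  have rows: "(\<Sum>j<M. (D $$ (k, j))\<^sup>2) \<le> \<Lambda>\<^sup>2 * (\<Sum>i<M. (F $$ (k, i))\<^sup>2)" if k: "k < M" for k
  proof -
    have d: "row D k \<in> carrier_vec M" using Dc k by auto
    have f: "row F k \<in> carrier_vec M" using F k by auto
    have "D = F * L" unfolding F_def using Dc P L by simp
    then have "row D k = transpose_mat L *\<^sub>v row F k"
      using F L k by (intro eq_vecI) (auto simp: scalar_prod_def mult.commute intro!: sum.cong)
    then have "vec_norm2 (row D k) \<le> \<Lambda> * vec_norm2 (row F k)"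
      using op_boundD[OF op_bound_transpose[OF L Lam(1)] LT f] by simp
    then have "(vec_norm2 (row D k))\<^sup>2 \<le> (\<Lambda> * vec_norm2 (row F k))\<^sup>2" by (rule power_mono) simp
    then show ?thesis
      unfolding power_mult_distrib vec_norm2_square using Dc F k
      by (simp add: scalar_prod_def lessThan_atLeast0 power2_eq_square)
  qed
  have "(\<Sum>i<M. \<Sum>j<M. (D $$ (i, j))\<^sup>2) \<le> (\<Sum>k<M. \<Lambda>\<^sup>2 * (\<Sum>i<M. (F $$ (k, i))\<^sup>2))"
    by (intro sum_mono rows) auto
  also have "\<dots> = \<Lambda>\<^sup>2 * (\<Sum>k<M. \<Sum>i<M. (F $$ (k, i))\<^sup>2)" by (simp only: sum_distrib_left)
  also have "(\<Sum>k<M. \<Sum>i<M. (F $$ (k, i))\<^sup>2) = (\<Sum>i<M. \<Sum>k<M. (F $$ (k, i))\<^sup>2)" by (rule sum.swap)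
  also have "\<dots> = (\<Sum>i<M. col F i \<bullet> col F i)"
    using F by (intro sum.cong refl) (simp add: scalar_prod_def lessThan_atLeast0 power2_eq_square)
  also have "\<Lambda>\<^sup>2 * (\<Sum>i<M. col F i \<bullet> col F i) \<le> \<Lambda>\<^sup>2 * (\<Sum>i<M. q * (col F i \<bullet> (X *\<^sub>v col F i)))"
    by (intro mult_left_mono sum_mono positive_definite_lower_bound[OF X Q(1-3)]) (use F in auto)
  also have "\<dots> = q * \<Lambda>\<^sup>2 * (\<Sum>i<M. col F i \<bullet> (X *\<^sub>v col F i))"
    by (simp add: sum_distrib_left mult_ac)
  finally show "(\<Sum>i<M. \<Sum>j<M. (D $$ (i, j))\<^sup>2) / (q * \<Lambda>\<^sup>2) \<le>
    - (\<Sum>i<M. \<Sum>j<M. D $$ (i, j) * (X - ?G) $$ (j, i))"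
    unfolding tr using Q(4) Lam(2) by (simp add: divide_le_eq mult.commute)
qed

text \<open>The representatives of the columns near \<open>r\<close> fill \<open>2 n + 1\<close> consecutive blocks.\<close>

lemma card_near_le:
  assumes "0 < m" "r < M"
  shows "card {c. c < M \<and> near m n M r c} \<le> (2 * n + 1) * m"
proof -
  let ?I = "{int m * (int r div int m - int n)..<int m * (int r div int m - int n) + int m * (2 * int n + 1)}"
  have "{c. c < M \<and> near m n M r c} \<subseteq> (\<lambda>d. nat (d mod int M)) ` ?I"
  proof
    fix c assume "c \<in> {c. c < M \<and> near m n M r c}"
    then obtain d where d: "d mod int M = int c" "\<bar>d div int m - int r div int m\<bar> \<le> int n"
      unfolding near_def by blast
    have dm: "d = int m * (d div int m) + d mod int m" "0 \<le> d mod int m" "d mod int m < int m"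
      using assms by auto
    have b: "int r div int m - int n \<le> d div int m" "d div int m + 1 \<le> int r div int m - int n + (2 * int n + 1)"
      using d(2) by linarith+
    have "int m * (int r div int m - int n) \<le> int m * (d div int m)"
      by (rule mult_left_mono[OF b(1)]) simp
    moreover have "int m * (d div int m + 1) \<le> int m * (int r div int m - int n + (2 * int n + 1))"
      by (rule mult_left_mono[OF b(2)]) simp
    ultimately have "d \<in> ?I" using dm by (simp only: distrib_left atLeastLessThan_iff mult_1_right) linarith
    moreover have "c = nat (d mod int M)" using d(1) by simp
    ultimately show "c \<in> (\<lambda>d. nat (d mod int M)) ` ?I" by blast
  qed
  then have "card {c. c < M \<and> near m n M r c} \<le> card ?I"
    by (meson card_image_le card_mono finite_atLeastLessThan_int finite_imageI order_trans)
  also have "card ?I = (2 * n + 1) * m"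
  proof -
    have "card ?I = nat (int m * (2 * int n + 1))" by simp
    also have "\<dots> = nat (int ((2 * n + 1) * m))" by (rule arg_cong[of _ _ nat]) (simp add: algebra_simps)
    also have "\<dots> = (2 * n + 1) * m" by (rule nat_int)
    finally show ?thesis .
  qed
  finally show ?thesis .
qed

lemma sum_abs_square_le:
  fixes f :: "'a \<Rightarrow> real"
  assumes "finite A" "B \<subseteq> A" "\<And>x. x \<in> A \<Longrightarrow> x \<notin> B \<Longrightarrow> f x = 0"
  shows "(\<Sum>x\<in>A. \<bar>f x\<bar>)\<^sup>2 \<le> real (card B) * (\<Sum>x\<in>A. (f x)\<^sup>2)"
proof -
  have "(\<Sum>x\<in>A. \<bar>f x\<bar>) = (\<Sum>x\<in>B. \<bar>f x\<bar> * \<bar>1\<bar>)"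
    by (simp, rule sum.mono_neutral_right) (use assms in auto)
  also have "\<dots> \<le> L2_set f B * L2_set (\<lambda>_. 1) B" by (rule L2_set_mult_ineq)
  finally have "(\<Sum>x\<in>A. \<bar>f x\<bar>)\<^sup>2 \<le> (L2_set f B * L2_set (\<lambda>_. 1) B)\<^sup>2"
    by (rule power_mono) (simp add: sum_nonneg)
  also have "\<dots> = (\<Sum>x\<in>B. (f x)\<^sup>2) * real (card B)"
    by (simp add: power_mult_distrib L2_set_def sum_nonneg)
  also have "(\<Sum>x\<in>B. (f x)\<^sup>2) = (\<Sum>x\<in>A. (f x)\<^sup>2)"
    by (rule sum.mono_neutral_left) (use assms in auto)
  finally show ?thesis by (simp add: mult.commute)
qed

lemma shift_invariant_iterate:
  assumes A: "shift_invariant m M A" and M: "M = m * N" and r: "r < M" and c: "c < M"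
  shows "A $$ ((r + m * p) mod M, (c + m * p) mod M) = A $$ (r, c)"
proof (induction p)
  case 0
  then show ?case using r c by simp
next
  case (Suc p)
  have e: "(x + m * Suc p) mod M = ((x + m * p) mod M + m) mod M" for x
    unfolding mod_add_left_eq by (simp add: algebra_simps)
  have "(r + m * p) mod M < M" "(c + m * p) mod M < M" using r by auto
  then show ?case unfolding e using A Suc unfolding shift_invariant_def by simp
qed

lemma shift_index_inj:
  assumes "x < M" "y < M" "(x + k) mod M = (y + k) mod M"
  shows "x = (y :: nat)"
proof -
  have "(int x + int k) mod int M = (int y + int k) mod int M"
    using assms(3) by (metis of_nat_add zmod_int)
  then have "(int x + int k - int k) mod int M = (int y + int k - int k) mod int M"
    by (rule mod_diff_cong) simp
  then show "x = y" using assms(1,2) by simp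
qed

lemma sum_mod_shift:
  fixes f :: "nat \<Rightarrow> real"
  assumes "0 < M"
  shows "(\<Sum>c<M. f ((c + k) mod M)) = (\<Sum>c<M. f c)"
proof -
  have inj: "inj_on (\<lambda>c. (c + k) mod M) {..<M}"
    by (rule inj_onI) (auto intro: shift_index_inj)
  have "(\<lambda>c. (c + k) mod M) ` {..<M} = {..<M}"
    by (rule endo_inj_surj[OF _ _ inj]) (use assms in auto)
  then show ?thesis using sum.reindex[OF inj, of f] by simp
qed

lemma shift_invariant_row_sums:
  assumes A: "shift_invariant m M A" and M: "M = m * N" "0 < M" and r: "r < M"
  shows "(\<Sum>c<M. f (A $$ ((r + m * p) mod M, c))) = (\<Sum>c<M. f (A $$ (r, c)) :: real)"
proof -
  have "(\<Sum>c<M. f (A $$ ((r + m * p) mod M, c))) = (\<Sum>c<M. f (A $$ ((r + m * p) mod M, (c + m * p) mod M)))"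
    by (rule sum_mod_shift[symmetric, OF M(2)])
  also have "\<dots> = (\<Sum>c<M. f (A $$ (r, c)))"
    by (intro sum.cong refl) (simp add: shift_invariant_iterate[OF A M(1) r])
  finally show ?thesis .
qed

text \<open>Each row of a block circulant matrix occurs \<open>N\<close> times up to a shift, so the largest absolute row sum \<open>s\<close> is
attained \<open>N\<close> times, and the row that attains it has at most \<open>(2 n + 1) m\<close> nonzero entries.\<close>

lemma circulant_frobenius_lower:
  assumes D: "shift_invariant m M D" and M: "M = m * N" and pos: "0 < m" "0 < N"
    and supp: "\<And>r c. r < M \<Longrightarrow> c < M \<Longrightarrow> D $$ (r, c) \<noteq> 0 \<Longrightarrow> near m n M r c"
  shows "\<exists>s\<ge>0. (\<forall>r<M. (\<Sum>c<M. \<bar>D $$ (r, c)\<bar>) \<le> s) \<and>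
    real N * s\<^sup>2 \<le> real ((2 * n + 1) * m) * (\<Sum>r<M. \<Sum>c<M. (D $$ (r, c))\<^sup>2)"
proof -
  have M0: "0 < M" and mM: "m \<le> M" using M pos by auto
  define rs where "rs r = (\<Sum>c<M. \<bar>D $$ (r, c)\<bar>)" for r
  define s where "s = Max (rs ` {..<m})"
  have "s \<in> rs ` {..<m}" unfolding s_def by (rule Max_in) (use pos in auto)
  then obtain a where a: "a < m" "s = rs a" by auto
  have s0: "0 \<le> s" unfolding a(2) rs_def by (simp add: sum_nonneg)
  have rs_le: "rs r \<le> s" if r: "r < M" for r
  proof -
    have "r mod m + m * (r div m) = r" by simp
    then have "rs r = rs (r mod m)"
      using shift_invariant_row_sums[OF D M M0, of "r mod m" abs "r div m"] r mM pos
      unfolding rs_def by (metis mod_less mod_less_divisor order_less_le_trans)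
    then show ?thesis unfolding s_def using pos by simp
  qed
  let ?sq = "\<lambda>r. \<Sum>c<M. (D $$ (r, c))\<^sup>2"
  have aM: "a < M" using a mM by simp
  have row: "s\<^sup>2 \<le> real ((2 * n + 1) * m) * ?sq a"
  proof -
    have "s\<^sup>2 \<le> real (card {c. c < M \<and> near m n M a c}) * ?sq a"
      unfolding a(2) rs_def by (rule sum_abs_square_le) (use supp[OF aM] in auto)
    also have "\<dots> \<le> real ((2 * n + 1) * m) * ?sq a"
      using card_near_le[OF pos(1) aM] by (intro mult_right_mono sum_nonneg) (simp_all only: of_nat_le_iff zero_le_power2)
    finally show ?thesis .
  qed
  have "real N * ?sq a = (\<Sum>p<N. ?sq ((a + m * p) mod M))"
    using shift_invariant_row_sums[OF D M M0 aM, of "\<lambda>x. x\<^sup>2"] by simp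
  also have "\<dots> = (\<Sum>p<N. ?sq (a + m * p))"
  proof (rule sum.cong[OF refl])
    fix p assume "p \<in> {..<N}"
    then have "m * Suc p \<le> m * N" by (intro mult_le_mono2) auto
    then have "a + m * p < M" using a M by simp
    then show "?sq ((a + m * p) mod M) = ?sq (a + m * p)" by simp
  qed
  also have "\<dots> = (\<Sum>r\<in>(\<lambda>p. a + m * p) ` {..<N}. ?sq r)"
    by (subst sum.reindex) (use pos in \<open>auto simp: inj_on_def\<close>)
  also have "\<dots> \<le> (\<Sum>r<M. ?sq r)"
  proof (rule sum_mono2)
    show "(\<lambda>p. a + m * p) ` {..<N} \<subseteq> {..<M}"
    proof
      fix r assume "r \<in> (\<lambda>p. a + m * p) ` {..<N}"
      then obtain p where p: "p < N" "r = a + m * p" by auto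
      then have "m * Suc p \<le> m * N" by (intro mult_le_mono2) auto
      then show "r \<in> {..<M}" using a M p by simp
    qed
  qed (auto intro: sum_nonneg)
  finally have "real N * ?sq a \<le> (\<Sum>r<M. ?sq r)" .
  then have "real ((2 * n + 1) * m) * (real N * ?sq a) \<le> real ((2 * n + 1) * m) * (\<Sum>r<M. ?sq r)"
    by (rule mult_left_mono) simp
  moreover have "real N * s\<^sup>2 \<le> real N * (real ((2 * n + 1) * m) * ?sq a)"
    by (rule mult_left_mono[OF row]) simp
  ultimately have "real N * s\<^sup>2 \<le> real ((2 * n + 1) * m) * (\<Sum>r<M. ?sq r)"
    by (simp only: mult.left_commute)
  then show ?thesis using s0 rs_le unfolding rs_def by blast
qed

lemma shift_invariant_minus:
  assumes "A \<in> carrier_mat M M" "B \<in> carrier_mat M M" "shift_invariant m M A" "shift_invariant m M B"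
  shows "shift_invariant m M (A - B)"
  using assms unfolding shift_invariant_def by auto

text \<open>With \<open>G = P P\<^sup>T\<close>, the matrix \<open>C - G = P E P\<^sup>T\<close> is of order \<open>\<eta>\<close>.  Within the band \<open>X - G\<close> equals \<open>C - G\<close>, and \<open>D\<close>
vanishes outside the band, so the energy of \<open>D\<close> is at most \<open>M s\<close> times a quantity of order \<open>\<eta>\<close>,
where \<open>s\<close> is the largest row sum of \<open>D\<close>; it is at least of order \<open>N s\<^sup>2 / (\<Lambda>\<^sup>2 + s)\<close>.  For small \<open>\<eta>\<close> this forces \<open>s\<close> to be
of order \<open>\<eta>\<close>.  All constants are independent of \<open>N\<close>.\<close>

lemma circulant_stability:
  assumes M: "M = m * N" "0 < m" "0 < N"
    and L: "L \<in> carrier_mat M M" and C: "C \<in> carrier_mat M M" "transpose_mat C = C" and E: "E \<in> carrier_mat M M"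
    and eq: "L * C * transpose_mat L = 1\<^sub>m M + E" and eta: "op_bound E \<eta>" "\<eta> \<le> 1 / 2"
    and Lam: "op_bound L \<Lambda>" "0 < \<Lambda>" and K: "op_bound C K" "0 < K"
    and R: "shift_invariant m M (transpose_mat L * L)"
      "\<And>r c. r < M \<Longrightarrow> c < M \<Longrightarrow> (transpose_mat L * L) $$ (r, c) \<noteq> 0 \<Longrightarrow> near m n M r c"
    and X: "X \<in> carrier_mat M M" "positive_definite X" "\<And>r c. r < M \<Longrightarrow> c < M \<Longrightarrow> near m n M r c \<Longrightarrow> X $$ (r, c) = C $$ (r, c)"
    and Q: "Q \<in> carrier_mat M M" "X * Q = 1\<^sub>m M" "shift_invariant m M Q"
      "\<And>r c. r < M \<Longrightarrow> c < M \<Longrightarrow> Q $$ (r, c) \<noteq> 0 \<Longrightarrow> near m n M r c"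
    and \<delta>: "\<delta> = 2 * K * \<eta> * real m * real ((2 * n + 1) * m) * \<Lambda>\<^sup>2" "\<delta> \<le> 1 / 2" "2 * K * (2 * \<delta> * \<Lambda>\<^sup>2) \<le> 1 / 2"
  shows "op_bound (C - X) (2 * K * \<eta> + 8 * K\<^sup>2 * (2 * \<delta> * \<Lambda>\<^sup>2))"
proof -
  obtain P where P: "P \<in> carrier_mat M M" "P * L = 1\<^sub>m M" "L * P = 1\<^sub>m M" "op_bound P (sqrt (2 * K))"
    and CP: "C = P * (1\<^sub>m M + E) * transpose_mat P"
    using factor_inverse[OF L C(1) E eq eta K(1) C(2)] by metis
  let ?G = "P * transpose_mat P" and ?R = "transpose_mat L * L"
  have PT: "transpose_mat P \<in> carrier_mat M M" and LT: "transpose_mat L \<in> carrier_mat M M" using P L by simp_all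
  have G: "?G \<in> carrier_mat M M" and Rc: "?R \<in> carrier_mat M M"
    using mult_carrier_mat[OF P(1) PT] mult_carrier_mat[OF LT L] by auto
  have kk: "sqrt (2 * K) * sqrt (2 * K) = 2 * K" using K(2) by simp
  have bPT: "op_bound (transpose_mat P) (sqrt (2 * K))" by (rule op_bound_transpose[OF P(1,4)])
  have bG: "op_bound ?G (2 * K)" using op_bound_mult[OF P(1) PT P(4) bPT] kk by simp
  have eta0: "0 \<le> \<eta>" by (rule op_bound_nonneg[OF eta(1)])
  have PE: "P * E \<in> carrier_mat M M" using P E by simp
  have CG: "C - ?G = P * E * transpose_mat P"
  proof -
    have "C = (P + P * E) * transpose_mat P"
      unfolding CP using mult_add_distrib_mat[OF P(1) one_carrier_mat E] P by simp
    also have "\<dots> = ?G + P * E * transpose_mat P" by (rule add_mult_distrib_mat[OF P(1) PE PT])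
    finally have e: "C = ?G + P * E * transpose_mat P" .
    show ?thesis unfolding e using carrier_matD[OF G] mult_carrier_mat[OF PE PT] by (intro eq_matI) auto
  qed
  have bCG: "op_bound (C - ?G) (2 * K * \<eta>)"
    using op_bound_mult[OF PE PT op_bound_mult[OF P(1) E P(4) eta(1)] bPT] kk unfolding CG
    by (simp add: mult_ac)
  define D where "D = Q - ?R"
  have Dc: "D \<in> carrier_mat M M" unfolding D_def by (rule minus_carrier_mat[OF Rc])
  have Qsym: "transpose_mat Q = Q" by (rule symmetric_inverse[OF X(1) Q(1,2) positive_definite_sym[OF X(2)]])
  have Dsym: "transpose_mat D = D"
    unfolding D_def transpose_minus[OF Q(1) Rc] Qsym transpose_mult[OF LT L] by simp
  have Dshift: "shift_invariant m M D" unfolding D_def by (rule shift_invariant_minus[OF Q(1) Rc Q(3) R(1)])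
  have Dsupp: "near m n M r c" if rc: "r < M" "c < M" and nz: "D $$ (r, c) \<noteq> 0" for r c
  proof -
    have "D $$ (r, c) = Q $$ (r, c) - ?R $$ (r, c)" unfolding D_def using rc carrier_matD[OF Rc] by simp
    then show ?thesis using nz Q(4)[OF rc] R(2)[OF rc] by fastforce
  qed
  let ?b = "real ((2 * n + 1) * m)"
  have "\<exists>s\<ge>0. (\<forall>r<M. (\<Sum>c<M. \<bar>D $$ (r, c)\<bar>) \<le> s) \<and>
      real N * s\<^sup>2 \<le> ?b * (\<Sum>r<M. \<Sum>c<M. (D $$ (r, c))\<^sup>2)"
    by (rule circulant_frobenius_lower[OF Dshift M Dsupp])
  then obtain s where s: "0 \<le> s" "\<And>r. r < M \<Longrightarrow> (\<Sum>c<M. \<bar>D $$ (r, c)\<bar>) \<le> s"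
    and frob: "real N * s\<^sup>2 \<le> ?b * (\<Sum>r<M. \<Sum>c<M. (D $$ (r, c))\<^sup>2)"
    by blast
  have bD: "op_bound D s"
  proof (rule op_bound_schur_test[OF Dc s(1,2)])
    fix j assume j: "j < M"
    have "(\<Sum>i<M. \<bar>D $$ (i, j)\<bar>) = (\<Sum>i<M. \<bar>D $$ (j, i)\<bar>)"
      using symmetric_index[OF Dsym Dc] j by (intro sum.cong) auto
    then show "(\<Sum>i<M. \<bar>D $$ (i, j)\<bar>) \<le> s" using s(2)[OF j] by simp
  qed
  \<comment> \<open>the bound on \<open>Q\<close> involves \<open>s\<close> itself, which is why \<open>\<delta>\<close> has to be small for the estimate of \<open>s\<close> to close\<close>
  define q where "q = \<Lambda>\<^sup>2 + s"
  have q: "0 < q" unfolding q_def using Lam(2) s(1) by (simp add: add_pos_nonneg)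
  have bQ: "op_bound Q q"
  proof -
    have "?R + D = Q" unfolding D_def using Q(1) carrier_matD[OF Rc] by (intro eq_matI) auto
    moreover have "op_bound ?R (\<Lambda>\<^sup>2)"
      using op_bound_mult[OF LT L op_bound_transpose[OF L Lam(1)] Lam(1)] by (simp add: power2_eq_square)
    ultimately show ?thesis using op_bound_add[OF Rc Dc _ bD] unfolding q_def by metis
  qed
  note energy = inverse_difference_energy[OF L P(1-3) Lam X(1,2) Q(1,2) bQ q D_def]
  have Gsym: "transpose_mat ?G = ?G" unfolding transpose_mult[OF P(1) PT] by simp
  have entry: "- (D $$ (i, j) * (X - ?G) $$ (j, i)) \<le> \<bar>D $$ (i, j)\<bar> * (2 * K * \<eta>)" if i: "i < M" and j: "j < M" for i j
  proof (cases "D $$ (i, j) = 0")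
    case False
    then have "near m n M i j" by (rule Dsupp[OF i j])
    then have "X $$ (i, j) = C $$ (i, j)" by (rule X(3)[OF i j])
    moreover have "X $$ (j, i) = X $$ (i, j)" "?G $$ (j, i) = ?G $$ (i, j)"
      using symmetric_index[OF positive_definite_sym[OF X(2)] X(1) j i] symmetric_index[OF Gsym G j i] by auto
    ultimately have "(X - ?G) $$ (j, i) = (C - ?G) $$ (i, j)"
      using i j carrier_matD[OF G] by simp
    moreover have "\<bar>(C - ?G) $$ (i, j)\<bar> \<le> 2 * K * \<eta>"
      by (rule abs_index_le_op_bound[OF minus_carrier_mat[OF G] bCG i j])
    ultimately have "\<bar>D $$ (i, j) * (X - ?G) $$ (j, i)\<bar> \<le> \<bar>D $$ (i, j)\<bar> * (2 * K * \<eta>)"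
      unfolding abs_mult by (intro mult_left_mono) auto
    then show ?thesis by linarith
  qed simp
  have "(\<Sum>i<M. \<Sum>j<M. - (D $$ (i, j) * (X - ?G) $$ (j, i))) \<le> (\<Sum>i<M. \<Sum>j<M. \<bar>D $$ (i, j)\<bar> * (2 * K * \<eta>))"
    by (intro sum_mono entry) auto
  then have "(\<Sum>i<M. \<Sum>j<M. (D $$ (i, j))\<^sup>2) / (q * \<Lambda>\<^sup>2) \<le> (\<Sum>i<M. \<Sum>j<M. \<bar>D $$ (i, j)\<bar> * (2 * K * \<eta>))"
    using energy(1) unfolding sum_negf by linarith
  also have "\<dots> = (\<Sum>i<M. \<Sum>j<M. \<bar>D $$ (i, j)\<bar>) * (2 * K * \<eta>)" by (simp only: sum_distrib_right)
  also have "\<dots> \<le> (\<Sum>i<M. s) * (2 * K * \<eta>)"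
    by (intro mult_right_mono sum_mono s(2)) (use K eta0 in auto)
  also have "\<dots> = real N * (real m * (2 * K * \<eta>) * s)" unfolding M(1) by simp
  finally have "(\<Sum>i<M. \<Sum>j<M. (D $$ (i, j))\<^sup>2) \<le> real N * (real m * (2 * K * \<eta>) * s) * (q * \<Lambda>\<^sup>2)"
    using q Lam(2) by (simp add: divide_le_eq)
  then have "?b * (\<Sum>i<M. \<Sum>j<M. (D $$ (i, j))\<^sup>2) \<le> ?b * (real N * (real m * (2 * K * \<eta>) * s) * (q * \<Lambda>\<^sup>2))"
    by (rule mult_left_mono) simp
  with frob have "real N * s\<^sup>2 \<le> ?b * (real N * (real m * (2 * K * \<eta>) * s) * (q * \<Lambda>\<^sup>2))" by linarith
  also have "\<dots> = real N * (\<delta> * q * s)" unfolding \<delta>(1) by (simp only: mult_ac)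
  finally have "s * s \<le> (\<delta> * q) * s" using M(3) by (simp add: power2_eq_square)
  moreover have d0: "0 \<le> \<delta>" unfolding \<delta>(1) using K eta0 by simp
  ultimately have "s \<le> \<delta> * q" using s(1) q by (cases "s = 0") auto
  also have "\<delta> * q \<le> \<delta> * \<Lambda>\<^sup>2 + 1 / 2 * s" unfolding q_def distrib_left using mult_right_mono[OF \<delta>(2) s(1)] by linarith
  finally have s_le: "s \<le> 2 * \<delta> * \<Lambda>\<^sup>2" by linarith
  have QX: "Q * X = 1\<^sub>m M" by (rule mat_mult_left_right_inverse[OF X(1) Q(1,2)])
  \<comment> \<open>\<open>Q\<close> is a small perturbation of \<open>L\<^sup>T L \<ge> 1/(2 K)\<close>, so it is bounded below by \<open>1/(4 K)\<close>\<close>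
  have bX: "op_bound X (4 * K)"
    unfolding op_bound_def
  proof (intro conjI ballI)
    fix y :: "real vec" assume "y \<in> carrier_vec (dim_col X)"
    then have y: "y \<in> carrier_vec M" using X(1) by auto
    define x where "x = X *\<^sub>v y"
    have x: "x \<in> carrier_vec M" unfolding x_def using X(1) y by simp
    have Qx: "Q *\<^sub>v x = y" unfolding x_def using assoc_mult_mat_vec[OF Q(1) X(1) y] QX y by simp
    have Lx: "L *\<^sub>v x \<in> carrier_vec M" using L x by simp
    have Dx: "D *\<^sub>v x \<in> carrier_vec M" using Dc x by simp
    have "x = P *\<^sub>v (L *\<^sub>v x)" using assoc_mult_mat_vec[OF P(1) L x] P(2) x by simp
    then have "vec_norm2 x \<le> sqrt (2 * K) * vec_norm2 (L *\<^sub>v x)" using op_boundD[OF P(4,1) Lx] by simp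
    then have "(vec_norm2 x)\<^sup>2 \<le> (sqrt (2 * K) * vec_norm2 (L *\<^sub>v x))\<^sup>2" by (rule power_mono) simp
    also have "\<dots> = 2 * K * ((L *\<^sub>v x) \<bullet> (L *\<^sub>v x))"
      using K(2) by (simp add: power_mult_distrib vec_norm2_square)
    also have "(L *\<^sub>v x) \<bullet> (L *\<^sub>v x) = x \<bullet> (?R *\<^sub>v x)"
      using transpose_vec_mult_scalar[OF L x Lx] comm_scalar_prod[OF x mult_mat_vec_carrier[OF LT Lx]]
        assoc_mult_mat_vec[OF LT L x] by simp
    also have "?R *\<^sub>v x = y - D *\<^sub>v x"
    proof -
      have "D *\<^sub>v x = Q *\<^sub>v x - ?R *\<^sub>v x" unfolding D_def by (rule minus_mult_distrib_mat_vec[OF Q(1) Rc x])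
      then show ?thesis unfolding Qx using y mult_mat_vec_carrier[OF Rc x] by (intro eq_vecI) auto
    qed
    also have "x \<bullet> (y - D *\<^sub>v x) = x \<bullet> y - x \<bullet> (D *\<^sub>v x)" by (rule scalar_prod_minus_distrib[OF x y Dx])
    also have "\<dots> \<le> vec_norm2 x * vec_norm2 y + s * (vec_norm2 x)\<^sup>2"
      using abs_scalar_prod_le[OF x y] abs_scalar_prod_le[OF x Dx]
        mult_left_mono[OF op_boundD[OF bD Dc x], of "vec_norm2 x"]
      by (simp add: power2_eq_square mult_ac)
    finally have "(vec_norm2 x)\<^sup>2 \<le> 2 * K * (vec_norm2 x * vec_norm2 y + s * (vec_norm2 x)\<^sup>2)"
      using K(2) by simp
    also have "\<dots> = 2 * K * (vec_norm2 x * vec_norm2 y) + (2 * K * s) * (vec_norm2 x)\<^sup>2"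
      by (simp add: algebra_simps)
    also have "(2 * K * s) * (vec_norm2 x)\<^sup>2 \<le> 1 / 2 * (vec_norm2 x)\<^sup>2"
    proof (rule mult_right_mono)
      have "2 * K * s \<le> 2 * K * (2 * \<delta> * \<Lambda>\<^sup>2)" by (rule mult_left_mono[OF s_le]) (use K in simp)
      then show "2 * K * s \<le> 1 / 2" using \<delta>(3) by linarith
    qed simp
    finally have "vec_norm2 x * vec_norm2 x \<le> (4 * K * vec_norm2 y) * vec_norm2 x"
      by (simp add: power2_eq_square algebra_simps)
    then show "vec_norm2 (X *\<^sub>v y) \<le> 4 * K * vec_norm2 y"
      unfolding x_def[symmetric] using K(2) by (cases "vec_norm2 x = 0") (auto simp: less_le)
  qed (use K in simp)
  have XD: "X * D \<in> carrier_mat M M" using X(1) Dc by simp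
  have "op_bound (?G - X) (4 * K * s * (2 * K))"
    unfolding energy(2) by (rule op_bound_mult[OF XD G op_bound_mult[OF X(1) Dc bX bD] bG])
  moreover have "4 * K * s * (2 * K) \<le> 8 * K\<^sup>2 * (2 * \<delta> * \<Lambda>\<^sup>2)"
    using mult_left_mono[OF s_le, of "8 * K\<^sup>2"] by (simp add: power2_eq_square mult_ac)
  ultimately have "op_bound (?G - X) (8 * K\<^sup>2 * (2 * \<delta> * \<Lambda>\<^sup>2))" by (rule op_bound_mono)
  moreover have "C - X = (C - ?G) + (?G - X)"
    using C(1) X(1) carrier_matD[OF G] by (intro eq_matI) auto
  ultimately show ?thesis
    using op_bound_add[OF minus_carrier_mat[OF G] minus_carrier_mat[OF X(1)] bCG] by metis
qed

section \<open>The constraints in terms of entries\<close>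

text \<open>The block at time lag \<open>k \<ge> 0\<close> to the right of the diagonal is the transpose of \<open>Sh k\<close>, which explains the order of
the two inner indices in the first case.\<close>

definition block_kernel :: "nat \<Rightarrow> (nat \<Rightarrow> real mat) \<Rightarrow> int \<Rightarrow> int \<Rightarrow> real" where
  "block_kernel m Sh r c =
    (if r div int m \<le> c div int m
     then Sh (nat (c div int m - r div int m)) $$ (nat (c mod int m), nat (r mod int m))
     else Sh (nat (r div int m - c div int m)) $$ (nat (r mod int m), nat (c mod int m)))"

lemma div_lt_of_less_mult: "r < m * N \<Longrightarrow> 0 < m \<Longrightarrow> r div m < N" for r m N :: nat
  by (simp add: less_mult_imp_div_less mult.commute)

lemma Toepl_carrier [simp]: "Toepl m N X \<in> carrier_mat (m * N) (m * N)"
  by (simp add: Toepl_def)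

lemma Toepl_eq_block_kernel:
  assumes Sh: "\<And>k. Sh k \<in> carrier_mat m m" and m: "0 < m"
  shows "Toepl m N (\<lambda>k. transpose_mat (Sh k)) = mat (m * N) (m * N) (\<lambda>(i, j). block_kernel m Sh (int i) (int j))"
proof (rule eq_matI)
  fix r c
  assume "r < dim_row (mat (m * N) (m * N) (\<lambda>(i, j). block_kernel m Sh (int i) (int j)))"
    "c < dim_col (mat (m * N) (m * N) (\<lambda>(i, j). block_kernel m Sh (int i) (int j)))"
  then have r: "r < m * N" and c: "c < m * N" by auto
  have lt: "r mod m < m" "c mod m < m" using m by auto
  show "Toepl m N (\<lambda>k. transpose_mat (Sh k)) $$ (r, c) =
      mat (m * N) (m * N) (\<lambda>(i, j). block_kernel m Sh (int i) (int j)) $$ (r, c)"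
    using r c lt carrier_matD[OF Sh]
    by (simp add: Toepl_def block_kernel_def Let_def zdiv_int[symmetric] zmod_int[symmetric] nat_diff_distrib')
qed (simp_all add: Toepl_def)

lemma block_eq_iff_entries:
  assumes A: "A \<in> carrier_mat (m * N) (m * N)"
  shows "block m A i j = block m A i' j' \<longleftrightarrow>
    (\<forall>a<m. \<forall>b<m. A $$ (m * i + a, m * j + b) = A $$ (m * i' + a, m * j' + b))"
  unfolding block_def by (auto simp: mat_eq_iff)

lemma corner_submatrix:
  assumes A: "A \<in> carrier_mat (m * N) (m * N)" and N: "n + 1 \<le> N"
  shows "transpose_mat (E_mat m n N) * A * E_mat m n N = mat (m * (n + 1)) (m * (n + 1)) (\<lambda>(i, j). A $$ (i, j))"
proof (rule eq_matI)
  fix r c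
  assume "r < dim_row (mat (m * (n + 1)) (m * (n + 1)) (\<lambda>(i, j). A $$ (i, j)))"
    "c < dim_col (mat (m * (n + 1)) (m * (n + 1)) (\<lambda>(i, j). A $$ (i, j)))"
  then have r: "r < m * (n + 1)" and c: "c < m * (n + 1)" by auto
  have le: "m * (n + 1) \<le> m * N" using N by (rule mult_le_mono2)
  have rN: "r < m * N" and cN: "c < m * N" using r c le by linarith+
  have Ec: "E_mat m n N \<in> carrier_mat (m * N) (m * (n + 1))" by (simp add: E_mat_def)
  have EA: "(transpose_mat (E_mat m n N) * A) $$ (r, j) = A $$ (r, j)" if j: "j < m * N" for j
  proof -
    have "(transpose_mat (E_mat m n N) * A) $$ (r, j) = (\<Sum>i<m * N. (if i = r then 1 else 0) * A $$ (i, j))"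
      using A r j by (simp add: E_mat_def scalar_prod_def lessThan_atLeast0)
    also have "\<dots> = A $$ (r, j)"
      using rN by (simp add: if_distrib[of "\<lambda>x. x * _"] cong: if_cong)
    finally show ?thesis .
  qed
  have EAc: "transpose_mat (E_mat m n N) * A \<in> carrier_mat (m * (n + 1)) (m * N)"
    using Ec A by auto
  have "(transpose_mat (E_mat m n N) * A * E_mat m n N) $$ (r, c) =
      (\<Sum>j<m * N. (transpose_mat (E_mat m n N) * A) $$ (r, j) * E_mat m n N $$ (j, c))"
    by (rule mat_mult_index_sum[OF EAc Ec r c])
  also have "\<dots> = (\<Sum>j<m * N. A $$ (r, j) * (if j = c then 1 else 0))"
    by (rule sum.cong[OF refl]) (use EA c in \<open>simp add: E_mat_def\<close>)
  also have "\<dots> = A $$ (r, c)" using cN by (simp add: if_distrib cong: if_cong)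
  finally show "(transpose_mat (E_mat m n N) * A * E_mat m n N) $$ (r, c) =
      mat (m * (n + 1)) (m * (n + 1)) (\<lambda>(i, j). A $$ (i, j)) $$ (r, c)" using r c by simp
qed (auto simp: E_mat_def)

lemma shift_index:
  fixes m N r c :: nat
  assumes "0 < m" "r < m * N"
  shows "c < m * N \<Longrightarrow> (c div m = (r div m + 1) mod N \<and> r mod m = c mod m) \<longleftrightarrow> c = (r + m) mod (m * N)"
    and "(r + m) mod (m * N) < m * N"
proof -
  have N: "0 < m * N" using assms by (cases N) auto
  have e: "(r + m) mod (m * N) = m * ((r div m + 1) mod N) + r mod m"
    using mod_mult2_eq[of "r + m" m N] assms(1) by simp
  show "(r + m) mod (m * N) < m * N" by (rule mod_less_divisor[OF N])
  show "(c div m = (r div m + 1) mod N \<and> r mod m = c mod m) \<longleftrightarrow> c = (r + m) mod (m * N)"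
    unfolding e
  proof
    assume "c div m = (r div m + 1) mod N \<and> r mod m = c mod m"
    then show "c = m * ((r div m + 1) mod N) + r mod m" by (metis mult_div_mod_eq)
  next
    assume "c = m * ((r div m + 1) mod N) + r mod m"
    then show "c div m = (r div m + 1) mod N \<and> r mod m = c mod m" using assms(1) by simp
  qed
qed

lemma shift_conjugation_iff:
  assumes A: "A \<in> carrier_mat (m * N) (m * N)" and m: "0 < m"
  shows "transpose_mat (U_mat m N) * A * U_mat m N = A \<longleftrightarrow> shift_invariant m (m * N) A"
proof -
  let ?M = "m * N" and ?U = "U_mat m N" and ?s = "\<lambda>r. (r + m) mod (m * N)"
  have U: "?U \<in> carrier_mat ?M ?M" by (simp add: U_mat_def)
  have Uij: "?U $$ (i, j) = (if j = ?s i then 1 else 0)" if "i < ?M" "j < ?M" for i j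
    using shift_index(1)[OF m that] that by (simp add: U_mat_def)
  have UA: "(transpose_mat ?U * A) $$ (?s r, j) = A $$ (r, j)" if r: "r < ?M" and j: "j < ?M" for r j
  proof -
    have "(transpose_mat ?U * A) $$ (?s r, j) = (\<Sum>i<?M. ?U $$ (i, ?s r) * A $$ (i, j))"
      using U A j shift_index(2)[OF m r] by (simp add: scalar_prod_def lessThan_atLeast0)
    also have "\<dots> = (\<Sum>i<?M. (if i = r then 1 else 0) * A $$ (i, j))"
      by (rule sum.cong[OF refl]) (use Uij shift_index(2)[OF m r] shift_index_inj[of _ ?M r m] r in auto)
    also have "\<dots> = A $$ (r, j)" using r by (simp add: if_distrib[of "\<lambda>x. x * _"] cong: if_cong)
    finally show ?thesis .
  qed
  have UAc: "transpose_mat ?U * A \<in> carrier_mat ?M ?M" using U A by auto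
  have UAU: "(transpose_mat ?U * A * ?U) $$ (?s r, ?s c) = A $$ (r, c)" if r: "r < ?M" and c: "c < ?M" for r c
  proof -
    have "(transpose_mat ?U * A * ?U) $$ (?s r, ?s c) = (\<Sum>j<?M. (transpose_mat ?U * A) $$ (?s r, j) * ?U $$ (j, ?s c))"
      by (rule mat_mult_index_sum[OF UAc U shift_index(2)[OF m r] shift_index(2)[OF m c]])
    also have "\<dots> = (\<Sum>j<?M. A $$ (r, j) * (if j = c then 1 else 0))"
      by (rule sum.cong[OF refl]) (use UA[OF r] Uij shift_index(2)[OF m c] shift_index_inj[of _ ?M c m] c in auto)
    also have "\<dots> = A $$ (r, c)" using c by (simp add: if_distrib cong: if_cong)
    finally show ?thesis .
  qed
  have surj: "\<exists>r'<?M. r = ?s r'" if r: "r < ?M" for r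
  proof -
    have inj: "inj_on ?s {..<?M}" by (rule inj_onI) (auto intro: shift_index_inj)
    have "?s ` {..<?M} = {..<?M}"
      by (rule endo_inj_surj[OF _ _ inj]) (use shift_index(2)[OF m] in auto)
    then show ?thesis using r by blast
  qed
  show ?thesis
  proof
    assume eq: "transpose_mat ?U * A * ?U = A"
    show "shift_invariant m ?M A" unfolding shift_invariant_def using UAU unfolding eq by simp
  next
    assume inv: "shift_invariant m ?M A"
    show "transpose_mat ?U * A * ?U = A"
    proof (rule eq_matI)
      fix r c assume "r < dim_row A" "c < dim_col A"
      then have "r < ?M" "c < ?M" using A by auto
      then obtain r' c' where rc: "r' < ?M" "c' < ?M" "r = ?s r'" "c = ?s c'" using surj by metis
      show "(transpose_mat ?U * A * ?U) $$ (r, c) = A $$ (r, c)"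
        unfolding rc(3,4) UAU[OF rc(1,2)] using inv rc(1,2) unfolding shift_invariant_def by simp
    qed (use U A in auto)
  qed
qed

lemma div_add_mult: "0 < m \<Longrightarrow> (x + int m * k) div int m = x div int m + k"
  by simp

section \<open>Optimality conditions\<close>

lemma near_shift:
  assumes m: "0 < m" and M: "M = m * N" and c: "c < M"
    and near: "near m n M ((r + m * p) mod M) ((c + m * p) mod M)"
  shows "near m n M r c"
proof -
  obtain d where d: "d mod int M = int ((c + m * p) mod M)" "\<bar>d div int m - int ((r + m * p) mod M) div int m\<bar> \<le> int n"
    using near unfolding near_def by blast
  define k where "k = int (r + m * p) div int M"
  have r: "int ((r + m * p) mod M) = int r + int m * (int p - int N * k)"
  proof -
    have "int ((r + m * p) mod M) = int (r + m * p) - int M * k"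
      unfolding k_def zmod_int by (rule minus_mult_div_eq_mod[symmetric])
    then show ?thesis unfolding M by (simp add: algebra_simps)
  qed
  let ?d = "d - int m * (int p - int N * k)"
  have "?d mod int M = (d - int m * int p + int M * k) mod int M" unfolding M by (simp add: algebra_simps)
  also have "\<dots> = (d - int m * int p) mod int M" by simp
  also have "\<dots> = (d mod int M - int m * int p) mod int M" by (simp add: mod_diff_left_eq)
  also have "\<dots> = ((int c + int m * int p) mod int M - int m * int p) mod int M" unfolding d(1) by (simp add: zmod_int)
  also have "\<dots> = int c" using c by (simp add: mod_diff_left_eq)
  finally have "?d mod int M = int c" .
  moreover have "?d div int m = d div int m - (int p - int N * k)"
  proof -
    have e: "?d = d + int m * (int N * k - int p)" by (simp add: algebra_simps)
    show ?thesis unfolding e div_add_mult[OF m] by simp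
  qed
  moreover have "int ((r + m * p) mod M) div int m = int r div int m + (int p - int N * k)"
    unfolding r using m by simp
  ultimately show ?thesis using d(2) unfolding near_def by (intro exI[of _ ?d]) auto
qed

lemma near_sym:
  assumes m: "0 < m" and M: "M = m * N" and r: "r < M" and near: "near m n M r c"
  shows "near m n M c r"
proof -
  obtain d where d: "d mod int M = int c" "\<bar>d div int m - int r div int m\<bar> \<le> int n"
    using near unfolding near_def by blast
  define k where "k = d div int M"
  have dk: "d = int c + int M * k" using d(1) mult_div_mod_eq[of "int M" d] unfolding k_def by simp
  have "(int r - int M * k) mod int M = int r" using r mod_mult_self2[of "int r" "int M" "- k"] by simp
  moreover have "(int r - int M * k) div int m = int r div int m - int N * k"
  proof -
    have e: "int r - int M * k = int r + int m * (- int N * k)" unfolding M by simp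
    show ?thesis unfolding e div_add_mult[OF m] by simp
  qed
  moreover have "d div int m = int c div int m + int N * k"
  proof -
    have e: "d = int c + int m * (int N * k)" unfolding dk M by simp
    show ?thesis unfolding e div_add_mult[OF m] ..
  qed
  ultimately show ?thesis using d(2) unfolding near_def by (intro exI[of _ "int r - int M * k"]) auto
qed

lemma double_delta_sum:
  fixes f :: "nat \<Rightarrow> nat \<Rightarrow> real"
  assumes "a < M" "b < M"
  shows "(\<Sum>i<M. \<Sum>j<M. f i j * (if j = a \<and> i = b then 1 else 0)) = f b a"
proof -
  have "(\<Sum>i<M. \<Sum>j<M. f i j * (if j = a \<and> i = b then 1 else 0)) = (\<Sum>i<M. if i = b then f i a else 0)"
  proof (rule sum.cong[OF refl])
    fix i
    have "(\<Sum>j<M. f i j * (if j = a \<and> i = b then 1 else 0)) = (\<Sum>j<M. if j = a then (if i = b then f i j else 0) else 0)"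
      by (rule sum.cong[OF refl]) simp
    then show "(\<Sum>j<M. f i j * (if j = a \<and> i = b then 1 else 0)) = (if i = b then f i a else 0)"
      using assms(1) by simp
  qed
  then show ?thesis using assms(2) by simp
qed

lemma transpose_symmetric_perturbation:
  fixes A H :: "real mat"
  assumes "A \<in> carrier_mat M M" "H \<in> carrier_mat M M" "transpose_mat A = A" "transpose_mat H = H"
  shows "transpose_mat (A + s \<cdot>\<^sub>m H) = A + s \<cdot>\<^sub>m H"
proof (rule eq_matI)
  fix i j assume "i < dim_row (A + s \<cdot>\<^sub>m H)" "j < dim_col (A + s \<cdot>\<^sub>m H)"
  then have "i < M" "j < M" using assms(1,2) by auto
  then show "transpose_mat (A + s \<cdot>\<^sub>m H) $$ (i, j) = (A + s \<cdot>\<^sub>m H) $$ (i, j)"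
    using assms(1,2) symmetric_index[OF assms(3,1), of i j] symmetric_index[OF assms(4,2), of i j] by simp
qed (use assms(1,2) in auto)

text \<open>The corner block is alone on its block diagonal and lies outside the prescribed block, so its entries
may be varied freely without leaving the feasible set.\<close>

lemma TME_inverse_corner:
  assumes sol: "TME_solution m n T N A" and N: "n + 2 \<le> N"
    and B: "B \<in> carrier_mat (m * N) (m * N)" "A * B = 1\<^sub>m (m * N)" and a: "a < m" and b: "b < m"
  shows "B $$ (a, m * (N - 1) + b) = 0"
proof -
  let ?M = "m * N"
  define e where "e = m * (N - 1) + b"
  have m: "0 < m" using a by simp
  have N': "m * N = m * (N - 1) + m" using N by (cases N) auto
  have le: "m * (n + 1) \<le> m * (N - 1)" by (rule mult_le_mono2) (use N in simp)
  have e: "e < ?M" "m * (n + 1) \<le> e" "a < m * (n + 1)" unfolding e_def using N' le b a m by (auto intro: less_le_trans)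
  have ae: "a < ?M" "a \<noteq> e" using e by auto
  have feas: "TME_feasible m n T N A" and opt: "\<not> (\<exists>y. TME_feasible m n T N y \<and> ln (det A) < ln (det y))"
    using sol unfolding TME_solution_def is_arg_max_def by auto
  have A: "A \<in> carrier_mat ?M ?M" "transpose_mat A = A" "positive_definite A"
    and AT: "transpose_mat (E_mat m n N) * A * E_mat m n N = T" and bt: "block_toeplitz m N A"
    using feas unfolding TME_feasible_def sym_mats_def by auto
  \<comment> \<open>the position \<open>(a, e)\<close> lies in the upper right corner block\<close>
  define H where "H = mat ?M ?M (\<lambda>(i, j). (if i = a \<and> j = e then 1 else 0) + (if i = e \<and> j = a then 1 else 0) :: real)"
  have Hc: "H \<in> carrier_mat ?M ?M" unfolding H_def by simp
  have Hij: "H $$ (i, j) = (if i = a \<and> j = e then 1 else 0) + (if i = e \<and> j = a then 1 else 0)" if "i < ?M" "j < ?M" for i j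
    using that by (simp add: H_def)
  have Hs: "transpose_mat H = H"
  proof (rule eq_matI)
    fix i j assume "i < dim_row H" "j < dim_col H"
    then have "i < ?M" "j < ?M" using Hc by auto
    then show "transpose_mat H $$ (i, j) = H $$ (i, j)"
      using Hc Hij[of i j] Hij[of j i] by (simp add: add.commute conj_commute)
  qed (use Hc in auto)
  note H = Hc Hs
  have "(\<Sum>i<?M. \<Sum>j<?M. B $$ (i, j) * H $$ (j, i)) = 0"
  proof (rule ln_det_stationary[OF A(1,3) H B])
    fix s assume pd: "positive_definite (A + s \<cdot>\<^sub>m H)"
    have AH: "A + s \<cdot>\<^sub>m H \<in> carrier_mat ?M ?M" using A H by auto
    have "TME_feasible m n T N (A + s \<cdot>\<^sub>m H)"
      unfolding TME_feasible_def sym_mats_def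
    proof (intro conjI CollectI pd AH transpose_symmetric_perturbation[OF A(1) H(1) A(2) H(2)])
      have n1: "n + 1 \<le> N" using N by simp
      have lt: "i < ?M" if "i < m * (n + 1)" for i using that le N' by linarith
      show "transpose_mat (E_mat m n N) * (A + s \<cdot>\<^sub>m H) * E_mat m n N = T"
        unfolding corner_submatrix[OF AH n1] AT[symmetric] corner_submatrix[OF A(1) n1]
      proof (rule eq_matI)
        fix i j assume "i < dim_row (mat (m * (n + 1)) (m * (n + 1)) (\<lambda>(i, j). A $$ (i, j)))"
          "j < dim_col (mat (m * (n + 1)) (m * (n + 1)) (\<lambda>(i, j). A $$ (i, j)))"
        then have ij: "i < m * (n + 1)" "j < m * (n + 1)" by auto
        then have "H $$ (i, j) = 0" using Hij[OF lt lt] e by auto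
        then show "mat (m * (n + 1)) (m * (n + 1)) (\<lambda>(i, j). (A + s \<cdot>\<^sub>m H) $$ (i, j)) $$ (i, j) =
            mat (m * (n + 1)) (m * (n + 1)) (\<lambda>(i, j). A $$ (i, j)) $$ (i, j)"
          using ij lt[OF ij(1)] lt[OF ij(2)] carrier_matD[OF A(1)] carrier_matD[OF H(1)] by simp
      qed auto
      have idx: "m * i + x < ?M" if "i < N" "x < m" for i x
      proof -
        have "m * Suc i \<le> m * N" using that by (intro mult_le_mono2) auto
        then show ?thesis using that by simp
      qed
      have div: "(m * i + x) div m = i" "(m * i + x) mod m = x" if "x < m" for i x using that by auto
      have eq_a: "m * i + x = a \<longleftrightarrow> i = 0 \<and> x = a" if "x < m" for i x
        using div[OF that, of i] a by (metis add.left_neutral div_less mod_less mult_0_right)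
      have eq_e: "m * i + x = e \<longleftrightarrow> i = N - 1 \<and> x = b" if "x < m" for i x
        unfolding e_def using div[OF that, of i] div[OF b, of "N - 1"] by metis
      have Hxy: "H $$ (m * i + x, m * j + y) = (if (i = 0 \<and> x = a) \<and> (j = N - 1 \<and> y = b) then 1 else 0)
          + (if (i = N - 1 \<and> x = b) \<and> (j = 0 \<and> y = a) then 1 else 0)"
        if "i < N" "j < N" "x < m" "y < m" for i j x y
        by (simp only: Hij[OF idx[OF that(1,3)] idx[OF that(2,4)]] eq_a[OF that(3)] eq_a[OF that(4)] eq_e[OF that(3)] eq_e[OF that(4)])
      show "block_toeplitz m N (A + s \<cdot>\<^sub>m H)"
        unfolding block_toeplitz_def block_eq_iff_entries[OF AH]
      proof (intro allI impI)
        fix i j i' j' x y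
        assume ij: "i < N" "j < N" "i' < N" "j' < N" "int j - int i = int j' - int i'" and xy: "x < m" "y < m"
        have "A $$ (m * i + x, m * j + y) = A $$ (m * i' + x, m * j' + y)"
          using bt ij xy unfolding block_toeplitz_def block_eq_iff_entries[OF A(1)] by blast
        moreover have "H $$ (m * i + x, m * j + y) = H $$ (m * i' + x, m * j' + y)"
        proof -
          have "i = 0 \<and> j = N - 1 \<longleftrightarrow> i' = 0 \<and> j' = N - 1" "i = N - 1 \<and> j = 0 \<longleftrightarrow> i' = N - 1 \<and> j' = 0"
            using ij by linarith+
          then show ?thesis
            unfolding Hxy[OF ij(1,2) xy] Hxy[OF ij(3,4) xy] by (intro arg_cong2[of _ _ _ _ "(+)"] if_cong) blast+
        qed
        ultimately show "(A + s \<cdot>\<^sub>m H) $$ (m * i + x, m * j + y) = (A + s \<cdot>\<^sub>m H) $$ (m * i' + x, m * j' + y)"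
          using A(1) H(1) idx ij xy by simp
      qed
    qed
    then show "ln (det (A + s \<cdot>\<^sub>m H)) \<le> ln (det A)" using opt by (meson not_le)
  qed
  also have "(\<Sum>i<?M. \<Sum>j<?M. B $$ (i, j) * H $$ (j, i)) =
      (\<Sum>i<?M. \<Sum>j<?M. B $$ (i, j) * (if j = a \<and> i = e then 1 else 0)) + (\<Sum>i<?M. \<Sum>j<?M. B $$ (i, j) * (if j = e \<and> i = a then 1 else 0))"
    unfolding sum.distrib[symmetric] by (intro sum.cong refl) (simp add: Hij distrib_left)
  also have "\<dots> = B $$ (e, a) + B $$ (a, e)"
    by (simp only: double_delta_sum[OF ae(1) e(1)] double_delta_sum[OF e(1) ae(1)])
  finally show ?thesis
    using symmetric_index[OF symmetric_inverse[OF A(1) B A(2)] B(1) ae(1) e(1)] unfolding e_def by simp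
qed

lemma CME_feasibleD:
  assumes "CME_feasible m n T N X" "0 < m" "n + 1 \<le> N"
  shows "X \<in> carrier_mat (m * N) (m * N)" "transpose_mat X = X" "positive_definite X"
    "shift_invariant m (m * N) X" "T = mat (m * (n + 1)) (m * (n + 1)) (\<lambda>(i, j). X $$ (i, j))"
proof -
  show X: "X \<in> carrier_mat (m * N) (m * N)" "transpose_mat X = X" "positive_definite X"
    using assms(1) unfolding CME_feasible_def sym_mats_def by auto
  show "shift_invariant m (m * N) X"
    using assms(1) shift_conjugation_iff[OF X(1) assms(2)] unfolding CME_feasible_def by blast
  show "T = mat (m * (n + 1)) (m * (n + 1)) (\<lambda>(i, j). X $$ (i, j))"
    using assms(1) corner_submatrix[OF X(1) assms(3)] unfolding CME_feasible_def by simp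
qed

text \<open>Shifting the rows and columns of the inverse gives another inverse of the same matrix.\<close>

lemma inverse_shift_invariant:
  assumes X: "X \<in> carrier_mat M M" "shift_invariant m M X" and Q: "Q \<in> carrier_mat M M" "X * Q = 1\<^sub>m M"
    and M: "M = m * N" "0 < M"
  shows "shift_invariant m M Q"
proof -
  let ?s = "\<lambda>i. (i + m) mod M"
  have s: "?s i < M" for i using M(2) by simp
  define Q' where "Q' = mat M M (\<lambda>(i, j). Q $$ (?s i, ?s j))"
  have Q': "Q' \<in> carrier_mat M M" unfolding Q'_def by simp
  have "X * Q' = 1\<^sub>m M"
  proof (rule eq_matI)
    fix i k assume "i < dim_row (1\<^sub>m M :: real mat)" "k < dim_col (1\<^sub>m M :: real mat)"
    then have i: "i < M" and k: "k < M" by auto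
    have "(X * Q') $$ (i, k) = (\<Sum>j<M. X $$ (i, j) * Q' $$ (j, k))"
      by (rule mat_mult_index_sum[OF X(1) Q' i k])
    also have "\<dots> = (\<Sum>j<M. X $$ (?s i, ?s j) * Q $$ (?s j, ?s k))"
      by (rule sum.cong[OF refl]) (use X(2) i k in \<open>simp add: shift_invariant_def Q'_def\<close>)
    also have "\<dots> = (\<Sum>j<M. X $$ (?s i, j) * Q $$ (j, ?s k))"
      by (rule sum_mod_shift[OF M(2), of "\<lambda>j. X $$ (?s i, j) * Q $$ (j, ?s k)"])
    also have "\<dots> = (X * Q) $$ (?s i, ?s k)" by (rule mat_mult_index_sum[OF X(1) Q(1) s s, symmetric])
    also have "\<dots> = (if i = k then 1 else 0)"
      unfolding Q(2) using s shift_index_inj[OF i k, of m] by auto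
    finally show "(X * Q') $$ (i, k) = 1\<^sub>m M $$ (i, k)" using i k by simp
  qed (use X Q' in auto)
  moreover have QX: "Q * X = 1\<^sub>m M" by (rule mat_mult_left_right_inverse[OF X(1) Q])
  ultimately have "Q' = Q"
    using assoc_mult_mat[OF Q(1) X(1) Q'] Q(1) Q' by simp
  then show ?thesis unfolding shift_invariant_def Q'_def by (auto simp: mat_eq_iff)
qed

text \<open>The admissible directions are the symmetric circulant matrices that vanish at cyclic block
distance at most \<open>n\<close>.  The smallest one that contains the position \<open>(r, c)\<close> sums the symmetric pair of unit matrices over all block
shifts; as the inverse is itself circulant, its inner product with this direction is \<open>2 N\<close> times the entry at \<open>(r, c)\<close>.\<close>

lemma CME_inverse_banded:
  assumes sol: "CME_solution m n T N X" and m: "0 < m" and N: "n + 1 \<le> N"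
    and Q: "Q \<in> carrier_mat (m * N) (m * N)" "X * Q = 1\<^sub>m (m * N)"
    and r: "r < m * N" and c: "c < m * N" and far: "\<not> near m n (m * N) r c"
  shows "Q $$ (r, c) = 0"
proof -
  let ?M = "m * N" and ?w = "m * (n + 1)"
  have feas: "CME_feasible m n T N X" and opt: "\<not> (\<exists>y. CME_feasible m n T N y \<and> ln (det X) < ln (det y))"
    using sol unfolding CME_solution_def is_arg_max_def by auto
  note X = CME_feasibleD[OF feas m N]
  have M0: "0 < ?M" using m N by auto
  have wM: "?w \<le> ?M" by (rule mult_le_mono2[OF N])
  define \<sigma> where "\<sigma> p x = (x + m * p) mod ?M" for p x
  have sM: "\<sigma> p x < ?M" for p x unfolding \<sigma>_def using M0 by simp
  define g where "g p i j = (if i = \<sigma> p r \<and> j = \<sigma> p c then 1 else 0) + (if i = \<sigma> p c \<and> j = \<sigma> p r then 1 else 0 :: real)" for p i j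
  define H where "H = mat ?M ?M (\<lambda>(i, j). \<Sum>p<N. g p i j)"
  have Hc: "H \<in> carrier_mat ?M ?M" unfolding H_def by simp
  have Hij: "H $$ (i, j) = (\<Sum>p<N. g p i j)" if "i < ?M" "j < ?M" for i j using that by (simp add: H_def)
  have gsym: "g p i j = g p j i" for p i j unfolding g_def by (simp add: conj_commute)
  have Hs: "transpose_mat H = H"
  proof (rule eq_matI)
    fix i j assume "i < dim_row H" "j < dim_col H"
    then have "i < ?M" "j < ?M" using Hc by auto
    then show "transpose_mat H $$ (i, j) = H $$ (i, j)"
      using Hc Hij[of i j] Hij[of j i] gsym[of _ i j] by simp
  qed (use Hc in auto)
  have "shift_invariant m ?M H"
    unfolding shift_invariant_def
  proof (intro allI impI)
    fix i j assume i: "i < ?M" and j: "j < ?M"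
    let ?s = "\<lambda>i. (i + m) mod ?M"
    have s: "?s i < ?M" "?s j < ?M" using M0 by auto
    have step: "\<sigma> (p + 1) x = ?s (\<sigma> p x)" for p x
      unfolding \<sigma>_def mod_add_left_eq by (simp add: algebra_simps)
    have wrap: "\<sigma> (p mod N) x = \<sigma> p x" for p x
      unfolding \<sigma>_def by (metis mod_add_right_eq mult_mod_right)
    have shift: "?s i = \<sigma> (p + 1) x \<longleftrightarrow> i = \<sigma> p x" if "i < ?M" for p x i
      unfolding step using shift_index_inj[OF that sM] by blast
    have "H $$ (?s i, ?s j) = (\<Sum>p<N. g p (?s i) (?s j))" by (rule Hij[OF s])
    also have "\<dots> = (\<Sum>p<N. g ((p + 1) mod N) (?s i) (?s j))"
      by (rule sum_mod_shift[symmetric]) (use N in simp)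
    also have "\<dots> = (\<Sum>p<N. g p i j)"
      unfolding g_def wrap shift[OF i] shift[OF j] ..
    also have "\<dots> = H $$ (i, j)" by (rule Hij[OF i j, symmetric])
    finally show "H $$ (?s i, ?s j) = H $$ (i, j)" .
  qed
  note Hshift = this
  have zero: "H $$ (i, j) = 0" if i: "i < ?w" and j: "j < ?w" for i j
  proof -
    have ij: "i < ?M" "j < ?M" using i j wM by linarith+
    have nr: "near m n ?M i j"
      unfolding near_def
    proof (intro exI[of _ "int j"] conjI)
      show "int j mod int ?M = int j" unfolding zmod_int[symmetric] using ij by (simp only: mod_less)
      have "i div m < n + 1" "j div m < n + 1" using div_lt_of_less_mult[OF _ m] i j by blast+
      then show "\<bar>int j div int m - int i div int m\<bar> \<le> int n" by (simp add: zdiv_int[symmetric])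
    qed
    have "g p i j = 0" for p
    proof -
      have n1: "\<not> (i = \<sigma> p r \<and> j = \<sigma> p c)"
        using near_shift[OF m refl c, of n r p] nr far unfolding \<sigma>_def by blast
      have n2: "\<not> (i = \<sigma> p c \<and> j = \<sigma> p r)"
        using near_shift[OF m refl r, of n c p] near_sym[OF m refl c, of n r] nr far unfolding \<sigma>_def by blast
      show ?thesis by (simp only: g_def n1 n2 if_False add_0_left)
    qed
    then show ?thesis unfolding Hij[OF ij] by simp
  qed
  have "(\<Sum>i<?M. \<Sum>j<?M. Q $$ (i, j) * H $$ (j, i)) = 0"
  proof (rule ln_det_stationary[OF X(1,3) Hc Hs Q])
    fix s assume pd: "positive_definite (X + s \<cdot>\<^sub>m H)"
    have XH: "X + s \<cdot>\<^sub>m H \<in> carrier_mat ?M ?M" using X Hc by auto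
    have "CME_feasible m n T N (X + s \<cdot>\<^sub>m H)"
      unfolding CME_feasible_def sym_mats_def
    proof (intro conjI CollectI pd XH transpose_symmetric_perturbation[OF X(1) Hc X(2) Hs])
      show "transpose_mat (E_mat m n N) * (X + s \<cdot>\<^sub>m H) * E_mat m n N = T"
        unfolding corner_submatrix[OF XH N] X(5)
      proof (rule eq_matI)
        fix i j assume "i < dim_row (mat ?w ?w (\<lambda>(i, j). X $$ (i, j)))" "j < dim_col (mat ?w ?w (\<lambda>(i, j). X $$ (i, j)))"
        then have ij: "i < ?w" "j < ?w" by auto
        then have "i < ?M" "j < ?M" using wM by linarith+
        then show "mat ?w ?w (\<lambda>(i, j). (X + s \<cdot>\<^sub>m H) $$ (i, j)) $$ (i, j) = mat ?w ?w (\<lambda>(i, j). X $$ (i, j)) $$ (i, j)"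
          using ij zero[OF ij] carrier_matD[OF X(1)] carrier_matD[OF Hc] by simp
      qed auto
      show "transpose_mat (U_mat m N) * (X + s \<cdot>\<^sub>m H) * U_mat m N = X + s \<cdot>\<^sub>m H"
        unfolding shift_conjugation_iff[OF XH m]
        using X(4) Hshift carrier_matD[OF X(1)] carrier_matD[OF Hc] M0
        unfolding shift_invariant_def by simp
    qed
    then show "ln (det (X + s \<cdot>\<^sub>m H)) \<le> ln (det X)" using opt by (meson not_le)
  qed
  also have "(\<Sum>i<?M. \<Sum>j<?M. Q $$ (i, j) * H $$ (j, i)) = (\<Sum>p<N. Q $$ (c, r) + Q $$ (r, c))"
  proof -
    have "(\<Sum>i<?M. \<Sum>j<?M. Q $$ (i, j) * H $$ (j, i)) = (\<Sum>i<?M. \<Sum>j<?M. \<Sum>p<N. Q $$ (i, j) * g p j i)"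
      by (intro sum.cong refl) (simp add: Hij sum_distrib_left)
    also have "\<dots> = (\<Sum>i<?M. \<Sum>p<N. \<Sum>j<?M. Q $$ (i, j) * g p j i)"
      by (rule sum.cong[OF refl], rule sum.swap)
    also have "\<dots> = (\<Sum>p<N. \<Sum>i<?M. \<Sum>j<?M. Q $$ (i, j) * g p j i)" by (rule sum.swap)
    also have "\<dots> = (\<Sum>p<N. Q $$ (c, r) + Q $$ (r, c))"
    proof (rule sum.cong[OF refl])
      fix p
      have Qs: "Q $$ (\<sigma> p x, \<sigma> p y) = Q $$ (x, y)" if "x < ?M" "y < ?M" for x y
        unfolding \<sigma>_def by (rule shift_invariant_iterate[OF inverse_shift_invariant[OF X(1,4) Q refl M0] refl that])
      have "(\<Sum>i<?M. \<Sum>j<?M. Q $$ (i, j) * g p j i) =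
          (\<Sum>i<?M. \<Sum>j<?M. Q $$ (i, j) * (if j = \<sigma> p r \<and> i = \<sigma> p c then 1 else 0)) +
          (\<Sum>i<?M. \<Sum>j<?M. Q $$ (i, j) * (if j = \<sigma> p c \<and> i = \<sigma> p r then 1 else 0))"
        unfolding g_def distrib_left sum.distrib ..
      also have "\<dots> = Q $$ (\<sigma> p c, \<sigma> p r) + Q $$ (\<sigma> p r, \<sigma> p c)"
        by (simp only: double_delta_sum[OF sM sM])
      also have "\<dots> = Q $$ (c, r) + Q $$ (r, c)" unfolding Qs[OF c r] Qs[OF r c] ..
      finally show "(\<Sum>i<?M. \<Sum>j<?M. Q $$ (i, j) * g p j i) = Q $$ (c, r) + Q $$ (r, c)" .
    qed
    finally show ?thesis .
  qed
  finally show ?thesis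
    using N symmetric_index[OF symmetric_inverse[OF X(1) Q X(2)] Q(1) r c] by simp
qed

text \<open>A pair of indices at cyclic block distance at most \<open>n\<close> can be moved by a common block shift into the leading
\<open>n + 1\<close> blocks: shift the smaller of the two block numbers to \<open>0\<close>.\<close>

lemma shift_invariant_eq_near:
  assumes m: "0 < m" and N: "n + 1 \<le> N" and M: "M = m * N"
    and A: "shift_invariant m M A" and B: "shift_invariant m M B"
    and eq: "\<And>r c. r < m * (n + 1) \<Longrightarrow> c < m * (n + 1) \<Longrightarrow> A $$ (r, c) = B $$ (r, c)"
    and r: "r < M" and c: "c < M" and near: "near m n M r c"
  shows "A $$ (r, c) = B $$ (r, c)"
proof -
  obtain d where d: "d mod int M = int c" "\<bar>d div int m - int r div int m\<bar> \<le> int n"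
    using near unfolding near_def by blast
  define q where "q = min (int r div int m) (d div int m)"
  \<comment> \<open>\<open>q\<close> may be negative, so the shift by \<open>-q\<close> blocks is reduced modulo \<open>N\<close>\<close>
  define p where "p = nat ((- q) mod int N)"
  have N0: "0 < N" using N by simp
  have wM: "m * (n + 1) \<le> M" unfolding M by (rule mult_le_mono2[OF N])
  have p: "int m * int p = (int m * (- q)) mod int M"
    unfolding p_def M using N0 by (simp add: mult_mod_right)
  have range: "0 \<le> x - int m * q \<and> x - int m * q < int (m * (n + 1))"
    if "q \<le> x div int m" "x div int m \<le> q + int n" for x
  proof -
    define y where "y = x mod int m"
    have y: "0 \<le> y" "y < int m" unfolding y_def using m by auto
    have e: "int m * (x div int m) = x - y" unfolding y_def by (simp add: minus_mod_eq_mult_div)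
    define z where "z = int m * q"
    define v where "v = int m * int n"
    have lower: "z \<le> x - y" unfolding z_def e[symmetric] by (rule mult_left_mono[OF that(1)]) simp
    have "int m * (x div int m) \<le> int m * (q + int n)" by (rule mult_left_mono[OF that(2)]) simp
    then have "x - y \<le> z + v" unfolding e distrib_left z_def v_def .
    moreover have "int (m * (n + 1)) = v + int m" unfolding v_def by (simp add: algebra_simps)
    ultimately show ?thesis unfolding z_def[symmetric] using lower y by (simp only:) linarith
  qed
  have rd: "q \<le> int r div int m" "int r div int m \<le> q + int n" "q \<le> d div int m" "d div int m \<le> q + int n"
    using d(2) unfolding q_def by linarith+
  have moved: "int ((y + m * p) mod M) = x - int m * q"
    if y: "x mod int M = int y" and x: "q \<le> x div int m" "x div int m \<le> q + int n" for x y
  proof -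
    have "int ((y + m * p) mod M) = (x mod int M + (int m * (- q)) mod int M) mod int M"
      unfolding y p[symmetric] by (simp add: zmod_int)
    also have "\<dots> = (x - int m * q) mod int M" by (simp add: mod_add_eq)
    also have "\<dots> = x - int m * q"
      by (rule mod_pos_pos_trivial) (use range[OF x] wM in linarith)+
    finally show ?thesis .
  qed
  have rr: "int r mod int M = int r" unfolding zmod_int[symmetric] using r by (simp only: mod_less)
  have "int ((r + m * p) mod M) < int (m * (n + 1))"
    unfolding moved[OF rr rd(1,2)] using range[OF rd(1,2)] by blast
  then have r': "(r + m * p) mod M < m * (n + 1)" by (simp only: of_nat_less_iff)
  have "int ((c + m * p) mod M) < int (m * (n + 1))"
    unfolding moved[OF d(1) rd(3,4)] using range[OF rd(3,4)] by blast
  then have c': "(c + m * p) mod M < m * (n + 1)" by (simp only: of_nat_less_iff)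
  show ?thesis
    using eq[OF r' c'] shift_invariant_iterate[OF A M r c, of p] shift_invariant_iterate[OF B M r c, of p] by simp
qed

section \<open>Convergence of the circulant approximation\<close>

lemma Toepl_index:
  "r < m * N \<Longrightarrow> c < m * N \<Longrightarrow> Toepl m N X $$ (r, c) =
    (if r div m \<le> c div m then X (c div m - r div m) else transpose_mat (X (r div m - c div m))) $$ (r mod m, c mod m)"
  by (simp add: Toepl_def Let_def)

text \<open>Each section of at least \<open>n + 1\<close> blocks solves the Toeplitz problem of its size, which gives positive
definiteness and the vanishing corner.\<close>

lemma toeplitz_kernel_of_extension:
  assumes m: "1 \<le> m" and S0: "transpose_mat (S 0) = S 0" and ext: "max_entropy_toeplitz_extension m n S Sh"
  shows "toeplitz_kernel m n (block_kernel m Sh)"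
proof
  have m0: "0 < m" using m by simp
  have Sh: "Sh k \<in> carrier_mat m m" for k using ext unfolding max_entropy_toeplitz_extension_def by blast
  have sol: "TME_solution m n (T_mat m n S) N (mat (m * N) (m * N) (\<lambda>(i, j). block_kernel m Sh (int i) (int j)))"
    if "n + 1 \<le> N" for N
    using ext that unfolding max_entropy_toeplitz_extension_def Toepl_eq_block_kernel[OF Sh m0, symmetric] by blast
  show "0 < m" by (rule m0)
  show "block_kernel m Sh (r + int m) (c + int m) = block_kernel m Sh r c" for r c
    unfolding block_kernel_def using m0 by simp
  show "block_kernel m Sh r c = block_kernel m Sh c r" for r c
  proof (cases "r div int m = c div int m")
    case True
    have "Sh 0 = S 0" using ext unfolding max_entropy_toeplitz_extension_def by blast
    then have "transpose_mat (Sh 0) = Sh 0" using S0 by simp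
    moreover have "nat (r mod int m) < m" "nat (c mod int m) < m" using m0 by (simp_all add: nat_less_iff)
    ultimately show ?thesis unfolding block_kernel_def using True symmetric_index[OF _ Sh] by simp
  next
    case False
    then show ?thesis unfolding block_kernel_def by auto
  qed
  show "pos_kernel (m * N) (\<lambda>i j. block_kernel m Sh (int i) (int j))" if "n + 1 \<le> N" for N
    using sol[OF that] unfolding TME_solution_def is_arg_max_def TME_feasible_def pos_kernel_iff by blast
  fix N g a b
  assume N: "n + 2 \<le> N" and a: "a < m" and b: "b < m"
    and g: "\<And>i k. i < m * N \<Longrightarrow> k < m * N \<Longrightarrow>
      (\<Sum>j<m * N. g i j * block_kernel m Sh (int j) (int k)) = (if i = k then 1 else 0 :: real)"
  let ?A = "mat (m * N) (m * N) (\<lambda>(i, j). block_kernel m Sh (int i) (int j))"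
  let ?B = "mat (m * N) (m * N) (\<lambda>(i, j). g i j)"
  have BA: "?B * ?A = 1\<^sub>m (m * N)"
  proof (rule eq_matI)
    fix i k assume "i < dim_row (1\<^sub>m (m * N) :: real mat)" "k < dim_col (1\<^sub>m (m * N) :: real mat)"
    then have i: "i < m * N" and k: "k < m * N" by auto
    have "(?B * ?A) $$ (i, k) = (\<Sum>j<m * N. ?B $$ (i, j) * ?A $$ (j, k))"
      by (rule mat_mult_index_sum[OF _ _ i k]) auto
    also have "\<dots> = (\<Sum>j<m * N. g i j * block_kernel m Sh (int j) (int k))"
      by (rule sum.cong[OF refl]) (use i k in simp)
    finally show "(?B * ?A) $$ (i, k) = 1\<^sub>m (m * N) $$ (i, k)" using g[OF i k] i k by simp
  qed auto
  have AB: "?A * ?B = 1\<^sub>m (m * N)" by (rule mat_mult_left_right_inverse[OF _ _ BA]) auto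
  have "n + 1 \<le> N" using N by simp
  from TME_inverse_corner[OF sol[OF this] N _ AB a b]
  have "?B $$ (a, m * (N - 1) + b) = 0" by simp
  moreover have "m * N = m * (N - 1) + m" using N by (cases N) auto
  ultimately show "g a (m * (N - 1) + b) = 0" using a b m0 by simp
qed

context toeplitz_kernel
begin

text \<open>Two blocks out of \<open>N\<close> differ by less than \<open>N\<close>, and the truncation keeps differences of at most \<open>N/2\<close>, so no more than the three
representatives next to \<open>c\<close> can contribute.\<close>

lemma circ_index:
  assumes N: "0 < N" and r: "r < m * N" and c: "c < m * N"
  shows "circ N $$ (r, c) = trunc (N div 2) (int r) (int c - int (m * N))
    + trunc (N div 2) (int r) (int c) + trunc (N div 2) (int r) (int c + int (m * N))"
proof -
  let ?M = "m * N" and ?h = "N div 2"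
  define I where "I = {int r - int m * int (?h + 1)..int r + int m * int (?h + 1)}"
  have M: "0 < int ?M" using N m_pos by simp
  have i: "int r div int m < int N" "0 \<le> int r div int m" and j: "int c div int m < int N" "0 \<le> int c div int m"
    using div_lt_of_less_mult[OF r m_pos] div_lt_of_less_mult[OF c m_pos] by (simp_all add: zdiv_int[symmetric])
  have "circ N $$ (r, c) = (\<Sum>d\<in>{d \<in> I. d mod int ?M = int c}. trunc ?h (int r) d)"
    unfolding circ_def I_def using r c by (simp add: wrap_def)
  also have "\<dots> = (\<Sum>d\<in>{int c - int ?M, int c, int c + int ?M}. trunc ?h (int r) d)"
  proof (rule sum.mono_neutral_cong)
    have "finite I" unfolding I_def by simp
    then show "finite {d \<in> I. d mod int ?M = int c}" by simp
    fix d assume d: "d \<in> {int c - int ?M, int c, int c + int ?M} - {d \<in> I. d mod int ?M = int c}"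
    have cm: "int c mod int ?M = int c" unfolding zmod_int[symmetric] using c by (simp only: mod_less)
    have "d mod int ?M = int c" using d cm mod_mult_self2[of "int c" "int ?M" "-1"] mod_mult_self2[of "int c" "int ?M" 1] by auto
    then have "d \<notin> I" using d by blast
    then show "trunc ?h (int r) d = 0" using banded_trunc[of ?h] unfolding banded_def I_def by fastforce
  next
    fix d assume d: "d \<in> {d \<in> I. d mod int ?M = int c} - {int c - int ?M, int c, int c + int ?M}"
    define k where "k = d div int ?M"
    have dk: "d = int c + int ?M * k" using d mult_div_mod_eq[of "int ?M" d] unfolding k_def by simp
    have dd: "d div int m = int c div int m + int N * k"
      unfolding dk using div_add_mult[OF m_pos, of "int c" "int N * k"] by (simp add: mult.assoc)
    have "k \<noteq> 0" "k \<noteq> 1" "k \<noteq> -1" using d dk by auto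
    then have "2 \<le> k \<or> k \<le> -2" by linarith
    then have "int N * 2 \<le> int N * k \<or> int N * k \<le> int N * (-2)" by (metis mult_left_mono of_nat_0_le_iff)
    moreover have "int ?h \<le> int N" by simp
    ultimately have "int ?h < \<bar>d div int m - int r div int m\<bar>"
      unfolding dd using i j N by linarith
    then show "trunc ?h (int r) d = 0" unfolding trunc_def by simp
  qed auto
  also have "\<dots> = trunc ?h (int r) (int c - int ?M) + trunc ?h (int r) (int c) + trunc ?h (int r) (int c + int ?M)"
  proof -
    have "sum f {x - p, x, x + p} = f (x - p) + f x + f (x + p)" if "0 < p" for f :: "int \<Rightarrow> real" and x p
      using that by simp
    from this[OF M] show ?thesis .
  qed
  finally show ?thesis .
qed

lemma circ_sym: "0 < N \<Longrightarrow> transpose_mat (circ N) = circ N"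
proof -
  assume N: "0 < N"
  have "transpose_mat (circ N) = wrap (m * N) (int m * int (N div 2 + 1)) (\<lambda>r c. trunc (N div 2) c r)"
    unfolding circ_def
    by (rule wrap_transpose) (use N m_pos trunc_shift in \<open>auto intro!: periodic_of_shift\<close>)
  then show ?thesis unfolding circ_def by (simp only: trunc_sym[of "N div 2"])
qed

lemma circ_shift_invariant: "0 < N \<Longrightarrow> shift_invariant m (m * N) (circ N)"
  unfolding shift_invariant_def circ_def
  by (intro allI impI wrap_shift[OF refl _ trunc_shift banded_trunc]) (use m_pos in auto)

lemma circ_corner:
  assumes N: "2 * n + 2 \<le> N" and r: "r < w" and c: "c < w"
  shows "circ N $$ (r, c) = t (int r) (int c)"
proof -
  have wM: "w \<le> m * N" unfolding w_def by (rule mult_le_mono2) (use N in simp)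
  have b: "int r div int m \<le> int n" "0 \<le> int r div int m" "int c div int m \<le> int n" "0 \<le> int c div int m"
    using div_lt_of_less_mult[OF r[unfolded w_def] m_pos] div_lt_of_less_mult[OF c[unfolded w_def] m_pos]
    by (simp_all add: zdiv_int[symmetric])
  have N2: "int n \<le> int (N div 2)" "int (N div 2) < int N - int n" using N by linarith+
  have d: "(int c - int (m * N)) div int m = int c div int m - int N" "(int c + int (m * N)) div int m = int c div int m + int N"
    using div_add_mult[OF m_pos, of "int c" "- int N"] div_add_mult[OF m_pos, of "int c" "int N"] by simp_all
  have "trunc (N div 2) (int r) (int c - int (m * N)) = 0" "trunc (N div 2) (int r) (int c + int (m * N)) = 0"
    unfolding trunc_def d using b N2 by auto
  moreover have "trunc (N div 2) (int r) (int c) = t (int r) (int c)"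
    unfolding trunc_def using b N2 by auto
  ultimately show ?thesis
    using circ_index[of N r c] N r c wM by simp
qed

end

lemma circulant_approx_eq_circ:
  assumes "toeplitz_kernel m n (block_kernel m Sh)" and Sh: "\<And>k. Sh k \<in> carrier_mat m m" and N: "0 < N"
  shows "circulant_approx m Sh N = toeplitz_kernel.circ m (block_kernel m Sh) N"
proof -
  interpret toeplitz_kernel m n "block_kernel m Sh" by (rule assms(1))
  let ?h = "N div 2"
  define X where "X = (\<lambda>k. if even N then (if k < ?h then transpose_mat (Sh k) else if k = ?h then transpose_mat (Sh k) + Sh k else Sh (N - k))
    else if k \<le> ?h then transpose_mat (Sh k) else Sh (N - k))"
  have approx: "circulant_approx m Sh N = Toepl m N X"
  proof (cases "even N")
    case False
    then have "(N - 1) div 2 = ?h" by presburger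
    then show ?thesis using False unfolding circulant_approx_def X_def by simp
  qed (simp add: circulant_approx_def X_def)
  have X: "X k $$ (x, y) = (if k \<le> ?h then Sh k $$ (y, x) else 0) + (if N \<le> k + ?h then Sh (N - k) $$ (x, y) else 0)"
    if "x < m" "y < m" "k < N" for k x y
  proof (cases "even N")
    case True
    then have "N = 2 * ?h" by simp
    then show ?thesis using that True carrier_matD[OF Sh] unfolding X_def by auto
  next
    case False
    then have "N \<le> k + ?h \<longleftrightarrow> \<not> k \<le> ?h" by presburger
    then show ?thesis using that False carrier_matD[OF Sh] unfolding X_def by auto
  qed
  have Xd: "dim_row (X k) = m" "dim_col (X k) = m" for k using carrier_matD[OF Sh] unfolding X_def by auto
  show ?thesis
    unfolding approx
  proof (rule eq_matI)
    fix r c assume "r < dim_row (circ N)" "c < dim_col (circ N)"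
    then have r: "r < m * N" and c: "c < m * N" using circ_carrier[of N] by auto
    define i j x y where ijxy: "i = r div m" "j = c div m" "x = r mod m" "y = c mod m"
    have ij: "i < N" "j < N" unfolding ijxy using div_lt_of_less_mult m_pos r c by auto
    have xy: "x < m" "y < m" unfolding ijxy using m_pos by auto
    have div: "int r div int m = int i" "int c div int m = int j" "int r mod int m = int x" "int c mod int m = int y"
      unfolding ijxy by (simp_all add: zdiv_int zmod_int)
    have cM: "(int c - int (m * N)) div int m = int j - int N" "(int c + int (m * N)) div int m = int j + int N"
      "(int c - int (m * N)) mod int m = int y" "(int c + int (m * N)) mod int m = int y"
    proof -
      show "(int c - int (m * N)) div int m = int j - int N" "(int c + int (m * N)) div int m = int j + int N"
        using div_add_mult[OF m_pos, of "int c" "- int N"] div_add_mult[OF m_pos, of "int c" "int N"] div by simp_all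
      show "(int c - int (m * N)) mod int m = int y" "(int c + int (m * N)) mod int m = int y"
        using mod_mult_self2[of "int c" "int m" "- int N"] mod_mult_self2[of "int c" "int m" "int N"] div by simp_all
    qed
    show "Toepl m N X $$ (r, c) = circ N $$ (r, c)"
    proof (cases "i \<le> j")
      case True
      have "Toepl m N X $$ (r, c) = X (j - i) $$ (x, y)"
        using Toepl_index[OF r c, of X] True unfolding ijxy by simp
      also have "\<dots> = (if j - i \<le> ?h then Sh (j - i) $$ (y, x) else 0) + (if N \<le> (j - i) + ?h then Sh (N - (j - i)) $$ (x, y) else 0)"
        by (rule X[OF xy]) (use ij in simp)
      finally have e1: "Toepl m N X $$ (r, c) =
          (if j - i \<le> ?h then Sh (j - i) $$ (y, x) else 0) + (if N \<le> (j - i) + ?h then Sh (N - (j - i)) $$ (x, y) else 0)" .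
      have e2: "(if j - i \<le> ?h then Sh (j - i) $$ (y, x) else 0) = trunc ?h (int r) (int c)"
        unfolding trunc_def block_kernel_def div using True by (auto simp: nat_diff_distrib')
      have e3: "(if N \<le> (j - i) + ?h then Sh (N - (j - i)) $$ (x, y) else 0) = trunc ?h (int r) (int c - int (m * N))"
      proof -
        have "nat (int i - (int j - int N)) = N - (j - i)" using True ij by linarith
        moreover have "\<not> int i \<le> int j - int N" using ij by linarith
        moreover have "\<bar>int j - int N - int i\<bar> \<le> int ?h \<longleftrightarrow> N \<le> (j - i) + ?h" using True ij by linarith
        ultimately show ?thesis unfolding trunc_def block_kernel_def div cM by simp
      qed
      have e4: "trunc ?h (int r) (int c + int (m * N)) = 0"
      proof -
        have "?h < N" using N by simp
        then have "\<not> \<bar>int j + int N - int i\<bar> \<le> int ?h" using True by linarith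
        then show ?thesis unfolding trunc_def div cM by simp
      qed
      show ?thesis unfolding e1 e2 e3 circ_index[OF N r c] using e4 by simp
    next
      case False
      have "Toepl m N X $$ (r, c) = X (i - j) $$ (y, x)"
        using Toepl_index[OF r c, of X] False xy Xd unfolding ijxy by simp
      also have "\<dots> = (if i - j \<le> ?h then Sh (i - j) $$ (x, y) else 0) + (if N \<le> (i - j) + ?h then Sh (N - (i - j)) $$ (y, x) else 0)"
        by (rule X[OF xy(2,1)]) (use ij in simp)
      finally have e1: "Toepl m N X $$ (r, c) =
          (if i - j \<le> ?h then Sh (i - j) $$ (x, y) else 0) + (if N \<le> (i - j) + ?h then Sh (N - (i - j)) $$ (y, x) else 0)" .
      have e2: "(if i - j \<le> ?h then Sh (i - j) $$ (x, y) else 0) = trunc ?h (int r) (int c)"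
        unfolding trunc_def block_kernel_def div using False by (auto simp: nat_diff_distrib')
      have e3: "(if N \<le> (i - j) + ?h then Sh (N - (i - j)) $$ (y, x) else 0) = trunc ?h (int r) (int c + int (m * N))"
      proof -
        have "nat (int j + int N - int i) = N - (i - j)" using False ij by linarith
        moreover have "int i \<le> int j + int N" using ij by linarith
        moreover have "\<bar>int j + int N - int i\<bar> \<le> int ?h \<longleftrightarrow> N \<le> (i - j) + ?h" using False ij by linarith
        ultimately show ?thesis unfolding trunc_def block_kernel_def div cM by simp
      qed
      have e4: "trunc ?h (int r) (int c - int (m * N)) = 0"
      proof -
        have "?h < N" using N by simp
        then have "\<not> \<bar>int j - int N - int i\<bar> \<le> int ?h" using False by linarith
        then show ?thesis unfolding trunc_def div cM by simp
      qed
      show ?thesis unfolding e1 e2 e3 circ_index[OF N r c] using e4 by simp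
    qed
  qed (use carrier_matD[OF circ_carrier[of N]] in \<open>simp_all add: Toepl_def\<close>)
qed

theorem theorem3p1:
  fixes m n :: nat and S Sh :: "nat \<Rightarrow> real mat"
  assumes "m \<ge> 1"
    and "\<And>k. k \<le> n \<Longrightarrow> S k \<in> carrier_mat m m"
    and "transpose_mat (S 0) = S 0"
    and "positive_definite (T_mat m n S)"
    and "max_entropy_toeplitz_extension m n S Sh"
  shows "(\<forall>\<^sub>F N in sequentially. positive_definite (circulant_approx m Sh N)) \<and>
    (\<forall>So :: nat \<Rightarrow> real mat.
       (\<forall>\<^sub>F N in sequentially. CME_solution m n (T_mat m n S) N (So N)) \<longrightarrow>
       (\<lambda>N. spectral_norm (circulant_approx m Sh N - So N)) \<longlonglongrightarrow> 0)"
proof -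
  have m: "0 < m" using assms(1) by simp
  have Sh: "Sh k \<in> carrier_mat m m" and ShS: "k \<le> n \<Longrightarrow> Sh k = S k" for k
    using assms(5) unfolding max_entropy_toeplitz_extension_def by auto
  have kernel: "toeplitz_kernel m n (block_kernel m Sh)"
    by (rule toeplitz_kernel_of_extension[OF assms(1,3,5)])
  interpret toeplitz_kernel m n "block_kernel m Sh" by (rule kernel)
  have approx: "circulant_approx m Sh N = circ N" if "0 < N" for N
    by (rule circulant_approx_eq_circ[OF kernel Sh that])
  have T: "T_mat m n S = mat w w (\<lambda>(i, j). block_kernel m Sh (int i) (int j))"
  proof -
    have "T_mat m n S = Toepl m (n + 1) (\<lambda>k. transpose_mat (Sh k))"
      unfolding T_mat_def
    proof (rule eq_matI)
      fix r c assume "r < dim_row (Toepl m (n + 1) (\<lambda>k. transpose_mat (Sh k)))" "c < dim_col (Toepl m (n + 1) (\<lambda>k. transpose_mat (Sh k)))"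
      then have r: "r < m * (n + 1)" and c: "c < m * (n + 1)" by (simp_all add: Toepl_def)
      have "r div m \<le> n" "c div m \<le> n"
        using div_lt_of_less_mult[OF r m] div_lt_of_less_mult[OF c m] by simp_all
      then have "Sh (c div m - r div m) = S (c div m - r div m)" "Sh (r div m - c div m) = S (r div m - c div m)"
        using ShS by simp_all
      then show "Toepl m (n + 1) (\<lambda>k. transpose_mat (S k)) $$ (r, c) = Toepl m (n + 1) (\<lambda>k. transpose_mat (Sh k)) $$ (r, c)"
        unfolding Toepl_index[OF r c] by simp
    qed (simp_all add: Toepl_def)
    then show ?thesis unfolding Toepl_eq_block_kernel[OF Sh m] w_def .
  qed
  obtain L \<Lambda> K \<eta> where eta: "\<eta> \<longlonglongrightarrow> 0" and Lam: "0 < \<Lambda>" and K: "0 < K"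
    and L: "\<And>N. L N \<in> carrier_mat (m * N) (m * N)"
    and bL: "\<And>N. 0 < N \<Longrightarrow> op_bound (L N) \<Lambda>"
    and bC: "\<And>N. 0 < N \<Longrightarrow> op_bound (circ N) K"
    and fact: "\<And>N. 0 < N \<Longrightarrow> \<exists>E \<in> carrier_mat (m * N) (m * N).
       L N * circ N * transpose_mat (L N) = 1\<^sub>m (m * N) + E \<and> op_bound E (\<eta> N)"
    and Rshift: "\<And>N. 0 < N \<Longrightarrow> shift_invariant m (m * N) (transpose_mat (L N) * L N)"
    and Rband: "\<And>N r c. 0 < N \<Longrightarrow> r < m * N \<Longrightarrow> c < m * N \<Longrightarrow> (transpose_mat (L N) * L N) $$ (r, c) \<noteq> 0 \<Longrightarrow>
       near m n (m * N) r c"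
    by (rule approximate_factorization) blast
  have eta_ev: "\<forall>\<^sub>F N in sequentially. \<eta> N \<le> 1 / 2"
    using order_tendstoD(2)[OF eta, of "1 / 2"] by (auto elim: eventually_mono)
  have pd: "\<forall>\<^sub>F N in sequentially. positive_definite (circulant_approx m Sh N)"
    using eta_ev eventually_gt_at_top[of 0]
  proof eventually_elim
    case (elim N)
    then obtain E where E: "E \<in> carrier_mat (m * N) (m * N)"
      "L N * circ N * transpose_mat (L N) = 1\<^sub>m (m * N) + E" "op_bound E (\<eta> N)"
      using fact by blast
    have "positive_definite (circ N)"
      by (rule factor_inverse[OF L circ_carrier E elim(1) bC[OF elim(2)] circ_sym[OF elim(2)]])
    then show ?case using approx[OF elim(2)] by simp
  qed
  have lim: "(\<lambda>N. spectral_norm (circulant_approx m Sh N - So N)) \<longlonglongrightarrow> 0"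
    if sol: "\<forall>\<^sub>F N in sequentially. CME_solution m n (T_mat m n S) N (So N)" for So
  proof -
    \<comment> \<open>the quantities of \<open>circulant_stability\<close>, all of them multiples of \<open>\<eta>\<close>\<close>
    define \<delta> where "\<delta> N = 2 * K * \<eta> N * real m * real ((2 * n + 1) * m) * \<Lambda>\<^sup>2" for N
    have "\<delta> \<longlonglongrightarrow> 2 * K * 0 * real m * real ((2 * n + 1) * m) * \<Lambda>\<^sup>2"
      unfolding \<delta>_def by (intro tendsto_intros eta)
    then have delta: "\<delta> \<longlonglongrightarrow> 0" by simp
    have "(\<lambda>N. 2 * K * (2 * \<delta> N * \<Lambda>\<^sup>2)) \<longlonglongrightarrow> 2 * K * (2 * 0 * \<Lambda>\<^sup>2)" by (intro tendsto_intros delta)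
    then have delta': "(\<lambda>N. 2 * K * (2 * \<delta> N * \<Lambda>\<^sup>2)) \<longlonglongrightarrow> 0" by simp
    define \<epsilon> where "\<epsilon> N = 2 * K * \<eta> N + 8 * K\<^sup>2 * (2 * \<delta> N * \<Lambda>\<^sup>2)" for N
    have "\<epsilon> \<longlonglongrightarrow> 2 * K * 0 + 8 * K\<^sup>2 * (2 * 0 * \<Lambda>\<^sup>2)"
      unfolding \<epsilon>_def by (intro tendsto_intros eta delta)
    then have eps: "\<epsilon> \<longlonglongrightarrow> 0" by simp
    have "\<forall>\<^sub>F N in sequentially. \<delta> N \<le> 1 / 2" "\<forall>\<^sub>F N in sequentially. 2 * K * (2 * \<delta> N * \<Lambda>\<^sup>2) \<le> 1 / 2"
      using order_tendstoD(2)[OF delta, of "1 / 2"] order_tendstoD(2)[OF delta', of "1 / 2"]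
      by (auto elim: eventually_mono)
    with sol eta_ev eventually_ge_at_top[of "2 * n + 2"]
    have "\<forall>\<^sub>F N in sequentially. op_bound (circulant_approx m Sh N - So N) (\<epsilon> N)"
    proof eventually_elim
      case (elim N)
      let ?M = "m * N"
      have N: "0 < N" "n + 1 \<le> N" and M0: "0 < ?M" using elim(3) m by auto
      have feas: "CME_feasible m n (T_mat m n S) N (So N)"
        using elim(1) unfolding CME_solution_def is_arg_max_def by blast
      note X = CME_feasibleD[OF feas m N(2)]
      obtain Q where Q: "Q \<in> carrier_mat ?M ?M" "So N * Q = 1\<^sub>m ?M"
        using positive_definite_inverse[OF X(1,3)] by metis
      obtain E where E: "E \<in> carrier_mat ?M ?M"
        "L N * circ N * transpose_mat (L N) = 1\<^sub>m ?M + E" "op_bound E (\<eta> N)"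
        using fact[OF N(1)] by blast
      have corner_eq: "So N $$ (r, c) = circ N $$ (r, c)" if "r < m * (n + 1)" "c < m * (n + 1)" for r c
      proof -
        have rc: "r < w" "c < w" using that unfolding w_def by auto
        have "So N $$ (r, c) = T_mat m n S $$ (r, c)" unfolding X(5) using that by simp
        also have "\<dots> = block_kernel m Sh (int r) (int c)" unfolding T using rc by simp
        also have "\<dots> = circ N $$ (r, c)" by (rule circ_corner[OF elim(3) rc, symmetric])
        finally show ?thesis .
      qed
      have "op_bound (circ N - So N) (\<epsilon> N)"
        unfolding \<epsilon>_def
      proof (rule circulant_stability[OF refl m N(1) L circ_carrier circ_sym[OF N(1)] E elim(2) bL[OF N(1)] Lam bC[OF N(1)] K
            Rshift[OF N(1)] Rband[OF N(1)] X(1,3) _ Q inverse_shift_invariant[OF X(1,4) Q refl M0] _ \<delta>_def elim(4,5)])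
        show "So N $$ (r, c) = circ N $$ (r, c)" if "r < ?M" "c < ?M" "near m n ?M r c" for r c
          by (rule shift_invariant_eq_near[OF m N(2) refl X(4) circ_shift_invariant[OF N(1)] corner_eq that])
        show "near m n ?M r c" if "r < ?M" "c < ?M" "Q $$ (r, c) \<noteq> 0" for r c
          using CME_inverse_banded[OF elim(1) m N(2) Q that(1,2)] that(3) by blast
      qed
      then show ?case using approx[OF N(1)] by simp
    qed
    then have "\<forall>\<^sub>F N in sequentially. 0 \<le> spectral_norm (circulant_approx m Sh N - So N)"
      "\<forall>\<^sub>F N in sequentially. spectral_norm (circulant_approx m Sh N - So N) \<le> \<epsilon> N"
      by (auto elim: eventually_mono intro: spectral_norm_bounds)
    then show ?thesis by (rule tendsto_sandwich[OF _ _ tendsto_const eps])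
  qed
  show ?thesis using pd lim by blast
qed

end
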